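(* Let $\Omega$, $\{\mathcal T_h\}_{h>0}$, $\mathcal N_h$, $Q_h$, $\boldsymbol U_h$, $i_{Q_h}$ be as in the context (including the standing assumption there on the initial datum). There exists a constant $C>0$, independent of $h$ and of $\boldsymbol u_h$, such that for every $h$ and every $\boldsymbol u_h\in\boldsymbol U_h$ with $|\boldsymbol u_h(\boldsymbol a)|=1$ for all $\boldsymbol a\in\mathcal N_h$, $$\frac{C}{1+\|\nabla\boldsymbol u_h\|}\le\inf_{q_h\in Q_h\setminus\{0\}}\ \sup_{\bar{\boldsymbol u}_h\in\boldsymbol U_h\setminus\{\boldsymbol 0\}}\frac{(q_h,i_{Q_h}(\boldsymbol u_h\cdot\bar{\boldsymbol u}_h))}{\|q_h\|_{(H^1(\Omega)\cap L^\infty(\Omega))'}\,\big(\|\nabla\bar{\boldsymbol u}_h\|+\|\bar{\boldsymbol u}_h\|_{\boldsymbol L^\infty(\Omega)}\big)} .$$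
   Context: $M\in\{2,3\}$; $\Omega\subset\mathbb R^M$ is a bounded domain with polygonal/polyhedral Lipschitz boundary; $\{\mathcal T_h\}_{h>0}$ is a shape-regular, quasi-uniform family of conforming triangulations of $\overline\Omega$ into triangles ($M=2$) or tetrahedra ($M=3$), $h=\max_{K\in\mathcal T_h}\operatorname{diam}K$; $\mathcal N_h$ is the set of all nodes (vertices) of $\mathcal T_h$. $X_h=\{v_h\in C^0(\overline\Omega): v_h|_K \text{ is a polynomial of degree}\le 1\ \forall K\in\mathcal T_h\}$ with nodal (Lagrange) basis $\{\varphi_{\boldsymbol a}\}_{\boldsymbol a\in\mathcal N_h}$; $Q_h=X_h$, $\boldsymbol U_h=(X_h)^M$. $i_{Q_h}:C^0(\overline\Omega)\to Q_h$ is nodal interpolation, $i_{Q_h}(f)=\sum_{\boldsymbol a}f(\boldsymbol a)\varphi_{\boldsymbol a}$. $(\cdot,\cdot)$ and $\|\cdot\|$ are the $L^2(\Omega)$ inner product and norm (for scalars, vectors, matrices). For $q_h\in Q_h$, $$\|q_h\|_{(H^1(\Omega)\cap L^\infty(\Omega))'}=\sup_{q\in H^1(\Omega)\cap L^\infty(\Omega)\setminus\{0\}}\frac{(q_h,q)}{\|\nabla q\|+\|q\|_{L^\infty(\Omega)}} .$$ Standing assumption (initial datum; it does not otherwise appear in the claim): $\boldsymbol u_0\in\boldsymbol H^1(\Omega)$, $|\boldsymbol u_0|=1$ a.e., and $\boldsymbol u_{0h}\in\boldsymbol U_h$ satisfies $|\boldsymbol u_{0h}(\boldsymbol a)|=1$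 for all $\boldsymbol a\in\mathcal N_h$ and $\|\nabla\boldsymbol u_{0h}\|\le\|\nabla\boldsymbol u_0\|$. *)

theory Defs
  imports "HOL-Analysis.Analysis" "HOL-Probability.Essential_Supremum"
begin

section \<open>The domain\<close>

definition polyhedral_boundary :: "(real^'n) set \<Rightarrow> bool" where
  "polyhedral_boundary \<Omega> \<longleftrightarrow>
     (\<exists>\<F>. finite \<F> \<and> (\<forall>F\<in>\<F>. polytope F \<and> aff_dim F = int CARD('n) - 1) \<and> frontier \<Omega> = \<Union>\<F>)"

text \<open>Near each boundary point, the set is the strict epigraph of a Lipschitz function in some
  direction \<open>e\<close>: the height of \<open>y\<close> is \<open>y \<bullet> e\<close>, and \<open>y - (y \<bullet> e) *\<^sub>R e\<close> is its projection onto
  the hyperplane orthogonal to \<open>e\<close>, on which the function lives.\<close>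

definition lipschitz_boundary :: "(real^'n) set \<Rightarrow> bool" where
  "lipschitz_boundary \<Omega> \<longleftrightarrow>
     (\<forall>x\<in>frontier \<Omega>. \<exists>r>0. \<exists>e \<gamma> L. norm e = 1 \<and> L-lipschitz_on {z. z \<bullet> e = 0} \<gamma> \<and>
        \<Omega> \<inter> ball x r = {y \<in> ball x r. \<gamma> (y - (y \<bullet> e) *\<^sub>R e) < y \<bullet> e})"

definition polyhedral_lipschitz_domain :: "(real^'n) set \<Rightarrow> bool" where
  "polyhedral_lipschitz_domain \<Omega> \<longleftrightarrow>
     open \<Omega> \<and> connected \<Omega> \<and> \<Omega> \<noteq> {} \<and> bounded \<Omega> \<and> polyhedral_boundary \<Omega> \<and> lipschitz_boundary \<Omega>"


section \<open>Lebesgue and Sobolev spaces\<close>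

text \<open>Elements of the spaces are functions, not classes modulo null sets; only their values on
  \<open>\<Omega>\<close> matter.\<close>

definition L2_space :: "(real^'n) set \<Rightarrow> (real^'n \<Rightarrow> 'b::euclidean_space) set" where
  "L2_space \<Omega> = {f \<in> borel_measurable (lebesgue_on \<Omega>). integrable (lebesgue_on \<Omega>) (\<lambda>x. (norm (f x))\<^sup>2)}"

definition L2_inner :: "(real^'n) set \<Rightarrow> (real^'n \<Rightarrow> 'b::euclidean_space) \<Rightarrow> (real^'n \<Rightarrow> 'b) \<Rightarrow> real" where
  "L2_inner \<Omega> f g = (LINT x|lebesgue_on \<Omega>. f x \<bullet> g x)"

definition L2_norm :: "(real^'n) set \<Rightarrow> (real^'n \<Rightarrow> 'b::euclidean_space) \<Rightarrow> real" where
  "L2_norm \<Omega> f = sqrt (L2_inner \<Omega> f f)"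

definition Linf_space :: "(real^'n) set \<Rightarrow> (real^'n \<Rightarrow> 'b::euclidean_space) set" where
  "Linf_space \<Omega> = {f \<in> borel_measurable (lebesgue_on \<Omega>).
     esssup (lebesgue_on \<Omega>) (\<lambda>x. ereal (norm (f x))) < \<infinity>}"

definition Linf_norm :: "(real^'n) set \<Rightarrow> (real^'n \<Rightarrow> 'b::euclidean_space) \<Rightarrow> real" where
  "Linf_norm \<Omega> f = real_of_ereal (esssup (lebesgue_on \<Omega>) (\<lambda>x. ereal (norm (f x))))"

definition partial_deriv :: "'n \<Rightarrow> (real^'n \<Rightarrow> real) \<Rightarrow> real^'n \<Rightarrow> real" where
  "partial_deriv i f x = frechet_derivative f (at x) (axis i 1)"

primrec C_k :: "nat \<Rightarrow> (real^'n \<Rightarrow> real) \<Rightarrow> bool" where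
  "C_k 0 f \<longleftrightarrow> continuous_on UNIV f"
| "C_k (Suc k) f \<longleftrightarrow> (\<forall>x. f differentiable (at x)) \<and> (\<forall>i. C_k k (partial_deriv i f))"

definition test_functions :: "(real^'n) set \<Rightarrow> (real^'n \<Rightarrow> real) set" where
  "test_functions \<Omega> = {\<phi>. (\<forall>k. C_k k \<phi>) \<and> compact (closure {x. \<phi> x \<noteq> 0}) \<and> closure {x. \<phi> x \<noteq> 0} \<subseteq> \<Omega>}"

definition is_weak_grad :: "(real^'n) set \<Rightarrow> (real^'n \<Rightarrow> real) \<Rightarrow> (real^'n \<Rightarrow> real^'n) \<Rightarrow> bool" where
  "is_weak_grad \<Omega> u g \<longleftrightarrow>
     (\<forall>\<phi>\<in>test_functions \<Omega>. \<forall>i.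
        (LINT x|lebesgue_on \<Omega>. u x * partial_deriv i \<phi> x) = - (LINT x|lebesgue_on \<Omega>. g x $ i * \<phi> x))"

definition H1_space :: "(real^'n) set \<Rightarrow> (real^'n \<Rightarrow> real) set" where
  "H1_space \<Omega> = {u \<in> L2_space \<Omega>. \<exists>g\<in>L2_space \<Omega>. is_weak_grad \<Omega> u g}"

text \<open>Weak gradients are unique up to null sets, so the norms below do not depend on the choice.\<close>

definition weak_grad :: "(real^'n) set \<Rightarrow> (real^'n \<Rightarrow> real) \<Rightarrow> real^'n \<Rightarrow> real^'n" where
  "weak_grad \<Omega> u = (SOME g. g \<in> L2_space \<Omega> \<and> is_weak_grad \<Omega> u g)"

definition H1_vec_space :: "(real^'n) set \<Rightarrow> (real^'n \<Rightarrow> real^'m) set" where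
  "H1_vec_space \<Omega> = {u. \<forall>i. (\<lambda>x. u x $ i) \<in> H1_space \<Omega>}"

text \<open>Row \<open>i\<close> is the gradient of component \<open>i\<close>. The norm on the type of matrices is the
  Frobenius norm.\<close>

definition weak_grad_vec :: "(real^'n) set \<Rightarrow> (real^'n \<Rightarrow> real^'m) \<Rightarrow> real^'n \<Rightarrow> real^'n^'m" where
  "weak_grad_vec \<Omega> u x = (\<chi> i. weak_grad \<Omega> (\<lambda>y. u y $ i) x)"

text \<open>The supremum is over functions that are nonzero as classes modulo null sets.\<close>

definition dual_norm :: "(real^'n) set \<Rightarrow> (real^'n \<Rightarrow> real) \<Rightarrow> ereal" where
  "dual_norm \<Omega> p =
     (SUP q \<in> {q \<in> H1_space \<Omega> \<inter> Linf_space \<Omega>. \<not> (AE x in lebesgue_on \<Omega>. q x = 0)}.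
        ereal (L2_inner \<Omega> p q / (L2_norm \<Omega> (weak_grad \<Omega> q) + Linf_norm \<Omega> q)))"


section \<open>Triangulations\<close>

definition conforming_triangulation :: "(real^'n) set \<Rightarrow> (real^'n) set set \<Rightarrow> bool" where
  "conforming_triangulation \<Omega> \<T> \<longleftrightarrow>
     triangulation \<T> \<and> (\<forall>K\<in>\<T>. int CARD('n) simplex K) \<and> \<Union>\<T> = closure \<Omega>"

definition mesh_size :: "(real^'n) set set \<Rightarrow> real" where
  "mesh_size \<T> = Max (diameter ` \<T>)"

definition mesh_nodes :: "(real^'n) set set \<Rightarrow> (real^'n) set" where
  "mesh_nodes \<T> = (\<Union>K\<in>\<T>. {a. a extreme_point_of K})"

definition inball_diameter :: "(real^'n) set \<Rightarrow> real" where
  "inball_diameter K = Sup {2 * r | r c. 0 < r \<and> cball c r \<subseteq> K}"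

definition shape_regular :: "'i set \<Rightarrow> ('i \<Rightarrow> (real^'n) set set) \<Rightarrow> bool" where
  "shape_regular H \<T> \<longleftrightarrow> (\<exists>\<sigma>>0. \<forall>h\<in>H. \<forall>K\<in>\<T> h. diameter K \<le> \<sigma> * inball_diameter K)"

definition quasi_uniform :: "'i set \<Rightarrow> ('i \<Rightarrow> (real^'n) set set) \<Rightarrow> bool" where
  "quasi_uniform H \<T> \<longleftrightarrow> (\<exists>\<tau>>0. \<forall>h\<in>H. \<forall>K\<in>\<T> h. \<tau> * mesh_size (\<T> h) \<le> diameter K)"


section \<open>Finite element spaces\<close>

text \<open>Functions on \<open>closure \<Omega>\<close> are represented by their extension by zero, so that equality of
  functions in the spaces is equality on \<open>closure \<Omega>\<close>.\<close>

definition fe_space :: "(real^'n) set \<Rightarrow> (real^'n) set set \<Rightarrow> (real^'n \<Rightarrow> real) set" where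
  "fe_space \<Omega> \<T> =
     {v. continuous_on (closure \<Omega>) v \<and> (\<forall>x. x \<notin> closure \<Omega> \<longrightarrow> v x = 0) \<and>
         (\<forall>K\<in>\<T>. \<exists>a b. \<forall>x\<in>K. v x = a \<bullet> x + b)}"

definition fe_vec_space :: "(real^'n) set \<Rightarrow> (real^'n) set set \<Rightarrow> (real^'n \<Rightarrow> real^'n) set" where
  "fe_vec_space \<Omega> \<T> = {v. \<forall>i. (\<lambda>x. v x $ i) \<in> fe_space \<Omega> \<T>}"

definition nodal_basis :: "(real^'n) set \<Rightarrow> (real^'n) set set \<Rightarrow> real^'n \<Rightarrow> real^'n \<Rightarrow> real" where
  "nodal_basis \<Omega> \<T> a =
     (THE \<phi>. \<phi> \<in> fe_space \<Omega> \<T> \<and> (\<forall>b\<in>mesh_nodes \<T>. \<phi> b = (if b = a then 1 else 0)))"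

definition nodal_interp :: "(real^'n) set \<Rightarrow> (real^'n) set set \<Rightarrow> (real^'n \<Rightarrow> real) \<Rightarrow> real^'n \<Rightarrow> real" where
  "nodal_interp \<Omega> \<T> f x = (\<Sum>a\<in>mesh_nodes \<T>. f a * nodal_basis \<Omega> \<T> a x)"

end

theory Submission
  imports Defs
begin

text \<open>Let \<open>r\<close> be the \<open>L\<^sup>2\<close>-projection onto the scalar finite element space of a competitor \<open>p\<close> in the
  dual norm of \<open>q\<close>. The nodal interpolant \<open>w\<close> of \<open>r u\<close> has \<open>u \<bullet> w = r\<close> at every node, as \<open>\<bar>u\<bar> = 1\<close>
  there, so the numerator for \<open>w\<close> is \<open>(q, r) = (q, p)\<close>; comparing nodal differences, the norm of \<open>w\<close>
  is at most a constant times \<open>1 + \<parallel>\<nabla>u\<parallel>\<close> times the norm of \<open>r\<close>. Everything thus rests on the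
  stability of the projection in \<open>H\<^sup>1 \<inter> L\<^sup>\<infinity>\<close>. In \<open>L\<^sup>\<infinity>\<close> it follows from the Neumann series for the
  mass matrix, whose \<open>m\<close>-th term couples only nodes at distance at most \<open>m h\<close> and decays
  geometrically, while the number of such nodes grows polynomially in \<open>m\<close>. For the gradient, the
  projection is compared with the finite element function whose value at a node is the average of
  \<open>p\<close> over a ball of radius \<open>h\<close> moved into the domain along an interior cone: an element and the ball
  of any of its vertices are joined by segments inside the domain, so a Poincare inequality applies
  directly. If \<open>h\<close> is bounded below, an inverse estimate suffices, because the norm of \<open>p\<close> contains
  its supremum.\<close>

section \<open>Test functions and the fundamental lemma\<close>

text \<open>The dual norm tests with functions \<open>p\<close> that need not be continuous, so
  \<open>p\<close> has no nodal values. The projection supplies them, and its orthogonality keeps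
  the product of \<open>p\<close> with every finite element function; an averaged interpolant alone
  would not. The price is that the projection is nonlocal, hence the decay argument. The factor 1 +
  \<parallel>\<nabla>u\<parallel> is the product rule: the gradient of r u has a part r \<nabla>u,
  which asks for a bounded r, and a part u \<nabla>r, which asks for a bound on \<nabla>r, so both
  halves of the norm of \<open>p\<close> are used. Uniformity in h comes from condensing the mesh
  assumptions into one constant \<open>c\<close>: an element has diameter at most h and contains a
  ball of radius c h. The averaging balls are moved because a ball about a boundary vertex leaves
  \<Omega>; moving them takes the place of an extension of \<open>p\<close> beyond \<Omega>. The
  supremum in the dual norm need not be attained, so a competitor reaches a fraction \<theta> < 1 of
  it, and \<theta> tends to 1 only at the very end.\<close>

lemma C_k_continuous: "C_k k f \<Longrightarrow> continuous_on UNIV f"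
  by (cases k) (auto intro!: differentiable_imp_continuous_on simp: differentiable_on_def
      intro: differentiable_at_withinI)

lemma C_k_Suc_imp: "C_k (Suc k) f \<Longrightarrow> C_k k f"
proof (induction k arbitrary: f)
  case 0
  then show ?case using C_k_continuous by (metis C_k.simps(1))
next
  case (Suc k)
  then show ?case by (metis C_k.simps(2))
qed

text \<open>One induction over \<open>k\<close> serves the whole family at once. An induction for a
  single function would stall on families such as \<open>flat_fun\<close>, whose derivatives carry a
  new parameter.\<close>

lemma C_k_coinduct:
  assumes "f \<in> S" "\<And>f. f \<in> S \<Longrightarrow> (\<forall>x. f differentiable (at x)) \<and> (\<forall>i. partial_deriv i f \<in> S)"
  shows "C_k k f"
  using assms(1)
proof (induction k arbitrary: f)
  case 0
  then show ?case using assms(2)[of f]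
    by (auto intro!: differentiable_imp_continuous_on simp: differentiable_on_def
      intro: differentiable_at_withinI)
next
  case (Suc k)
  then show ?case using assms(2) by simp
qed

lemma partial_derivI:
  "(f has_derivative f') (at x) \<Longrightarrow> partial_deriv i f x = f' (axis i 1)"
  unfolding partial_deriv_def using frechet_derivative_at by metis

lemma has_derivative_frechet: "f differentiable (at x) \<Longrightarrow> (f has_derivative frechet_derivative f (at x)) (at x)"
  by (simp add: frechet_derivative_works)

lemma C_k_const: "C_k k (\<lambda>x. c)"
proof (rule C_k_coinduct[where S="{\<lambda>x. c | c. True}"])
  show "(\<lambda>x. c) \<in> {\<lambda>x. c | c. True}" by auto
next
  fix f :: "real^'n \<Rightarrow> real" assume "f \<in> {\<lambda>x. c | c. True}"
  then obtain c where f: "f = (\<lambda>x. c)" by auto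
  have "partial_deriv i f = (\<lambda>x. 0)" for i
    unfolding f by (rule ext, subst partial_derivI[OF has_derivative_const]) simp
  then show "(\<forall>x. f differentiable (at x)) \<and> (\<forall>i. partial_deriv i f \<in> {\<lambda>x. c | c. True})"
    unfolding f by auto
qed

lemma C_k_add: "C_k k f \<Longrightarrow> C_k k g \<Longrightarrow> C_k k (\<lambda>x. f x + g x)"
proof (induction k arbitrary: f g)
  case 0
  then show ?case by (auto intro: continuous_intros)
next
  case (Suc k)
  have "partial_deriv i (\<lambda>x. f x + g x) = (\<lambda>x. partial_deriv i f x + partial_deriv i g x)" for i
  proof
    fix x
    have "f differentiable (at x)" "g differentiable (at x)" using Suc.prems by auto
    from has_derivative_add[OF this[THEN has_derivative_frechet]]
    show "partial_deriv i (\<lambda>x. f x + g x) x = partial_deriv i f x + partial_deriv i g x"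
      by (subst partial_derivI) (auto simp: partial_deriv_def)
  qed
  then show ?case using Suc by auto
qed

lemma C_k_mult: "C_k k f \<Longrightarrow> C_k k g \<Longrightarrow> C_k k (\<lambda>x. f x * g x)"
proof (induction k arbitrary: f g)
  case 0
  then show ?case by (auto intro: continuous_intros)
next
  case (Suc k)
  have *: "partial_deriv i (\<lambda>x. f x * g x) = (\<lambda>x. f x * partial_deriv i g x + partial_deriv i f x * g x)" for i
  proof
    fix x
    have "f differentiable (at x)" "g differentiable (at x)" using Suc.prems by auto
    from has_derivative_mult[OF this[THEN has_derivative_frechet]]
    show "partial_deriv i (\<lambda>x. f x * g x) x = f x * partial_deriv i g x + partial_deriv i f x * g x"
      by (subst partial_derivI) (auto simp: partial_deriv_def)
  qed
  have "C_k k f" "C_k k g" using Suc.prems C_k_Suc_imp by auto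
  then have "C_k k (partial_deriv i (\<lambda>x. f x * g x))" for i
    unfolding * using Suc.prems by (intro C_k_add Suc.IH) auto
  then show ?case using Suc.prems by auto
qed

lemma C_k_prod: "finite I \<Longrightarrow> (\<And>j. j \<in> I \<Longrightarrow> C_k k (f j)) \<Longrightarrow> C_k k (\<lambda>x. \<Prod>j\<in>I. f j x)"
  by (induction I rule: finite_induct) (auto intro: C_k_const C_k_mult)

lemma C_k_power: "C_k k f \<Longrightarrow> C_k k (\<lambda>x. f x ^ m)"
  by (induction m) (auto intro: C_k_const C_k_mult)

lemma C_k_one_minus: "C_k k f \<Longrightarrow> C_k k (\<lambda>x. 1 - f x)"
  using C_k_add[OF C_k_const[of k 1] C_k_mult[OF C_k_const[of k "-1"], of f]] by simp

lemma partial_deriv_translate: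
  assumes "\<And>x. f differentiable (at x)"
  shows "partial_deriv i (\<lambda>x. f (x + h)) = (\<lambda>x. partial_deriv i f (x + h))"
proof
  fix x
  have "((\<lambda>x. f (x + h)) has_derivative frechet_derivative f (at (x + h))) (at x)"
    using has_derivative_compose[OF has_derivative_add[OF has_derivative_ident has_derivative_const[of h]] 
       has_derivative_frechet[OF assms[of "x+h"]]] by simp
  then show "partial_deriv i (\<lambda>x. f (x + h)) x = partial_deriv i f (x + h)"
    by (subst partial_derivI) (auto simp: partial_deriv_def)
qed

lemma C_k_translate: "C_k k f \<Longrightarrow> C_k k (\<lambda>x. f (x + h))"
proof (induction k arbitrary: f)
  case 0
  then show ?case
    using continuous_on_compose2[of UNIV f UNIV "\<lambda>x. x + h"] by (simp add: continuous_on_add)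
next
  case (Suc k)
  have "(\<lambda>x. f (x + h)) differentiable (at x)" for x
  proof -
    have "f differentiable (at (x + h))" using Suc.prems by auto
    from has_derivative_compose[OF has_derivative_add[OF has_derivative_ident has_derivative_const[of h]] 
       has_derivative_frechet[OF this]]
    show ?thesis unfolding differentiable_def by auto
  qed
  moreover have "C_k k (partial_deriv i (\<lambda>x. f (x + h)))" for i
    using Suc by (subst partial_deriv_translate) auto
  ultimately show ?case by simp
qed

section \<open>Cutoff functions built from exp(-1/t)\<close>

definition flat_fun :: "real poly \<Rightarrow> real \<Rightarrow> real" where
  "flat_fun p t = (if t \<le> 0 then 0 else poly p (1/t) * exp (- (1/t)))"

lemma poly_times_exp_tendsto_0: "((\<lambda>y::real. poly p y * exp (- y)) \<longlongrightarrow> 0) at_top"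
proof -
  have "((\<lambda>y::real. \<Sum>i\<le>degree p. coeff p i * (y ^ i / exp y)) \<longlongrightarrow> (\<Sum>i\<le>degree p. coeff p i * 0)) at_top"
    by (intro tendsto_intros tendsto_power_div_exp_0)
  then show ?thesis
    by (simp add: poly_altdef exp_minus divide_inverse sum_distrib_right mult.assoc)
qed

text \<open>The polynomial factor closes the family under differentiation: for positive
  \<open>t\<close> the derivative of p(1/t) exp(-1/t) is y^2 (p - p')(y) exp(-y) at y = 1/t, and the
  two \<open>pCons 0\<close> are the factor y^2. At 0 the exponential beats every
  polynomial.\<close>

lemma flat_fun_deriv:
  "(flat_fun p has_field_derivative flat_fun (pCons 0 (pCons 0 (p - pderiv p))) t) (at t)"
proof -
  consider "t < 0" | "t = 0" | "t > 0" by linarith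
  then show ?thesis
  proof cases
    case 1
    have "((\<lambda>t. 0) has_field_derivative 0) (at t)" by simp
    then have "(flat_fun p has_field_derivative 0) (at t)"
      by (rule has_field_derivative_transform_within_open[where S="{..<0}"]) (use 1 in \<open>auto simp: flat_fun_def\<close>)
    then show ?thesis using 1 by (simp add: flat_fun_def)
  next
    case 3
    have "((\<lambda>t. poly p (1/t) * exp (- (1/t))) has_field_derivative 
          flat_fun (pCons 0 (pCons 0 (p - pderiv p))) t) (at t)"
      using 3 unfolding flat_fun_def
      by (auto intro!: derivative_eq_intros DERIV_chain'[OF _ poly_DERIV] simp: field_simps power2_eq_square)
    then show ?thesis
      by (rule has_field_derivative_transform_within_open[where S="{0<..}"]) (use 3 in \<open>auto simp: flat_fun_def\<close>)
  next
    case 2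
    \<comment> \<open>Dividing by h multiplies by y = 1/h, so the right difference quotient at 0 is
      again a polynomial times exp(-y), now with \<open>pCons 0 p\<close>.\<close>
    have "((\<lambda>y. poly (pCons 0 p) y * exp (- y)) \<longlongrightarrow> 0) at_top"
      by (rule poly_times_exp_tendsto_0)
    from filterlim_compose[OF this filterlim_inverse_at_top_right]
    have "((\<lambda>h. poly (pCons 0 p) (inverse h) * exp (- inverse h)) \<longlongrightarrow> 0) (at_right 0)" .
    moreover have "\<forall>\<^sub>F h in at_right 0. poly (pCons 0 p) (inverse h) * exp (- inverse h) = flat_fun p h / h"
      unfolding eventually_at_right_field by (rule exI[of _ 1]) (auto simp: flat_fun_def field_simps)
    ultimately have r: "((\<lambda>h. flat_fun p h / h) \<longlongrightarrow> 0) (at_right 0)"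
      by (rule Lim_transform_eventually)
    have "\<forall>\<^sub>F h in at_left 0. 0 = flat_fun p h / h"
      unfolding eventually_at_left_field by (rule exI[of _ "-1"]) (auto simp: flat_fun_def)
    then have l: "((\<lambda>h. flat_fun p h / h) \<longlongrightarrow> 0) (at_left 0)"
      using Lim_transform_eventually tendsto_const by fast
    have "((\<lambda>h. flat_fun p h / h) \<longlongrightarrow> 0) (at 0)"
      using l r by (simp add: filterlim_split_at)
    then show ?thesis using 2 unfolding DERIV_def by (simp add: flat_fun_def)
  qed
qed

lemma C_k_flat: "C_k k (\<lambda>x::real^'n. flat_fun p (c * x $ i + d))"
proof (rule C_k_coinduct[where S="{\<lambda>x. flat_fun p (c * x $ i + d) | p. True}"])
  show "(\<lambda>x. flat_fun p (c * x $ i + d)) \<in> {\<lambda>x. flat_fun p (c * x $ i + d) | p. True}" by auto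
next
  fix f :: "real^'n \<Rightarrow> real" assume "f \<in> {\<lambda>x. flat_fun p (c * x $ i + d) | p. True}"
  then obtain p where f: "f = (\<lambda>x. flat_fun p (c * x $ i + d))" by auto
  let ?q = "pCons 0 (pCons 0 (p - pderiv p))"
  have D: "(f has_derivative (\<lambda>v. flat_fun ?q (c * x $ i + d) * (c * v $ i))) (at x)" for x
    unfolding f
    by (rule has_derivative_compose[where f="\<lambda>x. c * x $ i + d", OF _
        flat_fun_deriv[THEN has_field_derivative_imp_has_derivative]])
       (auto intro!: derivative_eq_intros bounded_linear.has_derivative[OF bounded_linear_vec_nth
           has_derivative_ident, simplified])
  \<comment> \<open>The chain rule factor, \<open>c\<close> or 0, is absorbed into the polynomial,
    so the derivative stays in the family.\<close>
  have "partial_deriv j f = (\<lambda>x. flat_fun (smult (if j = i then c else 0) ?q) (c * x $ i + d))" for j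
    by (rule ext, subst partial_derivI[OF D]) (auto simp: axis_def flat_fun_def)
  then show "(\<forall>x. f differentiable (at x)) \<and> (\<forall>j. partial_deriv j f \<in> {\<lambda>x. flat_fun p (c * x $ i + d) | p. True})"
    using D unfolding differentiable_def by blast
qed

text \<open>A product of one-dimensional cutoffs, positive exactly on the open cube of half side
  \<open>e\<close> about \<open>a\<close>. The factors 1 and -1 bring each argument into the affine
  form of \<open>C_k_flat\<close>.\<close>

definition bump :: "real^'n \<Rightarrow> real \<Rightarrow> real^'n \<Rightarrow> real" where
  "bump a e x = (\<Prod>i\<in>UNIV. flat_fun 1 (1 * x $ i + (e - a $ i)) * flat_fun 1 ((-1) * x $ i + (e + a $ i)))"

lemma C_k_bump: "C_k k (bump a e)"
  unfolding bump_def[abs_def] by (intro C_k_prod C_k_mult C_k_flat) auto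

lemma flat_fun_1_bounds: "0 \<le> flat_fun 1 t" "flat_fun 1 t \<le> 1" "flat_fun 1 t > 0 \<longleftrightarrow> t > 0"
  by (auto simp: flat_fun_def)

lemma bump_bounds: "0 \<le> bump a e x" "bump a e x \<le> 1"
  unfolding bump_def by (auto intro!: prod_nonneg prod_le_1 mult_le_one simp: flat_fun_1_bounds)

lemma bump_pos: "(\<And>i. \<bar>x $ i - a $ i\<bar> < e) \<Longrightarrow> bump a e x > 0"
  unfolding bump_def by (intro prod_pos ballI mult_pos_pos flat_fun_1_bounds(3)[THEN iffD2])
    (auto simp: abs_less_iff algebra_simps)

lemma bump_nonzero: "bump a e x \<noteq> 0 \<Longrightarrow> norm (x - a) \<le> real CARD('n) * e" for x a :: "real^'n"
proof -
  assume "bump a e x \<noteq> 0"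
  then have nz: "flat_fun 1 (1 * x $ i + (e - a $ i)) * flat_fun 1 ((-1) * x $ i + (e + a $ i)) \<noteq> 0" for i
    unfolding bump_def by (auto simp: prod_zero_iff)
  have "\<bar>(x - a) $ i\<bar> \<le> e" for i
    using nz[of i] by (auto simp: flat_fun_def split: if_splits)
  then have "(\<Sum>i\<in>UNIV. \<bar>(x - a) $ i\<bar>) \<le> CARD('n) * e"
    using sum_bounded_above[of UNIV "\<lambda>i. \<bar>(x-a)$i\<bar>" e] by auto
  then show ?thesis using norm_le_l1_cart[of "x - a"] by linarith
qed

text \<open>Powers replace a normalised cutoff. The product \<Psi> of the functions 1 -
  \<open>bump\<close> is smooth, equals 1 away from the cubes and stays below some \<theta> < 1 on
  the compact set, so 1 - \<Psi>^m is close to 1 there and still vanishes away from the cubes.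
  Shrinking the cubes gives the pointwise limit.\<close>

lemma test_functions_approx_compact:
  fixes C U :: "(real^'n) set"
  assumes C: "compact C" "C \<subseteq> U" "open U"
  obtains \<phi> where "\<And>k::nat. \<phi> k \<in> test_functions U" "\<And>k x. 0 \<le> \<phi> k x \<and> \<phi> k x \<le> 1"
     "\<And>x. (\<lambda>k. \<phi> k x) \<longlonglongrightarrow> indicator C x"
proof -
  obtain d where d: "d > 0" "\<And>x. x \<in> C \<Longrightarrow> cball x d \<subseteq> U"
    using compact_subset_open_imp_cball_epsilon_subset[OF C(1,3,2)] by (metis UN_subset_iff)
  have ex: "\<exists>\<phi>. \<phi> \<in> test_functions U \<and> (\<forall>x. 0 \<le> \<phi> x \<and> \<phi> x \<le> 1) \<and> (\<forall>x\<in>C. \<phi> x \<ge> 1 - e) \<and>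
      (\<forall>x. \<phi> x \<noteq> 0 \<longrightarrow> (\<exists>a\<in>C. norm (x - a) \<le> e))" if e: "0 < e" "e < 1" for e :: real
  proof -
    \<comment> \<open>By \<open>bump_nonzero\<close> a cube of half side \<delta> reaches at most n
      \<delta> = min d e: within \<open>d\<close>, to stay in \<open>U\<close>, and within
      \<open>e\<close>, to shrink onto \<open>C\<close>.\<close>
    define \<delta> where "\<delta> = min d e / CARD('n)"
    have \<delta>: "\<delta> > 0" "real CARD('n) * \<delta> = min d e" using d(1) e by (auto simp: \<delta>_def)
    define V where "V a = ball a \<delta>" for a :: "real^'n"
    have "C \<subseteq> (\<Union>a\<in>C. V a)" using \<delta> by (auto simp: V_def)
    then obtain D where D: "D \<subseteq> C" "finite D" "C \<subseteq> (\<Union>a\<in>D. V a)"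
      using compactE_image[OF C(1), of C V] by (auto simp: V_def)
    define \<Psi> where "\<Psi> x = (\<Prod>a\<in>D. 1 - bump a \<delta> x)" for x
    have \<Psi>01: "0 \<le> \<Psi> x" "\<Psi> x \<le> 1" for x
      unfolding \<Psi>_def using bump_bounds by (auto intro!: prod_nonneg prod_le_1)
    have \<Psi>lt: "\<Psi> x < 1" if xC: "x \<in> C" for x
    proof -
      obtain a where a: "a \<in> D" "x \<in> V a" using D(3) xC by blast
      have "bump a \<delta> x > 0"
      proof (rule bump_pos)
        fix i show "\<bar>x $ i - a $ i\<bar> < \<delta>" using a component_le_norm_cart[of "x - a" i]
          by (auto simp: V_def dist_norm norm_minus_commute)
      qed
      then have *: "1 - bump a \<delta> x < 1" by simp
      have "\<Psi> x = (1 - bump a \<delta> x) * (\<Prod>a\<in>D - {a}. 1 - bump a \<delta> x)"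
        unfolding \<Psi>_def using a D(2) by (simp add: prod.remove)
      also have "\<dots> \<le> (1 - bump a \<delta> x) * 1"
        using bump_bounds by (intro mult_left_mono prod_le_1) auto
      finally show ?thesis using * by simp
    qed
    have Ck: "C_k k \<Psi>" for k unfolding \<Psi>_def[abs_def] by (intro C_k_prod D C_k_one_minus C_k_bump)
    have cont: "continuous_on C \<Psi>" using C_k_continuous[OF Ck[of 0]] continuous_on_subset by blast
    obtain \<theta> where \<theta>: "0 \<le> \<theta>" "\<theta> < 1" "\<And>x. x \<in> C \<Longrightarrow> \<Psi> x \<le> \<theta>"
    proof (cases "C = {}")
      case True then show ?thesis using that[of 0] by auto
    next
      case False
      then obtain x where "x \<in> C" "\<And>y. y \<in> C \<Longrightarrow> \<Psi> y \<le> \<Psi> x"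
        using continuous_attains_sup[OF C(1) _ cont] by blast
      then show ?thesis using that[of "\<Psi> x"] \<Psi>01 \<Psi>lt by auto
    qed
    \<comment> \<open>This power brings \<Psi> below \<open>e\<close> on all of
      \<open>C\<close>.\<close>
    obtain m where m: "\<theta> ^ m < e" using real_arch_pow_inv[OF e(1) \<theta>(2)] by blast
    define \<phi> where "\<phi> x = 1 - \<Psi> x ^ m" for x
    have supp: "\<exists>a\<in>D. norm (x - a) \<le> min d e" if "\<phi> x \<noteq> 0" for x
    proof -
      have "\<Psi> x \<noteq> 1" using that unfolding \<phi>_def by (metis diff_self power_one)
      then have "\<exists>a\<in>D. bump a \<delta> x \<noteq> 0" unfolding \<Psi>_def by (metis (no_types, lifting) diff_zero prod.neutral)
      then obtain a where "a \<in> D" "bump a \<delta> x \<noteq> 0" by blast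
      then show ?thesis using bump_nonzero[of a \<delta> x] \<delta>(2) by (intro bexI[of _ a]) linarith+
    qed
    let ?S = "\<Union>a\<in>D. cball a (min d e)"
    have sub: "{x. \<phi> x \<noteq> 0} \<subseteq> ?S" using supp by (force simp: dist_norm norm_minus_commute)
    have cS: "compact ?S" using D by (intro compact_UN) auto
    have cl: "closure {x. \<phi> x \<noteq> 0} \<subseteq> ?S" using closure_minimal[OF sub] cS compact_imp_closed by blast
    have bd: "bounded {x. \<phi> x \<noteq> 0}" using bounded_subset[OF compact_imp_bounded[OF cS] sub] .
    have "?S \<subseteq> U" using d(2) D(1) by fastforce
    then have "\<phi> \<in> test_functions U"
      unfolding test_functions_def using cl
      using C_k_one_minus[OF C_k_power[OF Ck, of _ m], folded \<phi>_def] bd by auto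
    moreover have "0 \<le> \<phi> x \<and> \<phi> x \<le> 1" for x
      using \<Psi>01[of x] by (auto simp: \<phi>_def power_le_one)
    moreover have "\<phi> x \<ge> 1 - e" if "x \<in> C" for x
      using power_mono[OF \<theta>(3)[OF that] \<Psi>01(1), of m] m by (auto simp: \<phi>_def)
    moreover have "\<exists>a\<in>C. norm (x - a) \<le> e" if "\<phi> x \<noteq> 0" for x
      using supp[OF that] D(1) by auto
    ultimately show ?thesis by blast
  qed
  \<comment> \<open>The shift by 2 keeps the tolerance strictly below 1 already at k = 0.\<close>
  then have "\<forall>k::nat. \<exists>\<phi>. \<phi> \<in> test_functions U \<and> (\<forall>x. 0 \<le> \<phi> x \<and> \<phi> x \<le> 1) \<and> (\<forall>x\<in>C. \<phi> x \<ge> 1 - inverse (real (k+2))) \<and>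
      (\<forall>x. \<phi> x \<noteq> 0 \<longrightarrow> (\<exists>a\<in>C. norm (x - a) \<le> inverse (real (k+2))))"
    by (intro allI ex) (auto simp: field_simps)
  then obtain \<phi> where \<phi>: "\<And>k. \<phi> k \<in> test_functions U" "\<And>k x. 0 \<le> \<phi> k x \<and> \<phi> k x \<le> 1"
     "\<And>k x. x \<in> C \<Longrightarrow> \<phi> k x \<ge> 1 - inverse (real (k+2))"
     "\<And>k x. \<phi> k x \<noteq> 0 \<Longrightarrow> (\<exists>a\<in>C. norm (x - a) \<le> inverse (real (k+2)))"
    by metis
  have lim: "(\<lambda>k. inverse (real (k+2))) \<longlonglongrightarrow> 0"
    using LIMSEQ_ignore_initial_segment[OF LIMSEQ_inverse_real_of_nat, of 1] by (simp add: add.commute)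
  have "(\<lambda>k. \<phi> k x) \<longlonglongrightarrow> indicator C x" for x
  proof (cases "x \<in> C")
    case True
    have "(\<lambda>k. \<phi> k x) \<longlonglongrightarrow> 1"
      by (rule tendsto_sandwich[where f="\<lambda>k. 1 - inverse (real (k+2))" and h="\<lambda>k. 1"])
        (use \<phi> True tendsto_diff[OF tendsto_const lim, of 1] in auto)
    then show ?thesis using True by simp
  next
    case False
    obtain r where r: "r > 0" "ball x r \<inter> C = {}"
      using False compact_imp_closed[OF C(1)] by (metis ComplD ComplI Int_commute closed_def disjoint_eq_subset_Compl
          open_contains_ball)
    have "\<forall>\<^sub>F k in sequentially. inverse (real (k+2)) < r"
      using lim r(1) by (rule order_tendstoD)
    then have "\<forall>\<^sub>F k in sequentially. 0 = \<phi> k x"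
    proof eventually_elim
      case (elim k)
      show ?case
      proof (rule ccontr)
        assume "0 \<noteq> \<phi> k x"
        then obtain a where "a \<in> C" "norm (x - a) \<le> inverse (real (k+2))" using \<phi>(4)[of k x] by auto
        then have "a \<in> ball x r \<inter> C" using elim by (auto simp: dist_norm)
        then show False using r(2) by blast
      qed
    qed
    with tendsto_const have "(\<lambda>k. \<phi> k x) \<longlonglongrightarrow> 0" by (rule Lim_transform_eventually)
    then show ?thesis using False by simp
  qed
  then show ?thesis using that \<phi> by blast
qed

lemma test_functions_continuous: "\<phi> \<in> test_functions U \<Longrightarrow> continuous_on UNIV \<phi>"
  unfolding test_functions_def using C_k_continuous by blast

lemma test_functions_measurable: "\<phi> \<in> test_functions U \<Longrightarrow> \<phi> \<in> borel_measurable borel"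
  using test_functions_continuous borel_measurable_continuous_onI by blast

text \<open>On a compact subset of the set where \<open>f\<close> is positive, dominated convergence
  replaces test functions by the indicator. The integral of \<open>f\<close> there is 0, so the
  compact set is null, and inner regularity makes the whole set null. The one-sided form is applied
  to \<open>f\<close> and to -\<open>f\<close>.\<close>

lemma fundamental_lemma_le:
  fixes f :: "real^'n \<Rightarrow> real"
  assumes U: "open U" and f: "integrable lebesgue f"
    and z: "\<And>\<phi>. \<phi> \<in> test_functions U \<Longrightarrow> (LINT x|lebesgue. f x * \<phi> x) = 0"
  shows "AE x in lebesgue. x \<in> U \<longrightarrow> f x \<le> 0"
proof -
  define P where "P = {x \<in> U. f x > 0}"
  have fm: "f \<in> borel_measurable lebesgue" using f by auto
  have P: "P \<in> sets lebesgue"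
  proof -
    have "P = U \<inter> {x \<in> space lebesgue. f x > 0}" by (auto simp: P_def)
    moreover have "U \<in> sets lebesgue" using borel_open[OF U] sets_completionI_sets[of U lborel]
        by (simp only: sets_lborel)
    moreover have "{x \<in> space lebesgue. f x > 0} \<in> sets lebesgue"
      using fm by (rule borel_measurable_less[OF borel_measurable_const])
    ultimately show ?thesis by simp
  qed
  have null: "C \<in> null_sets lebesgue" if C: "compact C" "C \<subseteq> P" for C
  proof -
    have "C \<subseteq> U" using C by (auto simp: P_def)
    from test_functions_approx_compact[OF C(1) this U] obtain \<phi> where \<phi>: "\<And>k::nat. \<phi> k \<in> test_functions U" 
      "\<And>k x. 0 \<le> \<phi> k x \<and> \<phi> k x \<le> 1" "\<And>x. (\<lambda>k. \<phi> k x) \<longlonglongrightarrow> indicator C x" by blast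
    have Cm: "C \<in> sets lebesgue" using lmeasurable_compact[OF C(1)] by auto
    have m: "\<phi> k \<in> borel_measurable lebesgue" for k
      using test_functions_measurable[OF \<phi>(1)] by (simp add: measurable_completion)
    have "(\<lambda>k. LINT x|lebesgue. f x * \<phi> k x) \<longlonglongrightarrow> (LINT x|lebesgue. f x * indicator C x)"
    proof (rule integral_dominated_convergence[where w="\<lambda>x. norm (f x)"])
      show "AE x in lebesgue. (\<lambda>k. f x * \<phi> k x) \<longlonglongrightarrow> f x * indicator C x"
        by (intro AE_I2 tendsto_mult tendsto_const \<phi>(3))
      show "AE x in lebesgue. norm (f x * \<phi> k x) \<le> norm (f x)" for k
        using \<phi>(2)[of k] by (auto simp: abs_mult intro!: mult_left_le)
    qed (use f fm m Cm in auto)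
    then have "(LINT x|lebesgue. f x * indicator C x) = 0"
      using z[OF \<phi>(1)] by (simp add: LIMSEQ_const_iff)
    moreover have "integrable lebesgue (\<lambda>x. f x * indicator C x)"
      using f Cm by (rule integrable_mult_indicator[where f=f and A=C, simplified mult.commute real_scaleR_def,
          rotated])
    moreover have "AE x in lebesgue. 0 \<le> f x * indicator C x"
      using C by (auto simp: P_def indicator_def split: if_splits intro!: AE_I2)
    ultimately have "AE x in lebesgue. f x * indicator C x = 0"
      by (subst (asm) integral_nonneg_eq_0_iff_AE) auto
    then have "AE x in lebesgue. x \<notin> C"
      by eventually_elim (use C in \<open>auto simp: P_def indicator_def split: if_splits\<close>)
    then show ?thesis using Cm by (simp add: AE_iff_null_sets)
  qed
  have "P \<in> null_sets lebesgue"
  proof -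
    have "negligible P"
    proof (subst negligible_on_intervals, intro allI)
      fix a b :: "real^'n"
      \<comment> \<open>Inside a box the measure is finite, and a closed set that exhausts the rest
        up to \<open>e\<close> is compact.\<close>
      let ?Q = "P \<inter> cbox a b"
      have Q: "?Q \<in> lmeasurable" using P fmeasurable_Int_fmeasurable[OF lmeasurable_cbox] by (subst Int_commute) auto
      have "measure lebesgue ?Q < e" if "e > 0" for e
      proof -
        have Qs: "?Q \<in> sets lebesgue" using Q by auto
        from sets_lebesgue_inner_closed[OF Qs that] obtain T
          where T: "closed T" "T \<subseteq> ?Q" "?Q - T \<in> lmeasurable" "emeasure lebesgue (?Q - T) < ennreal e" by blast
        have "compact T" using T bounded_subset[OF bounded_cbox] by (auto simp: compact_eq_bounded_closed)
        then have "T \<in> null_sets lebesgue" using null[of T] T by auto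
        then have "measure lebesgue ?Q = measure lebesgue (?Q - T)" using Qs by (simp add: measure_Diff_null_set)
        then show ?thesis using T by (simp add: emeasure_eq_measure2 ennreal_less_iff)
      qed
      then have "measure lebesgue ?Q = 0" 
        by (meson less_irrefl linorder_neqE_linordered_idom measure_nonneg not_less)
      then show "negligible ?Q" using Q by (simp add: negligible_iff_measure)
    qed
    then show ?thesis using negligible_iff_null_sets by blast
  qed
  then have "AE x in lebesgue. x \<notin> P" using AE_not_in by blast
  then show ?thesis by eventually_elim (auto simp: P_def)
qed

lemma fundamental_lemma:
  fixes f :: "real^'n \<Rightarrow> real"
  assumes U: "open U" and f: "integrable lebesgue f"
    and z: "\<And>\<phi>. \<phi> \<in> test_functions U \<Longrightarrow> (LINT x|lebesgue. f x * \<phi> x) = 0"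
  shows "AE x in lebesgue. x \<in> U \<longrightarrow> f x = 0"
proof -
  have "AE x in lebesgue. x \<in> U \<longrightarrow> - f x \<le> 0"
    by (rule fundamental_lemma_le[OF U]) (use f z in auto)
  moreover have "AE x in lebesgue. x \<in> U \<longrightarrow> f x \<le> 0"
    by (rule fundamental_lemma_le[OF assms])
  ultimately show ?thesis by eventually_elim auto
qed

section \<open>Weak gradients along segments\<close>

lemma nn_integral_lborel_translate:
  fixes f :: "'a::euclidean_space \<Rightarrow> ennreal"
  assumes "f \<in> borel_measurable borel"
  shows "(\<integral>\<^sup>+x. f (x + h) \<partial>lborel) = (\<integral>\<^sup>+x. f x \<partial>lborel)"
proof -
  have "(\<integral>\<^sup>+x. f x \<partial>lborel) = (\<integral>\<^sup>+x. f x \<partial>distr lborel borel ((+) h))" by (simp add: lborel_distr_plus)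
  also have "\<dots> = (\<integral>\<^sup>+x. f (h + x) \<partial>lborel)" using assms by (subst nn_integral_distr) auto
  finally show ?thesis by (simp add: add.commute)
qed

lemma integrable_lborel_translate:
  fixes f :: "'a::euclidean_space \<Rightarrow> 'b::euclidean_space"
  assumes "integrable lborel f"
  shows "integrable lborel (\<lambda>x. f (x + h))"
proof -
  have "integrable (distr lborel borel ((+) h)) f" using assms by (simp add: lborel_distr_plus)
  then have "integrable lborel (\<lambda>x. f (h + x))" using assms by (subst (asm) integrable_distr_eq) auto
  then show ?thesis by (simp add: add.commute)
qed

lemma integral_lborel_translate:
  fixes f :: "'a::euclidean_space \<Rightarrow> 'b::euclidean_space"
  assumes "f \<in> borel_measurable borel"
  shows "(LINT x|lborel. f (x + h)) = (LINT x|lborel. f x)"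
proof -
  have "(LINT x|lborel. f x) = (LINT x|distr lborel borel ((+) h). f x)" by (simp add: lborel_distr_plus)
  also have "\<dots> = (LINT x|lborel. f (h + x))" using assms by (subst integral_distr) auto
  finally show ?thesis by (simp add: add.commute)
qed

lemma test_functions_translate:
  assumes "\<phi> \<in> test_functions U" "\<And>x. x \<in> U \<Longrightarrow> x + h \<in> V"
  shows "(\<lambda>x. \<phi> (x - h)) \<in> test_functions V"
proof -
  have "{x. \<phi> (x - h) \<noteq> 0} = (+) h ` {x. \<phi> x \<noteq> 0}"
    by (auto simp: image_iff algebra_simps intro!: exI[of _ "x - h" for x])
  then have cl: "closure {x. \<phi> (x - h) \<noteq> 0} = (+) h ` closure {x. \<phi> x \<noteq> 0}"
    by (simp add: closure_translation)
  have "C_k k (\<lambda>x. \<phi> (x + (- h)))" for k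
    using assms(1) by (intro C_k_translate) (auto simp: test_functions_def)
  moreover have "compact ((+) h ` closure {x. \<phi> x \<noteq> 0})"
    using assms(1) by (intro compact_translation) (auto simp: test_functions_def)
  moreover have "(+) h ` closure {x. \<phi> x \<noteq> 0} \<subseteq> V"
    using assms by (auto simp: test_functions_def add.commute)
  ultimately show ?thesis unfolding test_functions_def cl mem_Collect_eq by auto
qed

lemma test_functions_differentiable: "\<phi> \<in> test_functions U \<Longrightarrow> \<phi> differentiable (at x)"
  unfolding test_functions_def by (metis (mono_tags, lifting) C_k.simps(2) mem_Collect_eq)

lemma test_functions_partial_continuous: "\<phi> \<in> test_functions U \<Longrightarrow> continuous_on UNIV (partial_deriv i \<phi>)"
  unfolding test_functions_def by (metis (mono_tags, lifting) C_k.simps mem_Collect_eq)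

lemma partial_deriv_zero_outside:
  assumes "x \<notin> closure {x. \<phi> x \<noteq> 0}"
  shows "partial_deriv i \<phi> x = 0"
proof -
  have "(\<phi> has_derivative (\<lambda>_. 0)) (at x)"
    by (rule has_derivative_transform_within_open[where s="- closure {x. \<phi> x \<noteq> 0}" and f="\<lambda>_. 0"])
       (use assms closure_subset[of "{x. \<phi> x \<noteq> 0}"] in auto)
  then show ?thesis by (rule partial_derivI)
qed

lemma continuous_compact_support_bounded:
  fixes f :: "real^'n \<Rightarrow> real"
  assumes "continuous_on UNIV f" "compact K" "\<And>x. x \<notin> K \<Longrightarrow> f x = 0"
  obtains M where "M \<ge> 0" "\<And>x. \<bar>f x\<bar> \<le> M"
proof -
  have "bounded (f ` K)" by (intro compact_imp_bounded compact_continuous_image assms continuous_on_subset[OF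
      assms(1)]) auto
  then obtain M where M: "\<And>x. x \<in> K \<Longrightarrow> \<bar>f x\<bar> \<le> M" unfolding bounded_iff by auto
  have "\<bar>f x\<bar> \<le> max M 0" for x using M[of x] assms(3)[of x] by (cases "x \<in> K") auto
  then show ?thesis using that[of "max M 0"] by auto
qed

lemma test_functions_bounded:
  assumes "\<phi> \<in> test_functions U"
  obtains M where "M \<ge> 0" "\<And>x. \<bar>\<phi> x\<bar> \<le> M" "\<And>i x. \<bar>partial_deriv i \<phi> x\<bar> \<le> M"
proof -
  let ?K = "closure {x. \<phi> x \<noteq> 0}"
  have K: "compact ?K" using assms by (auto simp: test_functions_def)
  obtain M0 where M0: "M0 \<ge> 0" "\<And>x. \<bar>\<phi> x\<bar> \<le> M0"
    by (rule continuous_compact_support_bounded[OF test_functions_continuous[OF assms] K])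
      (use closure_subset[of "{x. \<phi> x \<noteq> 0}"] in auto)
  have "\<exists>M. M \<ge> 0 \<and> (\<forall>x. \<bar>partial_deriv i \<phi> x\<bar> \<le> M)" for i
    by (rule continuous_compact_support_bounded[OF test_functions_partial_continuous[OF assms] K
        partial_deriv_zero_outside])
      auto
  then obtain M where M: "\<And>i. M i \<ge> 0" "\<And>i x. \<bar>partial_deriv i \<phi> x\<bar> \<le> M i" by metis
  let ?M = "M0 + (\<Sum>i\<in>UNIV. M i)"
  have "M i \<le> (\<Sum>i\<in>UNIV. M i)" for i by (rule member_le_sum) (use M in auto)
  then have "\<bar>partial_deriv i \<phi> x\<bar> \<le> ?M" for i x by (rule order_trans[OF M(2) add_increasing[OF M0(1)]])
  moreover have "0 \<le> (\<Sum>i\<in>UNIV. M i)" using M by (simp add: sum_nonneg)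
  moreover have "\<bar>\<phi> x\<bar> \<le> M0 + (\<Sum>i\<in>UNIV. M i)" for x
    using M0(2)[of x] \<open>0 \<le> sum M UNIV\<close> by linarith
  ultimately show ?thesis using that[of ?M] M0(1) by auto
qed

lemma frechet_partial_sum:
  fixes \<phi> :: "real^'n \<Rightarrow> real"
  assumes "\<phi> differentiable (at x)"
  shows "frechet_derivative \<phi> (at x) h = (\<Sum>i\<in>UNIV. h $ i * partial_deriv i \<phi> x)"
proof -
  interpret linear "frechet_derivative \<phi> (at x)" using assms by (rule linear_frechet_derivative)
  have "frechet_derivative \<phi> (at x) h = frechet_derivative \<phi> (at x) (\<Sum>i\<in>UNIV. h $ i *s axis i 1)"
    by (simp add: basis_expansion)
  also have "\<dots> = (\<Sum>i\<in>UNIV. h $ i * partial_deriv i \<phi> x)"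
    by (simp add: sum scaleR scalar_mult_eq_scaleR partial_deriv_def)
  finally show ?thesis .
qed

text \<open>The fundamental theorem of calculus on the segment from x - h to x, in the form in which
  it reappears after the shift has been moved to the test function.\<close>

lemma test_function_segment:
  fixes \<phi> :: "real^'n \<Rightarrow> real"
  assumes "\<phi> \<in> test_functions U"
  shows "(LINT t|lborel. indicator {0..1} t * (\<Sum>i\<in>UNIV. h $ i * partial_deriv i \<phi> (x - t *\<^sub>R h))) = \<phi> x - \<phi> (x - h)"
proof -
  define F where "F t = - \<phi> (x - t *\<^sub>R h)" for t
  define f where "f t = (\<Sum>i\<in>UNIV. h $ i * partial_deriv i \<phi> (x - t *\<^sub>R h))" for t
  have D: "(F has_real_derivative f t) (at t)" for t
  proof -
    have "((\<lambda>t. \<phi> (x - t *\<^sub>R h)) has_derivative (\<lambda>s. frechet_derivative \<phi> (at (x - t *\<^sub>R h)) (- (s *\<^sub>R h)))) (at t)"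
      by (rule has_derivative_compose[where f="\<lambda>t. x - t *\<^sub>R h", OF _ has_derivative_frechet[OF
          test_functions_differentiable[OF assms]]])
        (auto intro!: derivative_eq_intros)
    then have "(F has_derivative (\<lambda>s. - frechet_derivative \<phi> (at (x - t *\<^sub>R h)) (- (s *\<^sub>R h)))) (at t)"
      unfolding F_def by (rule has_derivative_minus)
    moreover have "- frechet_derivative \<phi> (at (x - t *\<^sub>R h)) (- (s *\<^sub>R h)) = f t * s" for s
      unfolding frechet_partial_sum[OF test_functions_differentiable[OF assms]] f_def
      by (simp add: sum_negf sum_distrib_left mult_ac)
    ultimately show ?thesis unfolding has_field_derivative_def by simp
  qed
  have cf: "continuous_on {0..1} f" unfolding f_def
    by (intro continuous_intros continuous_on_compose2[OF test_functions_partial_continuous[OF assms]]) auto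
  have "(LINT t|lborel. indicator {0..1} t *\<^sub>R f t) = F 1 - F 0"
    by (rule integral_FTC_atLeastAtMost)
      (use D cf in \<open>auto simp: has_real_derivative_iff_has_vector_derivative intro: has_vector_derivative_at_within\<close>)
  then show ?thesis by (simp add: F_def f_def)
qed

lemma test_function_partial_DERIV:
  fixes \<phi> :: "real^'n \<Rightarrow> real"
  assumes "\<phi> \<in> test_functions U"
  shows "((\<lambda>s. \<phi> (x + s *\<^sub>R axis i 1)) has_real_derivative partial_deriv i \<phi> (x + s *\<^sub>R axis i 1)) (at s)"
proof -
  have "((\<lambda>s. \<phi> (x + s *\<^sub>R axis i 1)) has_derivative (\<lambda>t. frechet_derivative \<phi> (at (x + s *\<^sub>R axis i 1))
      (t *\<^sub>R axis i 1))) (at s)"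
    by (rule has_derivative_compose[where f="\<lambda>s. x + s *\<^sub>R axis i
        1", OF _ has_derivative_frechet[OF test_functions_differentiable[OF assms]]])
      (auto intro!: derivative_eq_intros)
  moreover have "frechet_derivative \<phi> (at (x + s *\<^sub>R axis i 1)) (t *\<^sub>R axis i 1)
      = partial_deriv i \<phi> (x + s *\<^sub>R axis i 1) * t" for t
    using linear_frechet_derivative[OF test_functions_differentiable[OF assms], of "x + s *\<^sub>R axis i 1"]
    by (simp add: linear_scale partial_deriv_def)
  ultimately show ?thesis unfolding has_field_derivative_def by simp
qed

lemma integrable_bounded_mult:
  fixes f g :: "'a \<Rightarrow> real"
  assumes "integrable M f" "g \<in> borel_measurable M" "\<And>x. \<bar>g x\<bar> \<le> B"
  shows "integrable M (\<lambda>x. f x * g x)"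
proof (rule Bochner_Integration.integrable_bound[where f="\<lambda>x. B * f x"])
  show "AE x in M. norm (f x * g x) \<le> norm (B * f x)"
  proof (rule AE_I2)
    fix x
    have "\<bar>g x\<bar> \<le> \<bar>B\<bar>" using assms(3)[of x] by linarith
    then have "\<bar>f x\<bar> * \<bar>g x\<bar> \<le> \<bar>f x\<bar> * \<bar>B\<bar>" by (intro mult_left_mono) auto
    then show "norm (f x * g x) \<le> norm (B * f x)" by (simp add: abs_mult mult.commute)
  qed
qed (use assms in auto)

text \<open>Licenses the interchanges of integrals below: the integral of \<bar>g\<bar> over all of
  space does not feel the shift by t h, so the bound is uniform in \<open>t\<close>.\<close>

lemma integrable_shifts:
  fixes g :: "real^'n \<Rightarrow> real"
  assumes g: "integrable lborel g" 
    and \<psi>: "(\<lambda>(t, x). \<psi> t x) \<in> borel_measurable (borel \<Otimes>\<^sub>M borel)" and M: "\<And>t x. \<bar>\<psi> t x\<bar> \<le> M"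
  shows "integrable (lborel \<Otimes>\<^sub>M lborel) (\<lambda>(t, x). indicator {0..1::real} t * (g (x + t *\<^sub>R h) * \<psi> t x))"
proof (rule lborel_pair.Fubini_integrable)
  have gm[measurable]: "g \<in> borel_measurable borel" using g by auto
  have \<psi>m[measurable]: "(\<lambda>x. \<psi> (fst x) (snd x)) \<in> borel_measurable (borel \<Otimes>\<^sub>M borel)" using \<psi>
      by (simp add: split_beta')
  have "(\<lambda>x::real \<times> (real^'n). snd x + fst x *\<^sub>R h) \<in> borel_measurable borel"
    by (intro borel_measurable_continuous_onI continuous_intros)
  then have [measurable]: "(\<lambda>x::real \<times> (real^'n). snd x + fst x *\<^sub>R h) \<in> borel_measurable (borel \<Otimes>\<^sub>M borel)"
    by (simp add: borel_prod)
  show "(\<lambda>(t, x). indicator {0..1::real} t * (g (x + t *\<^sub>R h) * \<psi> t x)) \<in> borel_measurable (lborel \<Otimes>\<^sub>M lborel)"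
    unfolding split_beta' by measurable
  have \<psi>1: "\<psi> t \<in> borel_measurable borel" for t
    using measurable_compose[OF measurable_Pair1' \<psi>, of t] by simp
  have i: "integrable lborel (\<lambda>x. g (x + t *\<^sub>R h) * \<psi> t x)" for t
    by (rule integrable_bounded_mult[OF integrable_lborel_translate[OF g]]) (use \<psi>1 M in auto)
  then show "AE t in lborel. integrable lborel (\<lambda>x. case (t, x) of (t, x) \<Rightarrow> indicator {0..1} t *
      (g (x + t *\<^sub>R h) * \<psi> t x))"
    by simp
  have M0: "M \<ge> 0" using M[of 0 0] by linarith
  show "integrable lborel (\<lambda>t::real. LINT x|lborel. norm (case (t, x) of (t, x) \<Rightarrow> indicator {0..1} t *
      (g (x + t *\<^sub>R h) * \<psi> t x)))"
  proof (rule Bochner_Integration.integrable_bound[where f="\<lambda>t. indicator {0..1} t * (M * (LINT x|lborel. \<bar>g x\<bar>))"])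
    show "AE t in lborel. norm (LINT x|lborel. norm (case (t, x) of (t, x) \<Rightarrow> indicator {0..1} t *
        (g (x + t *\<^sub>R h) * \<psi> t x)))
       \<le> norm (indicator {0..1} t * (M * (LINT x|lborel. \<bar>g x\<bar>)))"
    proof (rule AE_I2)
      fix t :: real
      have "(LINT x|lborel. \<bar>g (x + t *\<^sub>R h) * \<psi> t x\<bar>) \<le> (LINT x|lborel. M * \<bar>g (x + t *\<^sub>R h)\<bar>)"
      proof (rule integral_mono)
        show "\<bar>g (x + t *\<^sub>R h) * \<psi> t x\<bar> \<le> M * \<bar>g (x + t *\<^sub>R h)\<bar>" for x
          using M[of t x] by (simp add: abs_mult mult.commute mult_right_mono)
      qed (use i g integrable_lborel_translate[OF g] in auto)
      also have "\<dots> = M * (LINT x|lborel. \<bar>g x\<bar>)"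
        using integral_lborel_translate[of "\<lambda>x. \<bar>g x\<bar>"] by simp
      finally show "norm (LINT x|lborel. norm (case (t, x) of (t, x) \<Rightarrow> indicator {0..1} t * (g (x + t *\<^sub>R h) * \<psi> t
          x)))
       \<le> norm (indicator {0..1} t * (M * (LINT x|lborel. \<bar>g x\<bar>)))"
        using M0 by (auto simp: indicator_def abs_mult)
    qed
    show "integrable lborel (\<lambda>t. indicator {0..1::real} t * (M * (LINT x|lborel. \<bar>g x\<bar>)))"
      by (intro integrable_mult_left) (auto simp: integrable_real_indicator)
  qed (unfold split_beta', measurable)
qed

text \<open>Instead of mollifying, both sides are tested with \<phi> supported in \<open>U\<close>.
  Every translate of \<phi> by t h with t in [0,1] is a test function of \<Omega>, so the definition
  of the weak gradient applies for each \<open>t\<close>, and integrating over \<open>t\<close>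
  rebuilds a difference of \<phi>. The fundamental lemma then gives the identity for almost every
  \<open>x\<close>, with \<open>h\<close> fixed.\<close>

lemma weak_gradient_difference:
  fixes p :: "real^'n \<Rightarrow> real" and g :: "real^'n \<Rightarrow> real^'n"
  assumes p: "integrable lborel p" and g: "integrable lborel g"
    and wg: "\<And>\<phi> i. \<phi> \<in> test_functions \<Omega> \<Longrightarrow> (LINT x|lborel. p x * partial_deriv i \<phi> x)
        = - (LINT x|lborel. g x $ i * \<phi> x)"
    and U: "open U" "\<And>x t. x \<in> U \<Longrightarrow> t \<in> {0..1} \<Longrightarrow> x + t *\<^sub>R h \<in> \<Omega>"
  shows "AE x in lborel. x \<in> U \<longrightarrow> p (x + h) - p x = (LINT t|lborel. indicator {0..1} t * (g (x + t *\<^sub>R h) \<bullet> h))"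
proof -
  define J where "J x = (LINT t|lborel. indicator {0..1} t * (g (x + t *\<^sub>R h) \<bullet> h))" for x
  have pm[measurable]: "p \<in> borel_measurable borel" and gm[measurable]: "g \<in> borel_measurable borel" using p g by auto
  have gh: "integrable lborel (\<lambda>x. g x \<bullet> h)" using g by simp
  have gi: "integrable lborel (\<lambda>x. g x $ i)" for i using g by (simp add: cart_eq_inner_axis)
  have J: "integrable lborel J"
    using lborel_pair.integrable_snd[OF integrable_shifts[OF gh, of "\<lambda>t x. 1" 1 h]] by (simp add: J_def[abs_def])
  define F where "F x = p (x + h) - p x - J x" for x
  have F: "integrable lborel F" unfolding F_def
    by (intro Bochner_Integration.integrable_diff integrable_lborel_translate p J)
  have "AE x in lebesgue. x \<in> U \<longrightarrow> F x = 0"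
  proof (rule fundamental_lemma[OF U(1)])
    show "integrable lebesgue F" using F by (simp add: integrable_completion)
    fix \<phi> assume \<phi>: "\<phi> \<in> test_functions U"
    obtain M where M: "M \<ge> 0" "\<And>x. \<bar>\<phi> x\<bar> \<le> M" "\<And>i x. \<bar>partial_deriv i \<phi> x\<bar> \<le> M" using test_functions_bounded[OF \<phi>]
        by blast
    have \<phi>m[measurable]: "\<phi> \<in> borel_measurable borel" by (rule test_functions_measurable[OF \<phi>])
    have dm[measurable]: "partial_deriv i \<phi> \<in> borel_measurable borel" for i
      by (rule borel_measurable_continuous_onI[OF test_functions_partial_continuous[OF \<phi>]])
    have shift: "(\<lambda>x. \<phi> (x - t *\<^sub>R h)) \<in> test_functions \<Omega>" if "t \<in> {0..1}" for t
      by (rule test_functions_translate[OF \<phi>]) (use U(2) that in auto)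
    have pd: "partial_deriv i (\<lambda>x. \<phi> (x - y)) x = partial_deriv i \<phi> (x - y)" for i x y
      using partial_deriv_translate[of \<phi> i "- y"] test_functions_differentiable[OF \<phi>] by (simp add: fun_eq_iff)
    have e1: "(LINT x|lborel. p (x + h) * \<phi> x) = (LINT x|lborel. p x * \<phi> (x - h))"
      using integral_lborel_translate[of "\<lambda>x. p x * \<phi> (x - h)" h] by simp
    define Dh where "Dh y = (\<Sum>i\<in>UNIV. h $ i * partial_deriv i \<phi> y)" for y
    have Dhm[measurable]: "Dh \<in> borel_measurable borel" unfolding Dh_def by measurable
    have DhM: "\<bar>Dh y\<bar> \<le> (\<Sum>i\<in>UNIV. \<bar>h $ i\<bar> * M)" for y
      unfolding Dh_def by (rule order_trans[OF sum_abs]) (auto intro!: sum_mono mult_left_mono M simp: abs_mult)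
    have sm: "(\<lambda>x::real \<times> (real^'n). snd x - fst x *\<^sub>R h) \<in> borel_measurable (borel \<Otimes>\<^sub>M borel)"
      unfolding borel_prod by (intro borel_measurable_continuous_onI continuous_intros)
    have i1: "integrable (lborel \<Otimes>\<^sub>M lborel) (\<lambda>(t, x). indicator {0..1::real} t * (g (x + t *\<^sub>R h) \<bullet> h * \<phi> x))"
      by (rule integrable_shifts[OF gh]) (use M in auto)
    \<comment> \<open>Here the shift sits in the bounded factor, so \<open>integrable_shifts\<close>
      is used with displacement 0.\<close>
    have i2: "integrable (lborel \<Otimes>\<^sub>M lborel) (\<lambda>(t, x). indicator {0..1::real} t * (p x * Dh (x - t *\<^sub>R h)))"
      using integrable_shifts[OF p _ DhM, of "\<lambda>t x. x - t *\<^sub>R h" 0]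
        measurable_compose[OF sm Dhm] by (simp add: split_beta')
    have "(LINT x|lborel. J x * \<phi> x) = (LINT x|lborel. LINT t|lborel. indicator {0..1} t * (g (x + t *\<^sub>R h) \<bullet> h * \<phi>
        x))"
      unfolding J_def by (simp add: mult.assoc[symmetric])
    also have "\<dots> = (LINT t|lborel. LINT x|lborel. indicator {0..1} t * (g (x + t *\<^sub>R h) \<bullet> h * \<phi> x))"
      by (rule lborel_pair.Fubini_integral[OF i1])
    \<comment> \<open>The weak gradient is traded for derivatives of the translated test function,
      one \<open>t\<close> at a time.\<close>
    also have "\<dots> = (LINT t|lborel. LINT x|lborel. indicator {0..1} t * - (p x * Dh (x - t *\<^sub>R h)))"
    proof (rule Bochner_Integration.integral_cong[OF refl])
      fix t :: real
      show "(LINT x|lborel. indicator {0..1} t * (g (x + t *\<^sub>R h) \<bullet> h * \<phi> x))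
          = (LINT x|lborel. indicator {0..1} t * - (p x * Dh (x - t *\<^sub>R h)))"
      proof (cases "t \<in> {0..1}")
        case True
        note s = shift[OF True]
        have b: "integrable lborel (\<lambda>x. g x $ i * \<phi> (x - t *\<^sub>R h))" for i
          by (rule integrable_bounded_mult[OF gi]) (use M in auto)
        have b2: "integrable lborel (\<lambda>x. p x * partial_deriv i \<phi> (x - t *\<^sub>R h))" for i
          by (rule integrable_bounded_mult[OF p]) (use M in auto)
        have "(LINT x|lborel. g (x + t *\<^sub>R h) \<bullet> h * \<phi> x) = (LINT x|lborel. g x \<bullet> h * \<phi> (x - t *\<^sub>R h))"
          using integral_lborel_translate[of "\<lambda>x. g x \<bullet> h * \<phi> (x - t *\<^sub>R h)" "t *\<^sub>R h"] by simp
        also have "\<dots> = (LINT x|lborel. (\<Sum>i\<in>UNIV. h $ i * (g x $ i * \<phi> (x - t *\<^sub>R h))))"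
          by (simp add: inner_vec_def sum_distrib_left mult_ac)
        also have "\<dots> = (\<Sum>i\<in>UNIV. h $ i * (LINT x|lborel. g x $ i * \<phi> (x - t *\<^sub>R h)))"
          using b by (subst Bochner_Integration.integral_sum) auto
        also have "\<dots> = (\<Sum>i\<in>UNIV. - (h $ i * (LINT x|lborel. p x * partial_deriv i \<phi> (x - t *\<^sub>R h))))"
          using wg[OF s] by (simp add: pd)
        also have "\<dots> = - (LINT x|lborel. (\<Sum>i\<in>UNIV. h $ i * (p x * partial_deriv i \<phi> (x - t *\<^sub>R h))))"
          using b2 by (subst Bochner_Integration.integral_sum) (auto simp: sum_negf)
        also have "\<dots> = - (LINT x|lborel. p x * Dh (x - t *\<^sub>R h))"
          by (simp add: Dh_def sum_distrib_left mult_ac)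
        finally show ?thesis using True by simp
      qed simp
    qed
    also have "\<dots> = - (LINT t|lborel. LINT x|lborel. indicator {0..1} t * (p x * Dh (x - t *\<^sub>R h)))"
      by simp
    also have "(LINT t|lborel. LINT x|lborel. indicator {0..1} t * (p x * Dh (x - t *\<^sub>R h)))
        = (LINT x|lborel. LINT t|lborel. indicator {0..1} t * (p x * Dh (x - t *\<^sub>R h)))"
      by (rule lborel_pair.Fubini_integral[OF i2, symmetric])
    also have "\<dots> = (LINT x|lborel. p x * (LINT t|lborel. indicator {0..1} t * Dh (x - t *\<^sub>R h)))"
      by (simp add: mult.left_commute)
    also have "\<dots> = (LINT x|lborel. p x * (\<phi> x - \<phi> (x - h)))"
      unfolding Dh_def test_function_segment[OF \<phi>] ..
    finally have e2: "(LINT x|lborel. J x * \<phi> x) = - (LINT x|lborel. p x * (\<phi> x - \<phi> (x - h)))" .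
    have ip: "integrable lborel (\<lambda>x. p x * \<phi> x)" "integrable lborel (\<lambda>x. p x * \<phi> (x - h))"
        "integrable lborel (\<lambda>x. p (x + h) * \<phi> x)"
      "integrable lborel (\<lambda>x. J x * \<phi> x)"
      using M by (auto intro!: integrable_bounded_mult p J integrable_lborel_translate)
    have "(LINT x|lborel. F x * \<phi> x) = 0"
      using e1 e2 ip by (simp add: F_def left_diff_distrib right_diff_distrib)
    then show "(LINT x|lebesgue. F x * \<phi> x) = 0"
      using F by (subst integral_completion) auto
  qed
  then have "AE x in lborel. x \<in> U \<longrightarrow> F x = 0"
    by (simp add: AE_completion_iff)
  then show ?thesis by eventually_elim (auto simp: F_def J_def)
qed

section \<open>A Poincare inequality for two sets joined by segments\<close>

lemma square_integral_unit_interval_le: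
  fixes f :: "real \<Rightarrow> real"
  assumes [measurable]: "f \<in> borel_measurable borel"
  shows "ennreal ((LINT t|lborel. indicator {0..1} t * f t)\<^sup>2)
      \<le> (\<integral>\<^sup>+t. indicator {0..1} t * ennreal ((f t)\<^sup>2) \<partial>lborel)"
proof (cases "integrable lborel (\<lambda>t. indicator {0..1} t * f t)")
  case True
  let ?I = "indicator {0..1} :: real \<Rightarrow> ennreal"
  have "ennreal (norm (LINT t|lborel. indicator {0..1} t * f t)) \<le> (\<integral>\<^sup>+t. ennreal (norm (indicator {0..1} t * f t))
      \<partial>lborel)"
    by (rule integral_norm_bound_ennreal[OF True])
  also have "\<dots> = (\<integral>\<^sup>+t. (?I t * ennreal \<bar>f t\<bar>) * ?I t \<partial>lborel)"
    by (intro nn_integral_cong) (auto simp: indicator_def)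
  finally have "(ennreal (norm (LINT t|lborel. indicator {0..1} t * f t)))\<^sup>2
      \<le> (\<integral>\<^sup>+t. (?I t * ennreal \<bar>f t\<bar>) * ?I t \<partial>lborel)\<^sup>2"
    by (rule power_mono) simp
  also have "\<dots> \<le> (\<integral>\<^sup>+t. (?I t * ennreal \<bar>f t\<bar>)\<^sup>2 \<partial>lborel) * (\<integral>\<^sup>+t. (?I t)\<^sup>2 \<partial>lborel)"
    by (rule Cauchy_Schwarz_nn_integral) auto
  also have "(\<integral>\<^sup>+t. (?I t)\<^sup>2 \<partial>lborel) = (\<integral>\<^sup>+t. ?I t \<partial>lborel)"
    by (intro nn_integral_cong) (auto simp: indicator_def)
  also have "\<dots> = 1" by simp
  also have "(\<integral>\<^sup>+t. (?I t * ennreal \<bar>f t\<bar>)\<^sup>2 \<partial>lborel) = (\<integral>\<^sup>+t. ?I t * ennreal ((f t)\<^sup>2) \<partial>lborel)"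
    by (intro nn_integral_cong) (auto simp: indicator_def ennreal_power)
  finally show ?thesis by (simp add: ennreal_power)
\<comment> \<open>A non-integrable integrand makes the left integral 0 by convention, so the bound
  holds without an integrability assumption.\<close>
qed (simp add: not_integrable_integral_eq)

lemma nn_integral_lborel_contract_le:
  fixes f :: "'a::euclidean_space \<Rightarrow> ennreal"
  assumes [measurable]: "f \<in> borel_measurable borel" and c: "c \<ge> 1/2"
  shows "(\<integral>\<^sup>+x. f (t + c *\<^sub>R x) \<partial>lborel) \<le> ennreal (2^DIM('a)) * (\<integral>\<^sup>+x. f x \<partial>lborel)"
proof -
  have "(\<integral>\<^sup>+x. f x \<partial>lborel) = (\<integral>\<^sup>+x. f x \<partial>density (distr lborel borel (\<lambda>x. t + c *\<^sub>R x)) (\<lambda>_. \<bar>c\<bar>^DIM('a)))"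
    using c by (subst lborel_affine[of c t]) auto
  also have "\<dots> = (\<integral>\<^sup>+x. ennreal (\<bar>c\<bar>^DIM('a)) * f (t + c *\<^sub>R x) \<partial>lborel)"
    by (subst nn_integral_density, simp, simp, subst nn_integral_distr) auto
  also have "\<dots> = ennreal (\<bar>c\<bar>^DIM('a)) * (\<integral>\<^sup>+x. f (t + c *\<^sub>R x) \<partial>lborel)"
    by (rule nn_integral_cmult) simp
  finally have eq: "(\<integral>\<^sup>+x. f x \<partial>lborel) = ennreal (\<bar>c\<bar>^DIM('a)) * (\<integral>\<^sup>+x. f (t + c *\<^sub>R x) \<partial>lborel)" .
  have "1 \<le> (2 * c)^DIM('a)" using c by (intro one_le_power) simp
  then have "1 \<le> ennreal (2^DIM('a)) * ennreal (\<bar>c\<bar>^DIM('a))"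
    using c by (simp add: ennreal_mult[symmetric] power_mult_distrib)
  then have "1 * (\<integral>\<^sup>+x. f (t + c *\<^sub>R x) \<partial>lborel) \<le> (ennreal (2^DIM('a)) * ennreal (\<bar>c\<bar>^DIM('a))) *
      (\<integral>\<^sup>+x. f (t + c *\<^sub>R x) \<partial>lborel)"
    by (rule mult_right_mono) simp
  then show ?thesis unfolding eq by (simp add: mult.assoc)
qed

text \<open>The point x + t (y - x) moves with speed \<open>t\<close> in \<open>y\<close> and 1 -
  \<open>t\<close> in \<open>x\<close>. One of the two is at least 1/2; integrating over that
  variable first costs a Jacobian of at most 2^n, uniformly in \<open>t\<close>.\<close>

lemma nn_integral_convex_combination_le:
  fixes G :: "real^'n \<Rightarrow> ennreal"
  assumes [measurable]: "G \<in> borel_measurable borel" "A \<in> sets borel" "B \<in> sets borel"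
    and V: "emeasure lborel A \<le> V" "emeasure lborel B \<le> V" and t: "t \<in> {0..1}"
  shows "(\<integral>\<^sup>+x. \<integral>\<^sup>+y. indicator A x * indicator B y * G (x + t *\<^sub>R (y - x)) \<partial>lborel \<partial>lborel)
    \<le> V * (ennreal (2^CARD('n)) * (\<integral>\<^sup>+z. G z \<partial>lborel))"
proof -
  let ?G = "ennreal (2^CARD('n)) * (\<integral>\<^sup>+z. G z \<partial>lborel)"
  have sm: "(\<lambda>p::(real^'n) \<times> (real^'n). fst p + t *\<^sub>R (snd p - fst p)) \<in> borel_measurable (borel \<Otimes>\<^sub>M borel)"
    unfolding borel_prod by (intro borel_measurable_continuous_onI continuous_intros)
  have Gm: "(\<lambda>p. G (fst p + t *\<^sub>R (snd p - fst p))) \<in> borel_measurable (borel \<Otimes>\<^sub>M borel)"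
    using measurable_compose[OF sm assms(1)] .
  show ?thesis
  proof (cases "t \<ge> 1/2")
    case True
    have "(\<integral>\<^sup>+y. indicator A x * indicator B y * G (x + t *\<^sub>R (y - x)) \<partial>lborel) \<le> indicator A x * ?G" for x
    proof -
      have "(\<integral>\<^sup>+y. indicator A x * indicator B y * G (x + t *\<^sub>R (y - x)) \<partial>lborel)
          \<le> (\<integral>\<^sup>+y. indicator A x * G ((1 - t) *\<^sub>R x + t *\<^sub>R y) \<partial>lborel)"
        by (intro nn_integral_mono) (auto simp: indicator_def algebra_simps)
      also have "\<dots> = indicator A x * (\<integral>\<^sup>+y. G ((1 - t) *\<^sub>R x + t *\<^sub>R y) \<partial>lborel)"
        by (rule nn_integral_cmult) simp
      also have "\<dots> \<le> indicator A x * ?G"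
        using nn_integral_lborel_contract_le[OF assms(1) True, of "(1 - t) *\<^sub>R x"] by (intro mult_left_mono) auto
      finally show ?thesis .
    qed
    then have "(\<integral>\<^sup>+x. \<integral>\<^sup>+y. indicator A x * indicator B y * G (x + t *\<^sub>R (y - x)) \<partial>lborel \<partial>lborel)
        \<le> (\<integral>\<^sup>+x. indicator A x * ?G \<partial>lborel)"
      by (rule nn_integral_mono)
    also have "\<dots> = emeasure lborel A * ?G" by (subst nn_integral_multc) auto
    also have "\<dots> \<le> V * ?G" by (intro mult_right_mono V) simp
    finally show ?thesis .
  next
    case False
    have "(\<integral>\<^sup>+x. indicator A x * indicator B y * G (x + t *\<^sub>R (y - x)) \<partial>lborel) \<le> indicator B y * ?G" for y
    proof -
      have "(\<integral>\<^sup>+x. indicator A x * indicator B y * G (x + t *\<^sub>R (y - x)) \<partial>lborel)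
          \<le> (\<integral>\<^sup>+x. indicator B y * G (t *\<^sub>R y + (1 - t) *\<^sub>R x) \<partial>lborel)"
        by (intro nn_integral_mono) (auto simp: indicator_def algebra_simps)
      also have "\<dots> = indicator B y * (\<integral>\<^sup>+x. G (t *\<^sub>R y + (1 - t) *\<^sub>R x) \<partial>lborel)"
        by (rule nn_integral_cmult) simp
      also have "\<dots> \<le> indicator B y * ?G"
        using nn_integral_lborel_contract_le[OF assms(1), of "1 - t" "t *\<^sub>R y"] False by (intro mult_left_mono) auto
      finally show ?thesis .
    qed
    then have *: "(\<integral>\<^sup>+y. \<integral>\<^sup>+x. indicator A x * indicator B y * G (x + t *\<^sub>R (y - x)) \<partial>lborel \<partial>lborel)
        \<le> (\<integral>\<^sup>+y. indicator B y * ?G \<partial>lborel)"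
      by (rule nn_integral_mono)
    have "(\<integral>\<^sup>+x. \<integral>\<^sup>+y. indicator A x * indicator B y * G (x + t *\<^sub>R (y - x)) \<partial>lborel \<partial>lborel) =
      (\<integral>\<^sup>+y. \<integral>\<^sup>+x. indicator A x * indicator B y * G (x + t *\<^sub>R (y - x)) \<partial>lborel \<partial>lborel)"
      using Gm by (intro lborel_pair.Fubini'[symmetric]) (auto simp: split_beta')
    also note *
    also have "(\<integral>\<^sup>+y. indicator B y * ?G \<partial>lborel) = emeasure lborel B * ?G" by (subst nn_integral_multc) auto
    also have "\<dots> \<le> V * ?G" by (intro mult_right_mono V) simp
    finally show ?thesis .
  qed
qed

text \<open>By \<open>weak_gradient_difference\<close> and Cauchy-Schwarz, the squared difference of
  \<open>p\<close> at the two ends is at most D^2 times the mean of \<bar>g\<bar>^2 along the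
  segment. Integrated over all pairs, each \<open>t\<close> contributes at most V 2^n times the
  integral of \<bar>g\<bar>^2 over \<open>W\<close>. The set \<open>W\<close> keeps the estimate
  local.\<close>

lemma poincare_two_sets:
  fixes p :: "real^'n \<Rightarrow> real" and g :: "real^'n \<Rightarrow> real^'n"
  assumes p: "integrable lborel p" and g: "integrable lborel g"
    and wg: "\<And>\<phi> i. \<phi> \<in> test_functions \<Omega> \<Longrightarrow> (LINT x|lborel. p x * partial_deriv i \<phi> x)
        = - (LINT x|lborel. g x $ i * \<phi> x)"
    and \<Omega>: "open \<Omega>"
    and sets[measurable]: "A \<in> sets borel" "B \<in> sets borel" "W \<in> sets borel"
    and V: "emeasure lborel A \<le> V" "emeasure lborel B \<le> V"
    and seg: "\<And>x y t. x \<in> A \<Longrightarrow> y \<in> B \<Longrightarrow> t \<in> {0..1} \<Longrightarrow> x + t *\<^sub>R (y - x) \<in> \<Omega> \<inter> W"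
    and D: "\<And>x y. x \<in> A \<Longrightarrow> y \<in> B \<Longrightarrow> norm (y - x) \<le> D"
  shows "(\<integral>\<^sup>+x. \<integral>\<^sup>+y. indicator A x * indicator B y * ennreal ((p x - p y)\<^sup>2) \<partial>lborel \<partial>lborel)
    \<le> ennreal (D\<^sup>2) * (V * (ennreal (2^CARD('n)) * (\<integral>\<^sup>+z. indicator W z * ennreal ((norm (g z))\<^sup>2) \<partial>lborel)))"
proof -
  have pm[measurable]: "p \<in> borel_measurable borel" and gm[measurable]: "g \<in> borel_measurable borel" using p g by auto
  define G where "G z = indicator W z * ennreal ((norm (g z))\<^sup>2)" for z
  have Gm[measurable]: "G \<in> borel_measurable borel" unfolding G_def by measurable
  let ?I = "indicator {0..1} :: real \<Rightarrow> ennreal"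
  have sm: "(\<lambda>q::((real^'n) \<times> (real^'n)) \<times> real. fst (fst q) + snd q *\<^sub>R snd (fst q)) \<in> borel_measurable
      ((borel \<Otimes>\<^sub>M borel) \<Otimes>\<^sub>M borel)"
    unfolding borel_prod by (intro borel_measurable_continuous_onI continuous_intros)
  have pl[measurable]: "(\<lambda>q::(real^'n) \<times> (real^'n). fst q + snd q) \<in> borel_measurable (borel \<Otimes>\<^sub>M borel)"
    unfolding borel_prod by (intro borel_measurable_continuous_onI continuous_intros)
  \<comment> \<open>The exceptional null set depends on the displacement, so pairs (x, y) are
    parametrised by \<open>x\<close> and h = y - x.\<close>
  have *: "AE x in lborel. indicator A x * indicator B (x + h) * ennreal ((p x - p (x + h))\<^sup>2)
     \<le> (\<integral>\<^sup>+t. ?I t * (ennreal (D\<^sup>2) * (indicator A x * indicator B (x + h) * G (x + t *\<^sub>R h))) \<partial>lborel)" for h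
  proof -
    \<comment> \<open>Contains every \<open>x\<close> in \<open>A\<close> with x + h in
      \<open>B\<close>; it is open because the segment is compact.\<close>
    let ?U = "{x. \<forall>t\<in>{0..1}. x + t *\<^sub>R h \<in> \<Omega>}"
    have U: "open ?U"
    proof (subst open_contains_ball, intro ballI)
      fix x assume x: "x \<in> ?U"
      have "compact ((\<lambda>t. x + t *\<^sub>R h) ` {0..1})" by (intro compact_continuous_image continuous_intros) auto
      moreover have "(\<lambda>t. x + t *\<^sub>R h) ` {0..1} \<subseteq> \<Omega>" using x by auto
      ultimately obtain e where e: "e > 0" "(\<Union>y\<in>(\<lambda>t. x + t *\<^sub>R h) ` {0..1}. ball y e) \<subseteq> \<Omega>"
        using compact_subset_open_imp_ball_epsilon_subset[OF _ \<Omega>] by metis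
      have "ball x e \<subseteq> ?U"
      proof
        fix x' assume "x' \<in> ball x e"
        then have "x' + t *\<^sub>R h \<in> ball (x + t *\<^sub>R h) e" for t by (simp add: dist_norm)
        then show "x' \<in> ?U" using e(2) by blast
      qed
      then show "\<exists>e>0. ball x e \<subseteq> ?U" using e(1) by blast
    qed
    have "AE x in lborel. x \<in> ?U \<longrightarrow> p (x + h) - p x = (LINT t|lborel. indicator {0..1} t * (g (x + t *\<^sub>R h) \<bullet> h))"
      by (rule weak_gradient_difference[OF p g wg U]) auto
    then show ?thesis
    proof eventually_elim
      case (elim x)
      show ?case
      proof (cases "x \<in> A \<and> x + h \<in> B")
        case True
        have s: "x + t *\<^sub>R h \<in> \<Omega> \<inter> W" if "t \<in> {0..1}" for t using seg[of x "x + h" t] True that by simp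
        then have eq: "p (x + h) - p x = (LINT t|lborel. indicator {0..1} t * (g (x + t *\<^sub>R h) \<bullet> h))" using elim
            by blast
        have hD: "norm h \<le> D" using D[of x "x + h"] True by simp
        have "ennreal ((p x - p (x + h))\<^sup>2) = ennreal ((LINT t|lborel. indicator {0..1} t * (g (x + t *\<^sub>R h) \<bullet> h))\<^sup>2)"
          unfolding eq[symmetric] by (simp add: power2_commute)
        also have "\<dots> \<le> (\<integral>\<^sup>+t. ?I t * ennreal ((g (x + t *\<^sub>R h) \<bullet> h)\<^sup>2) \<partial>lborel)"
          by (rule square_integral_unit_interval_le) simp
        also have "\<dots> \<le> (\<integral>\<^sup>+t. ?I t * (ennreal (D\<^sup>2) * G (x + t *\<^sub>R h)) \<partial>lborel)"
        proof (rule nn_integral_mono)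
          fix t :: real
          show "?I t * ennreal ((g (x + t *\<^sub>R h) \<bullet> h)\<^sup>2) \<le> ?I t * (ennreal (D\<^sup>2) * G (x + t *\<^sub>R h))"
          proof (cases "t \<in> {0..1}")
            case t: True
            have "\<bar>g (x + t *\<^sub>R h) \<bullet> h\<bar> \<le> norm (g (x + t *\<^sub>R h)) * D"
              using Cauchy_Schwarz_ineq2[of "g (x + t *\<^sub>R h)" h] mult_left_mono[OF hD norm_ge_zero]
                  by (rule order_trans)
            then have "(g (x + t *\<^sub>R h) \<bullet> h)\<^sup>2 \<le> (norm (g (x + t *\<^sub>R h)) * D)\<^sup>2"
              by (rule abs_le_square_iff[THEN iffD1, OF order_trans]) simp
            then show ?thesis using s[OF t] t by (auto simp: G_def ennreal_mult[symmetric] power_mult_distrib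
                mult.commute intro!: ennreal_leI)
          qed simp
        qed
        finally show ?thesis using True by simp
      qed (auto simp: indicator_def)
    qed
  qed
  have m1: "(\<lambda>(x, h). indicator A x * indicator B (x + h) * ennreal ((p x - p (x + h))\<^sup>2)) \<in> borel_measurable
      (borel \<Otimes>\<^sub>M borel)"
    unfolding split_beta' by measurable
  have m2: "(\<lambda>q. ?I (snd q) * (ennreal (D\<^sup>2) * (indicator A (fst (fst q)) * indicator B (fst (fst q) + snd (fst q)) *
      G (fst (fst q) + snd q *\<^sub>R snd (fst q)))))
     \<in> borel_measurable ((borel \<Otimes>\<^sub>M borel) \<Otimes>\<^sub>M borel)"
    using measurable_compose[OF sm Gm] by measurable
  define K where "K x h t = ?I t * (ennreal (D\<^sup>2) * (indicator A x * indicator B (x + h) * G (x + t *\<^sub>R h)))"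
      for x h t
  have Km: "(\<lambda>q. K (fst (fst q)) (snd (fst q)) (snd q)) \<in> borel_measurable ((borel \<Otimes>\<^sub>M borel) \<Otimes>\<^sub>M borel)"
    using m2 by (simp add: K_def)
  have "(\<integral>\<^sup>+x. \<integral>\<^sup>+y. indicator A x * indicator B y * ennreal ((p x - p y)\<^sup>2) \<partial>lborel \<partial>lborel)
     = (\<integral>\<^sup>+x. \<integral>\<^sup>+h. indicator A x * indicator B (x + h) * ennreal ((p x - p (x + h))\<^sup>2) \<partial>lborel \<partial>lborel)"
  proof (rule nn_integral_cong)
    fix x
    show "(\<integral>\<^sup>+y. indicator A x * indicator B y * ennreal ((p x - p y)\<^sup>2) \<partial>lborel) = 
      (\<integral>\<^sup>+h. indicator A x * indicator B (x + h) * ennreal ((p x - p (x + h))\<^sup>2) \<partial>lborel)"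
      using nn_integral_lborel_translate[of "\<lambda>y. indicator A x * indicator B y * ennreal ((p x - p y)\<^sup>2)" x]
      by (simp add: add.commute)
  qed
  also have "\<dots> = (\<integral>\<^sup>+h. \<integral>\<^sup>+x. indicator A x * indicator B (x + h) * ennreal ((p x - p (x + h))\<^sup>2) \<partial>lborel \<partial>lborel)"
    using m1 by (intro lborel_pair.Fubini'[symmetric]) (simp add: split_beta')
  also have "\<dots> \<le> (\<integral>\<^sup>+h. \<integral>\<^sup>+x. \<integral>\<^sup>+t. K x h t \<partial>lborel \<partial>lborel \<partial>lborel)"
    unfolding K_def by (intro nn_integral_mono nn_integral_mono_AE *)
  \<comment> \<open>The following exchanges bring \<open>t\<close> to the outside, so that for fixed
    \<open>t\<close> the inner integrals run over pairs of points again.\<close>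
  also have "\<dots> = (\<integral>\<^sup>+x. \<integral>\<^sup>+h. \<integral>\<^sup>+t. K x h t \<partial>lborel \<partial>lborel \<partial>lborel)"
  proof (rule lborel_pair.Fubini')
    have "(\<lambda>q. \<integral>\<^sup>+t. K (fst q) (snd q) t \<partial>lborel) \<in> borel_measurable (borel \<Otimes>\<^sub>M borel)"
      using Km by (intro lborel.borel_measurable_nn_integral) (simp add: split_beta')
    then show "(\<lambda>(x, h). \<integral>\<^sup>+t. K x h t \<partial>lborel) \<in> borel_measurable (lborel \<Otimes>\<^sub>M lborel)"
      by (simp add: split_beta')
  qed
  also have "\<dots> = (\<integral>\<^sup>+x. \<integral>\<^sup>+t. \<integral>\<^sup>+h. K x h t \<partial>lborel \<partial>lborel \<partial>lborel)"
  proof (intro nn_integral_cong lborel_pair.Fubini'[symmetric])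
    fix x :: "real^'n"
    have "(\<lambda>q::(real^'n) \<times> real. ((x, fst q), snd q)) \<in> borel \<Otimes>\<^sub>M borel \<rightarrow>\<^sub>M (borel \<Otimes>\<^sub>M borel) \<Otimes>\<^sub>M borel" by measurable
    from measurable_compose[OF this Km] show "(\<lambda>(h, t). K x h t) \<in> borel_measurable (lborel \<Otimes>\<^sub>M lborel)"
      by (simp add: split_beta')
  qed
  also have "\<dots> = (\<integral>\<^sup>+t. \<integral>\<^sup>+x. \<integral>\<^sup>+h. K x h t \<partial>lborel \<partial>lborel \<partial>lborel)"
  proof (rule lborel_pair.Fubini'[symmetric])
    have "(\<lambda>r::((real^'n) \<times> real) \<times> (real^'n). ((fst (fst r), snd r), snd (fst r))) \<in> (borel \<Otimes>\<^sub>M borel) \<Otimes>\<^sub>M borel \<rightarrow>\<^sub>M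
        (borel \<Otimes>\<^sub>M borel) \<Otimes>\<^sub>M borel" by measurable
    from measurable_compose[OF this Km]
    have "(\<lambda>q. \<integral>\<^sup>+h. K (fst q) h (snd q) \<partial>lborel) \<in> borel_measurable (borel \<Otimes>\<^sub>M borel)"
      by (intro lborel.borel_measurable_nn_integral) (simp add: split_beta')
    then show "(\<lambda>(x, t). \<integral>\<^sup>+h. K x h t \<partial>lborel) \<in> borel_measurable (lborel \<Otimes>\<^sub>M lborel)"
      by (simp add: split_beta')
  qed
  also have "\<dots> \<le> (\<integral>\<^sup>+t. ?I t * (ennreal (D\<^sup>2) * (V * (ennreal (2^CARD('n)) * (\<integral>\<^sup>+z. G z \<partial>lborel)))) \<partial>lborel)"
  proof (rule nn_integral_mono)
    fix t :: real
    have "(\<integral>\<^sup>+x. \<integral>\<^sup>+h. K x h t \<partial>lborel \<partial>lborel) = (\<integral>\<^sup>+x. \<integral>\<^sup>+y. ?I t * (ennreal (D\<^sup>2) * (indicator A x * indicator B y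
        * G (x + t *\<^sub>R (y - x)))) \<partial>lborel \<partial>lborel)"
    proof (rule nn_integral_cong)
      fix x :: "real^'n"
      have cm: "(\<lambda>y. x + t *\<^sub>R (y - x)) \<in> borel_measurable borel"
        by (intro borel_measurable_continuous_onI continuous_intros)
      have "(\<lambda>y. ?I t * (ennreal (D\<^sup>2) * (indicator A x * indicator B y * G (x + t *\<^sub>R (y - x))))) \<in> borel_measurable
          borel"
        using measurable_compose[OF cm Gm] by measurable
      from nn_integral_lborel_translate[OF this, of x]
      show "(\<integral>\<^sup>+h. K x h t \<partial>lborel) = (\<integral>\<^sup>+y. ?I t * (ennreal (D\<^sup>2) * (indicator A x * indicator B y * G
          (x + t *\<^sub>R (y - x)))) \<partial>lborel)"
        by (simp add: K_def add.commute)
    qed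
    also have "\<dots> = ?I t * (ennreal (D\<^sup>2) * (\<integral>\<^sup>+x. \<integral>\<^sup>+y. indicator A x * indicator B y * G (x + t *\<^sub>R (y - x)) \<partial>lborel
        \<partial>lborel))"
    proof -
      have sm': "(\<lambda>q::(real^'n) \<times> (real^'n). fst q + t *\<^sub>R (snd q - fst q)) \<in> borel_measurable (borel \<Otimes>\<^sub>M borel)"
        unfolding borel_prod by (intro borel_measurable_continuous_onI continuous_intros)
      have q: "(\<lambda>q. indicator A (fst q) * indicator B (snd q) * G (fst q + t *\<^sub>R (snd q - fst q))) \<in> borel_measurable
          (borel \<Otimes>\<^sub>M borel)"
        using measurable_compose[OF sm' Gm] by measurable
      have [measurable]: "(\<lambda>x. \<integral>\<^sup>+y. indicator A x * indicator B y * G (x + t *\<^sub>R (y - x)) \<partial>lborel) \<in> borel_measurable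
          borel"
        using q by (intro lborel.borel_measurable_nn_integral) (simp add: split_beta')
      have [measurable]: "(\<lambda>y. indicator A x * indicator B y * G (x + t *\<^sub>R (y - x))) \<in> borel_measurable borel" for x
        using measurable_compose[OF measurable_Pair1' q, of x] by simp
      show ?thesis by (simp add: nn_integral_cmult)
    qed
    also have "\<dots> \<le> ?I t * (ennreal (D\<^sup>2) * (V * (ennreal (2^CARD('n)) * (\<integral>\<^sup>+z. G z \<partial>lborel))))"
    proof (cases "t \<in> {0..1}")
      case True
      then show ?thesis by (intro mult_left_mono nn_integral_convex_combination_le Gm sets V) auto
    qed simp
    finally show "(\<integral>\<^sup>+x. \<integral>\<^sup>+h. K x h t \<partial>lborel \<partial>lborel) \<le> ?I t *
        (ennreal (D\<^sup>2) * (V * (ennreal (2^CARD('n)) * (\<integral>\<^sup>+z. G z \<partial>lborel))))" .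
  qed
  also have "\<dots> = ennreal (D\<^sup>2) * (V * (ennreal (2^CARD('n)) * (\<integral>\<^sup>+z. G z \<partial>lborel)))"
    by (subst nn_integral_multc) auto
  finally show ?thesis unfolding G_def .
qed

section \<open>Interior cones of Lipschitz domains\<close>

text \<open>Near a boundary point the epigraph direction works: moving by t (e + z) with
  \<bar>z\<bar> \<le> k raises the height by at least t (1 - k) and the graph by at most L t k. At
  an interior point every direction works.\<close>

lemma interior_cone_at:
  fixes \<Omega> :: "(real^'n) set"
  assumes "open \<Omega>" "lipschitz_boundary \<Omega>" "x \<in> closure \<Omega>"
  shows "\<exists>d>0. \<exists>k>0. \<exists>e. k \<le> 1 \<and> norm e = 1 \<and> (\<forall>y\<in>closure \<Omega>. \<forall>t z.
      dist y x < d \<longrightarrow> 0 < t \<longrightarrow> t < d \<longrightarrow> norm z \<le> k \<longrightarrow> y + t *\<^sub>R (e + z) \<in> \<Omega>)"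
proof (cases "x \<in> \<Omega>")
  case True
  then obtain r where r: "r > 0" "ball x r \<subseteq> \<Omega>" using assms(1) open_contains_ball by blast
  define e :: "real^'n" where "e = axis undefined 1"
  have e: "norm e = 1" by (simp add: e_def norm_axis_1)
  have "y + t *\<^sub>R (e + z) \<in> \<Omega>" if "dist y x < r/4" "0 < t" "t < r/4" "norm z \<le> 1" for y z t
  proof -
    have "norm (e + z) \<le> 2" using norm_triangle_ineq[of e z] e that by linarith
    then have "norm (t *\<^sub>R (e + z)) \<le> r/4 * 2" using that mult_mono[of t "r/4" "norm (e + z)" 2] by simp
    then have "dist (y + t *\<^sub>R (e + z)) x < r"
      using that norm_triangle_ineq[of "y - x" "t *\<^sub>R (e + z)"] r(1) by (simp add: dist_norm algebra_simps)
    then show ?thesis using r(2) by (auto simp: dist_commute)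
  qed
  then show ?thesis using e r by (intro exI[of _ "r/4"] conjI exI[of _ 1] exI[of _ e]) auto
next
  case False
  then have "x \<in> frontier \<Omega>" using assms by (simp add: frontier_def interior_open)
  with assms(2) have "\<exists>r>0. \<exists>e \<gamma> L. norm e = 1 \<and> L-lipschitz_on {z. z \<bullet> e = 0} \<gamma> \<and>
        \<Omega> \<inter> ball x r = {y \<in> ball x r. \<gamma> (y - (y \<bullet> e) *\<^sub>R e) < y \<bullet> e}"
    unfolding lipschitz_boundary_def by (rule bspec)
  then obtain r where r: "r > 0" and ex: "\<exists>e \<gamma> L. norm e = 1 \<and> L-lipschitz_on {z. z \<bullet> e = 0} \<gamma> \<and>
        \<Omega> \<inter> ball x r = {y \<in> ball x r. \<gamma> (y - (y \<bullet> e) *\<^sub>R e) < y \<bullet> e}" by - (erule exE, erule conjE, rule that)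
  obtain e \<gamma> L where e: "norm e = 1" and L: "L-lipschitz_on {z. z \<bullet> e = 0} \<gamma>" and
    ch: "\<Omega> \<inter> ball x r = {y \<in> ball x r. \<gamma> (y - (y \<bullet> e) *\<^sub>R e) < y \<bullet> e}"
    using ex by (elim exE conjE) (rule that)
  define \<pi> where "\<pi> y = y - (y \<bullet> e) *\<^sub>R e" for y
  have ee: "e \<bullet> e = 1" using e by (simp add: norm_eq_1)
  have \<pi>0: "\<pi> y \<bullet> e = 0" for y by (simp add: \<pi>_def inner_diff_left ee)
  have \<pi>diff: "\<pi> y - \<pi> y' = \<pi> (y - y')" for y y' by (simp add: \<pi>_def algebra_simps inner_diff_left)
  have \<pi>norm: "norm (\<pi> v) \<le> norm v" for v
  proof -
    have "(norm v)\<^sup>2 = (norm (\<pi> v))\<^sup>2 + (v \<bullet> e)\<^sup>2"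
      unfolding \<pi>_def power2_norm_eq_inner by (simp add: inner_diff_left inner_diff_right ee inner_commute
          power2_eq_square)
    then have "(norm (\<pi> v))\<^sup>2 \<le> (norm v)\<^sup>2" by simp
    then show ?thesis by (rule power2_le_imp_le) simp
  qed
  have L0: "L \<ge> 0" using L by (rule lipschitz_on_nonneg)
  have lip: "\<gamma> (\<pi> y) \<le> \<gamma> (\<pi> y') + L * norm (\<pi> (y - y'))" for y y'
    using lipschitz_onD[OF L, of "\<pi> y" "\<pi> y'"] \<pi>0 by (simp add: dist_norm \<pi>diff abs_le_iff)
  \<comment> \<open>Makes (L + 1) k = 1/2, so the height gains on the graph.\<close>
  define k where "k = 1 / (2 * (L + 1))"
  have k: "0 < k" "k \<le> 1" "(L + 1) * k < 1" using L0 by (auto simp: k_def field_simps)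
  have "y + t *\<^sub>R (e + z) \<in> \<Omega>" if y: "y \<in> closure \<Omega>" and that: "dist y x < r/4" "0 < t" "t < r/4" "norm z \<le> k"
      for y z t
  proof -
    let ?p = "y + t *\<^sub>R (e + z)"
    have "norm (e + z) \<le> 2" using norm_triangle_ineq[of e z] e that k by linarith
    then have "norm (t *\<^sub>R (e + z)) \<le> r/4 * 2" using that mult_mono[of t "r/4" "norm (e + z)" 2] by simp
    then have p: "dist ?p x < r"
      using that norm_triangle_ineq[of "y - x" "t *\<^sub>R (e + z)"] r(1) by (simp add: dist_norm algebra_simps)
    \<comment> \<open>Points of the closure satisfy only the weak inequality; strictness comes from
      the move.\<close>
    have "\<gamma> (\<pi> y) \<le> y \<bullet> e"
    proof (rule field_le_epsilon)
      fix \<epsilon> :: real assume \<epsilon>: "\<epsilon> > 0"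
      \<comment> \<open>A neighbour at distance \<epsilon>' changes the height by at most
        \<epsilon>' and the graph by at most L \<epsilon>'; the cap r/4 keeps it in the
        chart.\<close>
      define \<epsilon>' where "\<epsilon>' = min (\<epsilon> / (1 + L)) (r/4)"
      have "\<epsilon>' > 0" using \<epsilon> L0 r by (simp add: \<epsilon>'_def)
      moreover have "\<epsilon>' \<le> \<epsilon> / (1 + L)" "\<epsilon>' \<le> r/4" unfolding \<epsilon>'_def by (rule min.cobounded1, rule min.cobounded2)
      ultimately have \<epsilon>': "\<epsilon>' > 0" "\<epsilon>' * (1 + L) \<le> \<epsilon>" "\<epsilon>' \<le> r/4"
        using pos_le_divide_eq[of "1 + L" \<epsilon>' \<epsilon>] L0 by linarith+
      obtain y' where y': "y' \<in> \<Omega>" "dist y' y < \<epsilon>'" using y \<epsilon>'(1) by (meson closure_approachable)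
      have "dist y' x < r" using y' \<epsilon>'(3) that(1) r dist_triangle[of y' x y] by linarith
      then have "y' \<in> \<Omega> \<inter> ball x r" using y' by (auto simp: dist_commute)
      then have "\<gamma> (\<pi> y') < y' \<bullet> e" unfolding ch \<pi>_def by auto
      moreover have "L * norm (\<pi> (y - y')) \<le> L * \<epsilon>'"
        using \<pi>norm[of "y - y'"] y' L0 by (intro mult_left_mono) (auto simp: dist_norm norm_minus_commute)
      moreover have "y' \<bullet> e \<le> y \<bullet> e + \<epsilon>'"
        using Cauchy_Schwarz_ineq2[of "y' - y" e] y' e by (auto simp: dist_norm inner_diff_left)
      ultimately have "\<gamma> (\<pi> y) \<le> y \<bullet> e + \<epsilon>' * (1 + L)"
        using lip[of y y'] by (simp add: algebra_simps)
      then show "\<gamma> (\<pi> y) \<le> y \<bullet> e + \<epsilon>" using \<epsilon>'(2) by linarith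
    qed
    moreover have "\<gamma> (\<pi> ?p) \<le> \<gamma> (\<pi> y) + L * (t * k)"
    proof -
      have "\<pi> (?p - y) = t *\<^sub>R \<pi> z" by (simp add: \<pi>_def algebra_simps inner_add_left ee)
      then have "norm (\<pi> (?p - y)) \<le> t * k" using \<pi>norm[of z] that by simp
      then have "L * norm (\<pi> (?p - y)) \<le> L * (t * k)" by (rule mult_left_mono[OF _ L0])
      then show ?thesis using lip[of ?p y] by linarith
    qed
    moreover have "?p \<bullet> e \<ge> y \<bullet> e + t * (1 - k)"
    proof -
      have "z \<bullet> e \<ge> - k" using Cauchy_Schwarz_ineq2[of z e] e that by (auto simp: abs_le_iff)
      then have "t * (1 + z \<bullet> e) \<ge> t * (1 - k)" using that by (intro mult_left_mono) auto
      then show ?thesis by (simp add: inner_add_left ee algebra_simps)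
    qed
    moreover have "t * ((L + 1) * k) < t * 1" using k that by (intro mult_strict_left_mono) auto
    ultimately have "\<gamma> (\<pi> ?p) < ?p \<bullet> e" by (simp add: algebra_simps)
    then have "?p \<in> {y \<in> ball x r. \<gamma> (y - (y \<bullet> e) *\<^sub>R e) < y \<bullet> e}"
      using p unfolding \<pi>_def by (simp add: dist_commute)
    then show ?thesis unfolding ch[symmetric] by blast
  qed
  then show ?thesis using e r k by (intro exI[of _ "r/4"] conjI exI[of _ k] exI[of _ e]) auto
qed

text \<open>The direction may vary with \<open>x\<close>, but it serves all points of the closure
  near \<open>x\<close>, while \<open>d\<close> and \<open>k\<close> are global. The vectors
  \<open>z\<close> give the cone its opening.\<close>

definition uniform_cone :: "(real^'n) set \<Rightarrow> real \<Rightarrow> real \<Rightarrow> bool" where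
  "uniform_cone \<Omega> d k \<longleftrightarrow> (\<forall>x\<in>closure \<Omega>. \<exists>e. norm e = 1 \<and> (\<forall>y\<in>closure \<Omega>. \<forall>t z.
     dist y x < d \<longrightarrow> 0 < t \<longrightarrow> t < d \<longrightarrow> norm z \<le> k \<longrightarrow> y + t *\<^sub>R (e + z) \<in> \<Omega>))"

lemma uniform_interior_cone:
  fixes \<Omega> :: "(real^'n) set"
  assumes "open \<Omega>" "bounded \<Omega>" "lipschitz_boundary \<Omega>"
  obtains d k where "d > 0" "0 < k" "k \<le> 1"
    "uniform_cone \<Omega> d k"
proof -
  have "\<forall>x\<in>closure \<Omega>. \<exists>d k e. d > 0 \<and> k > 0 \<and> k \<le> 1 \<and> norm e = 1 \<and> (\<forall>y\<in>closure \<Omega>. \<forall>t z.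
      dist y x < d \<longrightarrow> 0 < t \<longrightarrow> t < d \<longrightarrow> norm z \<le> k \<longrightarrow> y + t *\<^sub>R (e + z) \<in> \<Omega>)"
    using interior_cone_at[OF assms(1,3)] by meson
  then obtain d k e where *: "\<And>x. x \<in> closure \<Omega> \<Longrightarrow> d x > 0 \<and> k x > 0 \<and> k x \<le> 1 \<and> norm (e x) = 1 \<and> (\<forall>y\<in>closure \<Omega>. \<forall>t z.
      dist y x < d x \<longrightarrow> 0 < t \<longrightarrow> t < d x \<longrightarrow> norm z \<le> k x \<longrightarrow> y + t *\<^sub>R (e x + z) \<in> \<Omega>)"
    by metis
  have cpt: "compact (closure \<Omega>)" using assms(2) by simp
  have "closure \<Omega> \<subseteq> (\<Union>x\<in>closure \<Omega>. ball x (d x / 2))"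
  proof
    fix x assume x: "x \<in> closure \<Omega>"
    then show "x \<in> (\<Union>x\<in>closure \<Omega>. ball x (d x / 2))" using * by (intro UN_I[OF x]) simp
  qed
  then obtain X where X: "X \<subseteq> closure \<Omega>" "finite X" "closure \<Omega> \<subseteq> (\<Union>x\<in>X. ball x (d x / 2))"
    by (rule compactE_image[OF cpt open_ball])
  \<comment> \<open>The cover uses half radii: a point within \<open>d0\<close> of \<open>x\<close>,
    with \<open>x\<close> in a half ball, still lies in the full ball of that centre.\<close>
  define d0 where "d0 = Min (insert 1 ((\<lambda>x. d x / 2) ` X))"
  define k0 where "k0 = Min (insert 1 (k ` X))"
  have d0: "d0 > 0" unfolding d0_def by (subst Min_gr_iff) (use X * in \<open>auto simp: subset_iff\<close>)
  have d0le: "d0 \<le> d x / 2" if "x \<in> X" for x unfolding d0_def by (rule Min_le) (use that X in auto)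
  have k0: "k0 > 0" "k0 \<le> 1" unfolding k0_def by (subst Min_gr_iff, use X * in \<open>auto simp: subset_iff\<close>)
  have k0le: "k0 \<le> k x" if "x \<in> X" for x unfolding k0_def by (rule Min_le) (use that X in auto)
  show ?thesis
  proof (rule that[OF d0 k0], unfold uniform_cone_def, rule ballI)
    fix x assume "x \<in> closure \<Omega>"
    then obtain x' where x': "x' \<in> X" "dist x' x < d x' / 2" using X(3) by auto
    have x'c: "x' \<in> closure \<Omega>" using x' X by auto
    show "\<exists>e. norm e = 1 \<and> (\<forall>y\<in>closure \<Omega>. \<forall>t z.
      dist y x < d0 \<longrightarrow> 0 < t \<longrightarrow> t < d0 \<longrightarrow> norm z \<le> k0 \<longrightarrow> y + t *\<^sub>R (e + z) \<in> \<Omega>)"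
    proof (intro exI[of _ "e x'"] conjI ballI allI impI)
      fix y z :: "real^'n" and t :: real assume a: "y \<in> closure \<Omega>" "dist y x < d0" "0 < t" "t < d0" "norm z \<le> k0"
      have "dist y x' < d x'" using a(2) x'(2) d0le[OF x'(1)] dist_triangle[of y x' x] by (simp add: dist_commute)
      moreover have "t < d x'" using a d0le[OF x'(1)] *[OF x'c] by linarith
      moreover have "norm z \<le> k x'" using a k0le[OF x'(1)] by linarith
      ultimately show "y + t *\<^sub>R (e x' + z) \<in> \<Omega>" using *[OF x'c] a by blast
    qed (use *[OF x'c] in blast)
  qed
qed

section \<open>Banded linear systems\<close>

text \<open>A quadratic polynomial without negative values has no positive discriminant. The form to
  which this is applied may be degenerate, so R = 0 is a separate case.\<close>

lemma psd_form_Cauchy_Schwarz: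
  fixes P Q R :: real
  assumes "\<And>s. 0 \<le> P + 2 * s * Q + s\<^sup>2 * R" "R \<ge> 0"
  shows "Q\<^sup>2 \<le> P * R"
proof (cases "R = 0")
  case True
  have "Q = 0"
  proof (rule ccontr)
    assume "Q \<noteq> 0"
    \<comment> \<open>At this argument the expression equals -1.\<close>
    then show False using assms(1)[of "- (P + 1) / (2 * Q)"] True by (simp add: field_simps)
  qed
  then show ?thesis using True by simp
next
  case False
  then have "R > 0" using assms(2) by simp
  have "0 \<le> P + 2 * (- Q / R) * Q + (- Q / R)\<^sup>2 * R" by (rule assms(1))
  also have "\<dots> = P - Q\<^sup>2 / R" using \<open>R > 0\<close> by (simp add: power2_eq_square field_simps)
  finally show ?thesis using \<open>R > 0\<close> by (simp add: field_simps)
qed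

text \<open>The solution is the Neumann series of T = I - A/c2, a symmetric operator with 0 \<le> T
  \<le> \<rho> = 1 - c1/c2. The value of T^k f at \<open>a\<close> sees \<open>f\<close> only up to
  distance k h, where \<open>f\<close> has Euclidean norm at most \<beta> times the root of the
  number of nodes. This is why \<open>count\<close> bounds the square of \<open>m\<close>, and the
  pointwise bound is the sum of \<beta> \<rho>^k m(k), divided by c2.\<close>

lemma banded_system_solution:
  fixes N :: "'a::metric_space set" and A :: "'a \<Rightarrow> 'a \<Rightarrow> real" and m :: "nat \<Rightarrow> real"
  assumes fin: "finite N" and sym: "\<And>a b. a \<in> N \<Longrightarrow> b \<in> N \<Longrightarrow> A a b = A b a"
  and low: "\<And>x. c1 * (\<Sum>a\<in>N. (x a)\<^sup>2) \<le> (\<Sum>a\<in>N. \<Sum>b\<in>N. x a * A a b * x b)"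
  and up: "\<And>x. (\<Sum>a\<in>N. \<Sum>b\<in>N. x a * A a b * x b) \<le> c2 * (\<Sum>a\<in>N. (x a)\<^sup>2)"
  and c: "0 < c1" "c1 \<le> c2" and h: "h \<ge> 0"
  and band: "\<And>a b. a \<in> N \<Longrightarrow> b \<in> N \<Longrightarrow> dist a b > h \<Longrightarrow> A a b = 0"
  and count: "\<And>a k. a \<in> N \<Longrightarrow> real (card {b\<in>N. dist a b \<le> real k * h}) \<le> (m k)\<^sup>2" and m: "\<And>k. m k \<ge> 0"
  and sm: "summable (\<lambda>k. (1 - c1/c2)^k * m k)"
  and f: "\<And>a. a \<in> N \<Longrightarrow> \<bar>f a\<bar> \<le> \<beta>" and \<beta>: "\<beta> \<ge> 0"
  obtains x where "\<And>a. a \<in> N \<Longrightarrow> (\<Sum>b\<in>N. A a b * x b) = f a"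
    "\<And>a. a \<in> N \<Longrightarrow> \<bar>x a\<bar> \<le> \<beta> / c2 * (\<Sum>k. (1 - c1/c2)^k * m k)"
proof -
  define \<rho> where "\<rho> = 1 - c1/c2"
  have \<rho>: "0 \<le> \<rho>" using c by (auto simp: \<rho>_def field_simps)
  have c2: "c2 > 0" using c by simp
  define T where "T x a = x a - (\<Sum>b\<in>N. A a b * x b) / c2" for x a
  define ip where "ip x y = (\<Sum>a\<in>N. x a * y a)" for x y :: "'a \<Rightarrow> real"
  define B where "B x y = (\<Sum>a\<in>N. \<Sum>b\<in>N. x a * A a b * y b)" for x y :: "'a \<Rightarrow> real"
  have Bsym: "B x y = B y x" for x y
  proof -
    have "B x y = (\<Sum>b\<in>N. \<Sum>a\<in>N. x a * A a b * y b)" unfolding B_def by (rule sum.swap)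
    also have "\<dots> = B y x" unfolding B_def by (intro sum.cong refl) (simp add: sym mult.commute mult.left_commute)
    finally show ?thesis .
  qed
  have ipT: "ip x (T y) = ip x y - B x y / c2" for x y
    unfolding ip_def T_def B_def
    by (simp add: right_diff_distrib sum_subtractf sum_divide_distrib sum_distrib_left mult.assoc)
  have ipsym: "ip x y = ip y x" for x y unfolding ip_def by (simp add: mult.commute)
  have ipxx: "ip x x = (\<Sum>a\<in>N. (x a)\<^sup>2)" for x by (simp add: ip_def power2_eq_square)
  have ip_nn: "ip x x \<ge> 0" for x unfolding ipxx by (simp add: sum_nonneg)
  have psd: "0 \<le> ip x (T x)" "ip x (T x) \<le> \<rho> * ip x x" for x
  proof -
    have "B x x \<le> c2 * ip x x" "c1 * ip x x \<le> B x x" using up[of x] low[of x] by (simp_all add: ipxx B_def)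
    then have "B x x / c2 \<le> ip x x" "c1 / c2 * ip x x \<le> B x x / c2" using c2 by (auto simp: field_simps)
    then show "0 \<le> ip x (T x)" "ip x (T x) \<le> \<rho> * ip x x" 
      unfolding ipT \<rho>_def by (auto simp: left_diff_distrib)
  qed
  have ip_add: "ip (\<lambda>a. x a + s * y a) (\<lambda>a. u a + s * v a) = ip x u + s * (ip x v + ip y u) + s\<^sup>2 * ip y v"
      for x y u v s
    unfolding ip_def by (simp add: sum_distrib_left sum.distrib[symmetric] algebra_simps power2_eq_square)
  have T_add: "T (\<lambda>a. x a + s * y a) = (\<lambda>a. T x a + s * T y a)" for x y s
    unfolding T_def by (rule ext) (simp add: algebra_simps sum.distrib sum_distrib_left add_divide_distrib)
  have Tsym: "ip x (T y) = ip y (T x)" for x y unfolding ipT using ipsym Bsym by metis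
  have CS: "(ip x (T y))\<^sup>2 \<le> ip x (T x) * ip y (T y)" for x y
  proof (rule psd_form_Cauchy_Schwarz)
    show "0 \<le> ip x (T x) + 2 * s * ip x (T y) + s\<^sup>2 * ip y (T y)" for s
      using psd(1)[of "\<lambda>a. x a + s * y a"] unfolding T_add ip_add using Tsym[of x y] by (simp add: algebra_simps)
  qed (rule psd)
  \<comment> \<open>Cauchy-Schwarz for the form of \<open>T\<close>, applied to \<open>T x\<close>
    and \<open>x\<close>, turns the bound on the quadratic form into a bound on the operator
    norm.\<close>
  have contr: "ip (T x) (T x) \<le> \<rho>\<^sup>2 * ip x x" for x
  proof (cases "ip (T x) (T x) = 0")
    case True then show ?thesis using ip_nn by simp
  next
    case False
    then have p: "ip (T x) (T x) > 0" using ip_nn[of "T x"] by simp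
    have "(ip (T x) (T x))\<^sup>2 \<le> ip (T x) (T (T x)) * ip x (T x)" by (rule CS)
    also have "\<dots> \<le> (\<rho> * ip (T x) (T x)) * (\<rho> * ip x x)"
      using psd \<rho> ip_nn by (intro mult_mono) auto
    finally have "ip (T x) (T x) * ip (T x) (T x) \<le> ip (T x) (T x) * (\<rho>\<^sup>2 * ip x x)"
      by (simp add: power2_eq_square mult_ac)
    then show ?thesis using p by (simp add: mult_le_cancel_left_pos)
  qed
  have contr_k: "ip ((T ^^ k) x) ((T ^^ k) x) \<le> (\<rho>^k)\<^sup>2 * ip x x" for k x
  proof (induction k)
    case (Suc k)
    have "ip ((T ^^ Suc k) x) ((T ^^ Suc k) x) \<le> \<rho>\<^sup>2 * ip ((T ^^ k) x) ((T ^^ k) x)"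
      using contr[of "(T ^^ k) x"] by simp
    also have "\<dots> \<le> \<rho>\<^sup>2 * ((\<rho>^k)\<^sup>2 * ip x x)" using Suc by (intro mult_left_mono) auto
    finally show ?case by (simp add: power_mult_distrib mult.assoc)
  qed simp
  \<comment> \<open>Each application of \<open>T\<close> widens the domain of dependence by one band
    width \<open>h\<close>.\<close>
  have local: "a \<in> N \<Longrightarrow> (\<And>b. b \<in> N \<Longrightarrow> dist a b \<le> real k * h \<Longrightarrow> x b = y b) \<Longrightarrow> (T ^^ k) x a = (T ^^ k) y a" for k x y a
  proof (induction k arbitrary: a)
    case (Suc k)
    have *: "(T ^^ k) x b = (T ^^ k) y b" if b: "b \<in> N" "dist a b \<le> h" for b
    proof (rule Suc.IH[OF b(1)])
      fix c assume c: "c \<in> N" "dist b c \<le> real k * h"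
      have "dist a c \<le> real (Suc k) * h" using dist_triangle[of a c b] b c by (simp add: algebra_simps)
      then show "x c = y c" using Suc.prems c by blast
    qed
    have "A a b * (T ^^ k) x b = A a b * (T ^^ k) y b" if "b \<in> N" for b
      using *[OF that] band[OF Suc.prems(1) that] by (cases "dist a b \<le> h") auto
    then have "(\<Sum>b\<in>N. A a b * (T ^^ k) x b) = (\<Sum>b\<in>N. A a b * (T ^^ k) y b)" by (rule sum.cong[OF refl])
    moreover have "(T ^^ k) x a = (T ^^ k) y a" using *[OF Suc.prems(1)] h by simp
    ultimately show ?case by (simp add: T_def[of "(T ^^ k) x"] T_def[of "(T ^^ k) y"])
  qed auto
  have bound: "\<bar>(T ^^ k) f a\<bar> \<le> \<beta> * (\<rho>^k * m k)" if a: "a \<in> N" for k a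
  proof -
    let ?S = "{b\<in>N. dist a b \<le> real k * h}"
    \<comment> \<open>Truncating \<open>f\<close> to the domain of dependence leaves the value at
      \<open>a\<close> unchanged and makes the Euclidean norm small.\<close>
    define g where "g b = (if b \<in> ?S then f b else 0)" for b
    have "(T ^^ k) f a = (T ^^ k) g a" by (rule local[OF a]) (auto simp: g_def)
    moreover have "((T ^^ k) g a)\<^sup>2 \<le> ip ((T ^^ k) g) ((T ^^ k) g)"
      unfolding ipxx by (rule member_le_sum[OF a]) (auto simp: fin)
    moreover have "ip g g \<le> (m k)\<^sup>2 * \<beta>\<^sup>2"
    proof -
      have "ip g g = (\<Sum>b\<in>?S. (f b)\<^sup>2)"
        unfolding ipxx g_def by (rule sum.mono_neutral_cong_right) (auto simp: fin)
      also have "\<dots> \<le> (\<Sum>b\<in>?S. \<beta>\<^sup>2)" 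
        using f by (intro sum_mono) (auto simp: abs_le_square_iff[symmetric] \<beta>)
      also have "\<dots> \<le> (m k)\<^sup>2 * \<beta>\<^sup>2" using count[OF a, of k] by (simp add: mult_right_mono)
      finally show ?thesis .
    qed
    then have "(\<rho>^k)\<^sup>2 * ip g g \<le> (\<rho>^k)\<^sup>2 * ((m k)\<^sup>2 * \<beta>\<^sup>2)" by (intro mult_left_mono) auto
    ultimately have "((T ^^ k) f a)\<^sup>2 \<le> (\<beta> * (\<rho>^k * m k))\<^sup>2"
      using contr_k[of k g] by (simp add: power_mult_distrib mult_ac)
    then show ?thesis using \<beta> \<rho> m by (simp add: abs_le_square_iff[symmetric])
  qed
  have sm': "summable (\<lambda>k. \<beta> * (\<rho>^k * m k))" using sm unfolding \<rho>_def by (rule summable_mult)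
  have s1: "summable (\<lambda>k. (T ^^ k) f a)" if "a \<in> N" for a
    by (rule summable_comparison_test'[OF sm', of 0]) (use bound[OF that] in auto)
  define x where "x a = (\<Sum>k. (T ^^ k) f a) / c2" for a
  show ?thesis
  proof (rule that[of x])
    fix a assume a: "a \<in> N"
    have "\<bar>\<Sum>k. (T ^^ k) f a\<bar> \<le> (\<Sum>k. \<beta> * (\<rho>^k * m k))"
    proof -
      have "summable (\<lambda>k. norm ((T ^^ k) f a))"
        by (rule summable_comparison_test'[OF sm', of 0]) (use bound[OF a] in auto)
      then show ?thesis using summable_norm[of "\<lambda>k. (T ^^ k) f a"] suminf_le[OF _ _ sm', of "\<lambda>k. norm ((T ^^ k) f a)"]
          bound[OF a]
        by auto
    qed
    also have "\<dots> = \<beta> * (\<Sum>k. \<rho>^k * m k)" using sm unfolding \<rho>_def by (rule suminf_mult)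
    finally show "\<bar>x a\<bar> \<le> \<beta> / c2 * (\<Sum>k. (1 - c1/c2)^k * m k)"
      using c2 unfolding x_def \<rho>_def by (simp add: abs_divide divide_right_mono)
    \<comment> \<open>Applying \<open>T\<close> termwise shifts the series by one; comparing with
      the original series leaves its first term \<open>f a\<close>.\<close>
    have "(\<Sum>k. (T ^^ Suc k) f a) = (\<Sum>k. (T ^^ k) f a - (\<Sum>b\<in>N. A a b * (T ^^ k) f b) / c2)"
      by (simp add: T_def[of "(T ^^ k) f" for k])
    also have "\<dots> = (\<Sum>k. (T ^^ k) f a) - (\<Sum>b\<in>N. A a b * (\<Sum>k. (T ^^ k) f b)) / c2"
    proof -
      have "(\<lambda>k. (T ^^ k) f a - (\<Sum>b\<in>N. A a b * (T ^^ k) f b) / c2) sums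
          ((\<Sum>k. (T ^^ k) f a) - (\<Sum>b\<in>N. A a b * (\<Sum>k. (T ^^ k) f b)) / c2)"
        by (intro sums_diff sums_divide sums_sum sums_mult summable_sums s1 a)
      then show ?thesis by (rule sums_unique[symmetric])
    qed
    finally have "(\<Sum>b\<in>N. A a b * (\<Sum>k. (T ^^ k) f b)) / c2 = f a"
      using suminf_split_head[OF s1[OF a]] by simp
    then show "(\<Sum>b\<in>N. A a b * x b) = f a" unfolding x_def by (simp add: sum_divide_distrib)
  qed
qed

section \<open>Finite element functions on a mesh\<close>

lemma convex_hull_affine_le:
  assumes "x \<in> convex hull V" "\<And>v. v \<in> V \<Longrightarrow> a \<bullet> v + b \<le> (m::real)"
  shows "a \<bullet> x + b \<le> m"
proof -
  have "convex hull V \<subseteq> {x. a \<bullet> x \<le> m - b}"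
    using assms(2) by (intro hull_minimal convex_halfspace_le) (auto simp: algebra_simps)
  then show ?thesis using assms(1) by auto
qed

lemma affine_interpolation:
  fixes V :: "'a::euclidean_space set" and f :: "'a \<Rightarrow> real"
  assumes "\<not> affine_dependent V"
  obtains a b where "\<And>v. v \<in> V \<Longrightarrow> a \<bullet> v + b = f v"
proof (cases "V = {}")
  case False
  then obtain v0 where v0: "v0 \<in> V" by auto
  let ?B = "(\<lambda>x. - v0 + x) ` (V - {v0})"
  have "independent ?B" using affine_dependent_iff_dependent2[OF v0] assms by blast
  from linear_independent_extend[OF this, of "\<lambda>y. f (y + v0) - f v0"]
  obtain g where g: "linear g" "\<And>y. y \<in> ?B \<Longrightarrow> g y = f (y + v0) - f v0" by blast
  \<comment> \<open>The vector that represents the linear map \<open>g\<close> through the inner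
    product.\<close>
  define a where "a = (\<Sum>i\<in>Basis. g i *\<^sub>R i)"
  have ga: "g x = a \<bullet> x" for x
  proof -
    interpret linear g by (rule g(1))
    have "g x = g (\<Sum>i\<in>Basis. (x \<bullet> i) *\<^sub>R i)" by (simp add: euclidean_representation)
    also have "\<dots> = a \<bullet> x" by (simp add: sum scaleR a_def inner_sum_left inner_commute[of x] mult.commute)
    finally show ?thesis .
  qed
  have "a \<bullet> v + (f v0 - a \<bullet> v0) = f v" if "v \<in> V" for v
  proof (cases "v = v0")
    case False
    then have "- v0 + v \<in> ?B" using that by auto
    from g(2)[OF this] show ?thesis unfolding ga by (simp add: inner_diff_right algebra_simps)
  qed simp
  then show ?thesis using that by blast
qed (use that in auto)

definition vertices :: "'a::euclidean_space set \<Rightarrow> 'a set" where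
  "vertices K = {a. a extreme_point_of K}"

text \<open>Shape regularity and quasi-uniformity are condensed into \<open>c\<close>: elements have
  diameter at most \<open>h\<close> and contain a ball of radius c h. Constants proved here from
  \<open>c\<close> and the dimension are therefore the same for the whole family.\<close>

locale fe_mesh =
  fixes \<Omega> :: "(real^'n) set" and \<T> :: "(real^'n) set set" and h c :: real
  assumes tri: "conforming_triangulation \<Omega> \<T>"
    and open_dom: "open \<Omega>" and bounded_dom: "bounded \<Omega>" and nonempty_dom: "\<Omega> \<noteq> {}" and null_frontier:
        "negligible (frontier \<Omega>)"
    and h_pos: "h > 0" and c_pos: "c > 0"
    and diam: "\<And>K. K \<in> \<T> \<Longrightarrow> diameter K \<le> h"
    and inball: "\<And>K. K \<in> \<T> \<Longrightarrow> \<exists>x. cball x (c * h) \<subseteq> K"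
begin

section \<open>Elements, nodes and piecewise affine functions\<close>

lemma finite_tri: "finite \<T>" and Union_tri: "\<Union>\<T> = closure \<Omega>"
  using tri by (auto simp: conforming_triangulation_def triangulation_def)

lemma element_facts:
  assumes "K \<in> \<T>"
  shows "K = convex hull (vertices K)" "finite (vertices K)" "\<not> affine_dependent (vertices K)"
    "card (vertices K) = CARD('n) + 1" "compact K" "convex K" "vertices K \<subseteq> K"
proof -
  obtain C where C: "\<not> affine_dependent C" "int (card C) = int CARD('n) + 1" "K = convex hull C"
    using tri assms by (auto simp: conforming_triangulation_def simplex_def)
  have V: "vertices K = C" unfolding vertices_def C(3) using extreme_point_of_convex_hull_affine_independent[OF C(1)]
      by auto
  show "K = convex hull (vertices K)" "finite (vertices K)" "\<not> affine_dependent (vertices K)"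
    "card (vertices K) = CARD('n) + 1" "vertices K \<subseteq> K"
    unfolding V using C aff_independent_finite[OF C(1)] by (auto simp: hull_inc)
  show "convex K" unfolding C(3) by simp
  show "compact K" unfolding C(3) using aff_independent_finite[OF C(1)] by (simp add: finite_imp_compact_convex_hull)
qed

lemma element_subset: "K \<in> \<T> \<Longrightarrow> K \<subseteq> closure \<Omega>"
  using Union_tri by auto

lemma nodes_eq: "mesh_nodes \<T> = (\<Union>K\<in>\<T>. vertices K)"
  by (simp add: mesh_nodes_def vertices_def)

lemma finite_nodes: "finite (mesh_nodes \<T>)"
  unfolding nodes_eq using finite_tri element_facts by auto

lemma vertex_node: "K \<in> \<T> \<Longrightarrow> a \<in> vertices K \<Longrightarrow> a \<in> mesh_nodes \<T>"
  unfolding nodes_eq by auto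

lemma node_in_closure: "a \<in> mesh_nodes \<T> \<Longrightarrow> a \<in> closure \<Omega>"
  unfolding nodes_eq using element_facts(7) element_subset by blast

lemma element_interior: assumes "K \<in> \<T>" shows "interior K \<noteq> {}"
proof -
  obtain x where "cball x (c * h) \<subseteq> K" using inball[OF assms] by auto
  then have "ball x (c * h) \<subseteq> interior K" using ball_subset_cball by (intro interior_maximal) auto
  moreover have "x \<in> ball x (c * h)" using c_pos h_pos by simp
  ultimately show ?thesis by blast
qed

lemma element_face: "K \<in> \<T> \<Longrightarrow> K' \<in> \<T> \<Longrightarrow> (K \<inter> K') face_of K"
  using tri by (auto simp: conforming_triangulation_def triangulation_def)

text \<open>The intersection is a face of \<open>K\<close>, and a face that meets the interior is
  all of \<open>K\<close>.\<close>

lemma element_interior_disjoint: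
  assumes "K \<in> \<T>" "K' \<in> \<T>" "x \<in> interior K" "x \<in> K'"
  shows "K \<subseteq> K'"
proof (rule ccontr)
  assume "\<not> K \<subseteq> K'"
  then have "K \<inter> K' \<noteq> K" by auto
  from face_of_disjoint_interior[OF element_face[OF assms(1,2)] this] show False
    using assms(3,4) interior_subset by blast
qed

lemma fe_space_affine:
  assumes "v \<in> fe_space \<Omega> \<T>" "K \<in> \<T>"
  obtains a b where "\<And>x. x \<in> K \<Longrightarrow> v x = a \<bullet> x + b"
  using assms unfolding fe_space_def by blast

text \<open>Affine functions attain their maximum over a simplex at a vertex. Uniqueness of
  interpolation and all bounds by nodal values rest on this.\<close>

lemma fe_space_le:
  assumes "v \<in> fe_space \<Omega> \<T>" "K \<in> \<T>" "x \<in> K" "\<And>a. a \<in> vertices K \<Longrightarrow> v a \<le> m"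
  shows "v x \<le> m"
proof -
  obtain a b where ab: "\<And>x. x \<in> K \<Longrightarrow> v x = a \<bullet> x + b" using fe_space_affine[OF assms(1,2)] by blast
  have "a \<bullet> x + b \<le> m"
  proof (rule convex_hull_affine_le[of x "vertices K"])
    show "x \<in> convex hull vertices K" using element_facts(1)[OF assms(2)] assms(3) by simp
    show "a \<bullet> y + b \<le> m" if "y \<in> vertices K" for y
      using assms(4)[OF that] ab[of y] element_facts(7)[OF assms(2)] that by auto
  qed
  then show ?thesis using ab assms(3) by simp
qed

lemma fe_space_lin:
  assumes "v \<in> fe_space \<Omega> \<T>" "w \<in> fe_space \<Omega> \<T>"
  shows "(\<lambda>x. s * v x + t * w x) \<in> fe_space \<Omega> \<T>"
  unfolding fe_space_def mem_Collect_eq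
proof (intro conjI ballI)
  show "continuous_on (closure \<Omega>) (\<lambda>x. s * v x + t * w x)" "\<forall>x. x \<notin> closure \<Omega> \<longrightarrow> s * v x + t * w x = 0"
    using assms by (auto simp: fe_space_def intro!: continuous_intros)
  fix K assume K: "K \<in> \<T>"
  obtain a b where "\<And>x. x \<in> K \<Longrightarrow> v x = a \<bullet> x + b" using fe_space_affine[OF assms(1) K] by blast
  moreover obtain a' b' where "\<And>x. x \<in> K \<Longrightarrow> w x = a' \<bullet> x + b'" using fe_space_affine[OF assms(2) K] by blast
  ultimately show "\<exists>a b. \<forall>x\<in>K. s * v x + t * w x = a \<bullet> x + b"
    by (intro exI[of _ "s *\<^sub>R a + t *\<^sub>R a'"] exI[of _ "s * b + t * b'"]) (simp add: inner_add_left algebra_simps)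
qed

lemma fe_space_zero: "(\<lambda>_. 0) \<in> fe_space \<Omega> \<T>"
proof -
  have "\<exists>a b. \<forall>x\<in>K. (0::real) = a \<bullet> x + b" for K :: "(real^'n) set" by (intro exI[of _ 0]) auto
  then show ?thesis unfolding fe_space_def by auto
qed

lemma fe_space_diff: "v \<in> fe_space \<Omega> \<T> \<Longrightarrow> w \<in> fe_space \<Omega> \<T> \<Longrightarrow> (\<lambda>x. v x - w x) \<in> fe_space \<Omega> \<T>"
  using fe_space_lin[of v w 1 "-1"] by simp

lemma fe_space_sum: "finite I \<Longrightarrow> (\<And>i. i \<in> I \<Longrightarrow> v i \<in> fe_space \<Omega> \<T>) \<Longrightarrow> (\<lambda>x. \<Sum>i\<in>I. s i * v i x) \<in> fe_space \<Omega> \<T>"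
proof (induction I rule: finite_induct)
  case empty
  then show ?case using fe_space_zero by simp
next
  case (insert i I)
  then show ?case using fe_space_lin[of "v i" "\<lambda>x. \<Sum>i\<in>I. s i * v i x" "s i" 1] by simp
qed

lemma fe_space_eqI:
  assumes "v \<in> fe_space \<Omega> \<T>" "w \<in> fe_space \<Omega> \<T>" "\<And>a. a \<in> mesh_nodes \<T> \<Longrightarrow> v a = w a"
  shows "v = w"
proof
  fix x
  show "v x = w x"
  proof (cases "x \<in> closure \<Omega>")
    case True
    then obtain K where K: "K \<in> \<T>" "x \<in> K" using Union_tri by auto
    have "v x - w x \<le> 0" "w x - v x \<le> 0"
      using fe_space_le[OF fe_space_diff[OF assms(1,2)] K, of 0] fe_space_le[OF fe_space_diff[OF assms(2,1)] K, of 0]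
        assms(3) vertex_node[OF K(1)] by auto
    then show ?thesis by simp
  next
    case False
    then show ?thesis using assms by (simp add: fe_space_def)
  qed
qed

text \<open>Each element has its own affine interpolant. On a common face two of them agree, because
  conformity makes the extreme points of the face vertices of both elements; so the pieces glue
  continuously.\<close>

lemma fe_space_interpolation:
  obtains v where "v \<in> fe_space \<Omega> \<T>" "\<And>a. a \<in> mesh_nodes \<T> \<Longrightarrow> v a = f a"
proof -
  have "\<forall>K\<in>\<T>. \<exists>a b. \<forall>v\<in>vertices K. a \<bullet> v + b = f v"
    using affine_interpolation[OF element_facts(3)] by metis
  then obtain A B where AB: "\<And>K v. K \<in> \<T> \<Longrightarrow> v \<in> vertices K \<Longrightarrow> A K \<bullet> v + B K = f v"
    by metis
  \<comment> \<open>One inequality is enough, since \<open>K\<close> and \<open>K'\<close> can be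
    exchanged.\<close>
  have le: "A K \<bullet> x + B K \<le> A K' \<bullet> x + B K'" if K: "K \<in> \<T>" "K' \<in> \<T>" "x \<in> K" "x \<in> K'" for K K' x
  proof -
    let ?F = "K \<inter> K'"
    have "compact ?F" "convex ?F" using K element_facts by (auto intro: compact_Int convex_Int)
    then have "?F = convex hull {x. x extreme_point_of ?F}" by (rule Krein_Milman_Minkowski)
    then have x: "x \<in> convex hull {x. x extreme_point_of ?F}" using K by blast
    have "v \<in> vertices K" "v \<in> vertices K'" if "v extreme_point_of ?F" for v
      using extreme_point_of_face[OF element_face[OF K(1,2)]] extreme_point_of_face[OF element_face[OF K(2,1)]] that
      unfolding vertices_def by (auto simp: Int_commute)
    then have "(A K - A K') \<bullet> x + (B K - B K') \<le> 0"
      by (intro convex_hull_affine_le[OF x]) (use AB[OF K(1)] AB[OF K(2)] in \<open>force simp: inner_diff_left\<close>)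
    then show ?thesis by (simp add: inner_diff_left)
  qed
  define v where "v x = (if x \<in> closure \<Omega> then let K = SOME K. K \<in> \<T> \<and> x \<in> K in A K \<bullet> x + B K else 0)" for x
  have vK: "v x = A K \<bullet> x + B K" if K: "K \<in> \<T>" "x \<in> K" for K x
  proof -
    have "\<exists>K. K \<in> \<T> \<and> x \<in> K" using K by auto
    from someI_ex[OF this] show ?thesis using K le[of K "SOME K. K \<in> \<T> \<and> x \<in> K" x] le[of "SOME K. K \<in> \<T> \<and> x \<in> K" K x]
      element_subset[OF K(1)] unfolding v_def Let_def by force
  qed
  have "continuous_on (\<Union>K\<in>\<T>. K) v"
  proof (rule continuous_on_closed_Union[OF finite_tri])
    show "closed K" if "K \<in> \<T>" for K using element_facts(5)[OF that] compact_imp_closed by blast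
    show "continuous_on K v" if "K \<in> \<T>" for K
      by (rule continuous_on_eq[of _ "\<lambda>x. A K \<bullet> x + B K"]) (auto intro!: continuous_intros simp: vK[OF that])
  qed
  then have "continuous_on (closure \<Omega>) v" using Union_tri by simp
  then have "v \<in> fe_space \<Omega> \<T>" unfolding fe_space_def using vK by (auto simp: v_def)
  moreover have "v a = f a" if "a \<in> mesh_nodes \<T>" for a
    using that AB vK element_facts(7) unfolding nodes_eq by fastforce
  ultimately show ?thesis using that by blast
qed

section \<open>Nodal basis, interpolation and gradients on elements\<close>

lemma nodal_basis:
  assumes "a \<in> mesh_nodes \<T>"
  shows "nodal_basis \<Omega> \<T> a \<in> fe_space \<Omega> \<T>" "\<And>b. b \<in> mesh_nodes \<T> \<Longrightarrow> nodal_basis \<Omega> \<T> a b = (if b = a then 1 else 0)"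
proof -
  obtain v where v: "v \<in> fe_space \<Omega> \<T>" "\<And>b. b \<in> mesh_nodes \<T> \<Longrightarrow> v b = (if b = a then 1 else 0)"
    using fe_space_interpolation[of "\<lambda>b. if b = a then 1 else 0"] by blast
  have "\<exists>!\<phi>. \<phi> \<in> fe_space \<Omega> \<T> \<and> (\<forall>b\<in>mesh_nodes \<T>. \<phi> b = (if b = a then 1 else 0))"
    by (rule ex1I[of _ v]) (use v fe_space_eqI in auto)
  from theI'[OF this]
  show "nodal_basis \<Omega> \<T> a \<in> fe_space \<Omega> \<T>" "\<And>b. b \<in> mesh_nodes \<T> \<Longrightarrow> nodal_basis \<Omega> \<T> a b = (if b = a then 1 else 0)"
    unfolding nodal_basis_def by auto
qed

lemma nodal_interp:
  shows "nodal_interp \<Omega> \<T> f \<in> fe_space \<Omega> \<T>" "b \<in> mesh_nodes \<T> \<Longrightarrow> nodal_interp \<Omega> \<T> f b = f b"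
proof -
  show "nodal_interp \<Omega> \<T> f \<in> fe_space \<Omega> \<T>"
    unfolding nodal_interp_def[abs_def] by (intro fe_space_sum finite_nodes nodal_basis)
  assume b: "b \<in> mesh_nodes \<T>"
  have "nodal_interp \<Omega> \<T> f b = (\<Sum>a\<in>mesh_nodes \<T>. if b = a then f a else 0)"
    unfolding nodal_interp_def by (intro sum.cong refl) (simp add: nodal_basis b)
  then show "nodal_interp \<Omega> \<T> f b = f b" using b finite_nodes by simp
qed

lemma nodal_interp_eq: "v \<in> fe_space \<Omega> \<T> \<Longrightarrow> (\<And>a. a \<in> mesh_nodes \<T> \<Longrightarrow> v a = f a) \<Longrightarrow> nodal_interp \<Omega> \<T> f = v"
  by (rule fe_space_eqI) (auto simp: nodal_interp)

text \<open>An element has interior points, so for finite element functions the chosen slope is the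
  only one.\<close>

definition fe_grad :: "(real^'n \<Rightarrow> real) \<Rightarrow> (real^'n) set \<Rightarrow> real^'n" where
  "fe_grad v K = (SOME a. \<exists>b. \<forall>x\<in>K. v x = a \<bullet> x + b)"

lemma fe_grad_diff:
  assumes "v \<in> fe_space \<Omega> \<T>" "K \<in> \<T>" "x \<in> K" "y \<in> K"
  shows "v x - v y = fe_grad v K \<bullet> (x - y)"
proof -
  have "\<exists>a b. \<forall>x\<in>K. v x = a \<bullet> x + b" using assms unfolding fe_space_def by blast
  from someI_ex[OF this, folded fe_grad_def] show ?thesis using assms by (auto simp: inner_diff_right)
qed

text \<open>Along the gradient direction, across a diameter of the inscribed ball, \<open>v\<close>
  changes by 2 c h times the norm of its gradient, and no change inside \<open>K\<close> exceeds the
  vertex differences. With the converse \<open>fe_vertex_diff\<close>, gradients can be compared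
  through nodal values alone.\<close>

lemma fe_grad_bound:
  assumes v: "v \<in> fe_space \<Omega> \<T>" and K: "K \<in> \<T>" and \<delta>: "\<And>a b. a \<in> vertices K \<Longrightarrow> b \<in> vertices K \<Longrightarrow> v a - v b \<le> \<delta>"
  shows "norm (fe_grad v K) \<le> \<delta> / (2 * c * h)"
proof -
  let ?g = "fe_grad v K"
  have ch: "c * h > 0" using c_pos h_pos by simp
  obtain z where z: "cball z (c * h) \<subseteq> K" using inball[OF K] by auto
  have d: "v x - v y \<le> \<delta>" if "x \<in> K" "y \<in> K" for x y
  proof -
    have "v a - v y \<le> \<delta>" if "a \<in> vertices K" for a
    proof -
      have "(\<lambda>x. - v x) \<in> fe_space \<Omega> \<T>" using fe_space_lin[OF v v, of "-1" 0] by simp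
      from fe_space_le[OF this K \<open>y \<in> K\<close>, of "\<delta> - v a"] show ?thesis using \<delta>[OF that] by (force simp: algebra_simps)
    qed
    then have "v x \<le> \<delta> + v y" by (intro fe_space_le[OF v K \<open>x \<in> K\<close>]) force
    then show ?thesis by simp
  qed
  show ?thesis
  proof (cases "?g = 0")
    case True
    have "z \<in> K" using z ch by auto
    from d[OF this this] have "\<delta> \<ge> 0" by simp
    then show ?thesis using True ch by simp
  next
    case False
    let ?u = "(c * h) *\<^sub>R sgn ?g"
    have nu: "norm ?u = c * h" using False ch by (simp add: norm_sgn)
    have in1: "z + ?u \<in> K" "z - ?u \<in> K" using z nu by (auto simp: subset_iff dist_norm)
    have "?g \<bullet> sgn ?g = norm ?g" using False by (simp add: sgn_div_norm power2_norm_eq_inner[symmetric]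
        power2_eq_square)
    then have "v (z + ?u) - v (z - ?u) = 2 * (c * h) * norm ?g"
      unfolding fe_grad_diff[OF v K in1] by (simp only: inner_diff_right inner_add_right inner_scaleR_right)
    then have "norm ?g * (2 * c * h) \<le> \<delta>" using d[OF in1] by (simp add: mult_ac)
    then show ?thesis using ch by (subst pos_le_divide_eq) (auto simp: mult_ac)
  qed
qed

lemma element_dist: "K \<in> \<T> \<Longrightarrow> x \<in> K \<Longrightarrow> y \<in> K \<Longrightarrow> norm (x - y) \<le> h"
  using diameter_bounded_bound[OF compact_imp_bounded[OF element_facts(5)], of K x y] diam[of K]
      by (simp add: dist_norm)

lemma fe_vertex_diff:
  assumes "v \<in> fe_space \<Omega> \<T>" "K \<in> \<T>" "x \<in> K" "y \<in> K"
  shows "\<bar>v x - v y\<bar> \<le> h * norm (fe_grad v K)"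
proof -
  have "\<bar>v x - v y\<bar> \<le> norm (fe_grad v K) * norm (x - y)"
    unfolding fe_grad_diff[OF assms] by (rule Cauchy_Schwarz_ineq2)
  also have "\<dots> \<le> norm (fe_grad v K) * h" using element_dist[OF assms(2-4)] by (rule mult_left_mono) simp
  finally show ?thesis by (simp add: mult.commute)
qed

lemma fe_abs_le:
  assumes v: "v \<in> fe_space \<Omega> \<T>" and b: "\<And>a. a \<in> mesh_nodes \<T> \<Longrightarrow> \<bar>v a\<bar> \<le> m" and m: "m \<ge> 0"
  shows "\<bar>v x\<bar> \<le> m"
proof (cases "x \<in> closure \<Omega>")
  case True
  then obtain K where K: "K \<in> \<T>" "x \<in> K" using Union_tri by auto
  have "(\<lambda>x. - v x) \<in> fe_space \<Omega> \<T>" using fe_space_lin[OF v v, of "-1" 0] by simp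
  from fe_space_le[OF this K, of m] fe_space_le[OF v K, of m] b vertex_node[OF K(1)]
  show ?thesis by (force simp: abs_le_iff)
next
  case False
  then show ?thesis using v m by (simp add: fe_space_def)
qed

lemma fe_bounded:
  assumes v: "v \<in> fe_space \<Omega> \<T>"
  obtains M where "M \<ge> 0" "\<And>x. \<bar>v x\<bar> \<le> M"
proof -
  let ?M = "\<Sum>a\<in>mesh_nodes \<T>. \<bar>v a\<bar>"
  have "\<bar>v x\<bar> \<le> ?M" for x
    by (rule fe_abs_le[OF v]) (auto intro!: member_le_sum sum_nonneg finite_nodes)
  then show ?thesis using that[of ?M] by (simp add: sum_nonneg)
qed

lemma fe_measurable: assumes v: "v \<in> fe_space \<Omega> \<T>" shows "v \<in> borel_measurable borel"
proof -
  have "(\<lambda>x. indicator (closure \<Omega>) x *\<^sub>R v x) \<in> borel_measurable borel"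
    by (rule borel_measurable_continuous_on_indicator) (use v in \<open>auto simp: fe_space_def\<close>)
  moreover have "(\<lambda>x. indicator (closure \<Omega>) x *\<^sub>R v x) = v" using v
      by (auto simp: fe_space_def fun_eq_iff indicator_def)
  ultimately show ?thesis by simp
qed

lemma integrable_bounded_support:
  fixes f :: "real^'n \<Rightarrow> real"
  assumes "f \<in> borel_measurable lebesgue" "\<And>x. \<bar>f x\<bar> \<le> M" "\<And>x. x \<notin> closure \<Omega> \<Longrightarrow> f x = 0"
  shows "integrable lebesgue f"
proof (rule Bochner_Integration.integrable_bound[where f="\<lambda>x. M * indicator (closure \<Omega>) x"])
  have "closure \<Omega> \<in> lmeasurable" using bounded_dom by (intro lmeasurable_compact) simp
  then show "integrable lebesgue (\<lambda>x. M * indicator (closure \<Omega>) x)"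
    by (intro integrable_mult_right) (auto simp: fmeasurable_def integrable_indicator_iff)
  show "AE x in lebesgue. norm (f x) \<le> norm (M * indicator (closure \<Omega>) x)"
    using assms(2,3) by (auto intro!: AE_I2 simp: indicator_def) (meson abs_ge_self order_trans)
qed (use assms in auto)

end

section \<open>Square integrable functions on the domain and uniqueness of weak gradients\<close>

lemma L2_inner_indicator:
  "\<Omega> \<in> sets lebesgue \<Longrightarrow> L2_inner \<Omega> f g = (LINT x|lebesgue. indicator \<Omega> x * (f x \<bullet> g x))"
  unfolding L2_inner_def by (subst integral_restrict_space) auto

lemma L2_space_iff:
  assumes "\<Omega> \<in> sets lebesgue"
  shows "f \<in> L2_space \<Omega> \<longleftrightarrow> (\<lambda>x. indicator \<Omega> x *\<^sub>R f x) \<in> borel_measurable lebesgue \<and>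
     integrable lebesgue (\<lambda>x. indicator \<Omega> x * (norm (f x))\<^sup>2)"
  unfolding L2_space_def using assms
  by (simp add: borel_measurable_restrict_space_iff integrable_restrict_space)

lemma L2_norm_square:
  assumes "\<Omega> \<in> sets lebesgue"
  shows "(L2_norm \<Omega> f)\<^sup>2 = (LINT x|lebesgue. indicator \<Omega> x * (norm (f x))\<^sup>2)"
proof -
  have "L2_inner \<Omega> f f \<ge> 0" unfolding L2_inner_def by (intro integral_nonneg_AE AE_I2) simp
  then show ?thesis unfolding L2_norm_def using L2_inner_indicator[OF assms, of f f]
    by (simp add: power2_norm_eq_inner)
qed

lemma L2_norm_nonneg: "L2_norm \<Omega> f \<ge> 0"
  unfolding L2_norm_def L2_inner_def by (intro real_sqrt_ge_zero integral_nonneg_AE AE_I2) simp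

lemma L2_space_integrable:
  fixes f :: "real^'n \<Rightarrow> 'b::euclidean_space"
  assumes "\<Omega> \<in> lmeasurable" "f \<in> L2_space \<Omega>"
  shows "integrable lebesgue (\<lambda>x. indicator \<Omega> x *\<^sub>R f x)"
proof (rule Bochner_Integration.integrable_bound[where f="\<lambda>x. indicator \<Omega> x + indicator \<Omega> x * (norm (f x))\<^sup>2"])
  have S: "\<Omega> \<in> sets lebesgue" using assms(1) by auto
  note * = L2_space_iff[OF S, of f, THEN iffD1, OF assms(2)]
  show "(\<lambda>x. indicator \<Omega> x *\<^sub>R f x) \<in> borel_measurable lebesgue" using * by simp
  show "integrable lebesgue (\<lambda>x. indicator \<Omega> x + indicator \<Omega> x * (norm (f x))\<^sup>2)"
    using * assms(1) by (intro Bochner_Integration.integrable_add)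
        (auto simp: fmeasurable_def integrable_indicator_iff)
  have "a \<le> 1 + a\<^sup>2" for a :: real
  proof -
    have "0 \<le> (a - 1)\<^sup>2 + a\<^sup>2 + 1" by simp
    then show ?thesis by (simp add: power2_eq_square algebra_simps)
  qed
  then show "AE x in lebesgue. norm (indicator \<Omega> x *\<^sub>R f x) \<le> norm (indicator \<Omega> x + indicator \<Omega> x * (norm (f x))\<^sup>2)"
    by (auto simp: indicator_def)
qed

text \<open>The fundamental lemma in each component. It identifies the gradient picked by
  \<open>weak_grad\<close> with the elementwise one.\<close>

lemma weak_grad_unique:
  fixes \<Omega> :: "(real^'n) set"
  assumes \<Omega>: "open \<Omega>" "bounded \<Omega>"
    and "is_weak_grad \<Omega> u g" "is_weak_grad \<Omega> u g'" "g \<in> L2_space \<Omega>" "g' \<in> L2_space \<Omega>"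
  shows "AE x in lebesgue. x \<in> \<Omega> \<longrightarrow> g x = g' x"
proof -
  have lm: "\<Omega> \<in> lmeasurable" using \<Omega> by (simp add: lmeasurable_open)
  then have S: "\<Omega> \<in> sets lebesgue" by auto
  have comp: "integrable lebesgue (\<lambda>x. indicator \<Omega> x * g x $ i)" if "g \<in> L2_space \<Omega>" for g :: "real^'n \<Rightarrow> real^'n"
      and i
    using integrable_inner_left[of "axis i 1" lebesgue "\<lambda>x. indicator \<Omega> x *\<^sub>R g x"] L2_space_integrable[OF lm that]
    by (simp add: inner_axis)
  have "AE x in lebesgue. x \<in> \<Omega> \<longrightarrow> indicator \<Omega> x * g x $ i - indicator \<Omega> x * g' x $ i = 0" for i
  proof (rule fundamental_lemma[OF \<Omega>(1)])
    show "integrable lebesgue (\<lambda>x. indicator \<Omega> x * g x $ i - indicator \<Omega> x * g' x $ i)"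
      using comp assms by (intro Bochner_Integration.integrable_diff) auto
    fix \<phi> assume \<phi>: "\<phi> \<in> test_functions \<Omega>"
    obtain M where M: "\<And>x. \<bar>\<phi> x\<bar> \<le> M" by (rule test_functions_bounded[OF \<phi>]) (rule that)
    have \<phi>m: "\<phi> \<in> borel_measurable lebesgue" using test_functions_measurable[OF \<phi>]
        by (simp add: measurable_completion)
    have ii: "integrable lebesgue (\<lambda>x. indicator \<Omega> x * g x $ i * \<phi> x)"
        "integrable lebesgue (\<lambda>x. indicator \<Omega> x * g' x $ i * \<phi> x)"
      by (rule integrable_bounded_mult[OF comp[OF assms(5)] \<phi>m M], rule integrable_bounded_mult[OF comp[OF assms(6)]
          \<phi>m M])
    have "(LINT x|lebesgue_on \<Omega>. g x $ i * \<phi> x) = (LINT x|lebesgue_on \<Omega>. g' x $ i * \<phi> x)"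
      using assms(3)[unfolded is_weak_grad_def, rule_format, OF \<phi>, of i]
        assms(4)[unfolded is_weak_grad_def, rule_format, OF \<phi>, of i] by simp
    then have "(LINT x|lebesgue. indicator \<Omega> x * g x $ i * \<phi> x) = (LINT x|lebesgue. indicator \<Omega> x * g' x $ i * \<phi> x)"
      using S by (simp add: integral_restrict_space mult.assoc)
    then show "(LINT x|lebesgue. (indicator \<Omega> x * g x $ i - indicator \<Omega> x * g' x $ i) * \<phi> x) = 0"
      using ii by (simp add: left_diff_distrib)
  qed
  then have "AE x in lebesgue. \<forall>i. x \<in> \<Omega> \<longrightarrow> indicator \<Omega> x * g x $ i - indicator \<Omega> x * g' x $ i = 0"
    by (subst AE_all_countable) auto
  then show ?thesis by eventually_elim (auto simp: vec_eq_iff)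
qed

context fe_mesh
begin

section \<open>Volumes and numbers of elements\<close>

lemma unit_ball_pos: "unit_ball_vol (real CARD('n)) > 0" by simp

lemma dom_lmeasurable: "\<Omega> \<in> lmeasurable" using open_dom bounded_dom by (simp add: lmeasurable_open)

lemma dom_sets: "\<Omega> \<in> sets lebesgue" using dom_lmeasurable by auto

lemma measure_cball: fixes x :: "real^'n" and r :: real shows "r \<ge> 0 \<Longrightarrow> measure lebesgue (cball x r)
    = unit_ball_vol (real CARD('n)) * r ^ CARD('n)"
  using content_cball[of r x] by simp

lemma element_lmeasurable: "K \<in> \<T> \<Longrightarrow> K \<in> lmeasurable"
  using element_facts(5) by (rule lmeasurable_compact)

lemma element_measure_lower: assumes "K \<in> \<T>" shows "unit_ball_vol (real CARD('n)) * (c * h) ^ CARD('n)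
    \<le> measure lebesgue K"
proof -
  obtain x where x: "cball x (c * h) \<subseteq> K" using inball[OF assms] by auto
  have "measure lebesgue (cball x (c * h)) \<le> measure lebesgue K"
    using x element_lmeasurable[OF assms] by (intro measure_mono_fmeasurable) auto
  then show ?thesis using measure_cball[of "c * h" x] c_pos h_pos by simp
qed

lemma element_cball: "K \<in> \<T> \<Longrightarrow> x \<in> K \<Longrightarrow> K \<subseteq> cball x h"
  using element_dist[of K x] by (auto simp: dist_norm)

lemma element_measure_upper: assumes "K \<in> \<T>" shows "measure lebesgue K \<le> unit_ball_vol (real CARD('n)) * h ^ CARD('n)"
proof -
  obtain x where x: "x \<in> K" using element_interior[OF assms] interior_subset by blast
  have "measure lebesgue K \<le> measure lebesgue (cball x h)"
    using element_cball[OF assms x] element_lmeasurable[OF assms] by (intro measure_mono_fmeasurable) auto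
  then show ?thesis using measure_cball[of h x] h_pos by simp
qed

lemma element_measure_pos: "K \<in> \<T> \<Longrightarrow> measure lebesgue K > 0"
  using element_measure_lower[of K] c_pos h_pos by (intro less_le_trans[OF _ element_measure_lower]) auto

lemma tri_nonempty: "\<T> \<noteq> {}"
  using Union_tri nonempty_dom closure_subset by fastforce

text \<open>An element contains a ball of radius c h and lies in one of radius h. The bound keeps
  the spectral ratio of the mass matrix at most 1 and the node counts at least 1.\<close>

lemma c_le_1: "c \<le> 1"
proof -
  obtain K where K: "K \<in> \<T>" using tri_nonempty by blast
  have "(c * h) ^ CARD('n) \<le> h ^ CARD('n)"
    using element_measure_lower[OF K] element_measure_upper[OF K] unit_ball_pos
        by (meson mult_le_cancel_left_pos order_trans)
  then have "c * h \<le> h" using power_le_imp_le_base[of "c * h" "CARD('n) - 1" h] h_pos by simp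
  then show ?thesis using h_pos by simp
qed

lemma element_unique: "K \<in> \<T> \<Longrightarrow> K' \<in> \<T> \<Longrightarrow> x \<in> interior K \<Longrightarrow> x \<in> K' \<Longrightarrow> K = K'"
  using element_interior_disjoint[of K K' x] element_interior_disjoint[of K' K x] interior_mono[of K K']
      interior_subset[of K] by blast

lemma element_Int_negligible: assumes "K \<in> \<T>" "K' \<in> \<T>" "K \<noteq> K'" shows "negligible (K \<inter> K')"
proof (rule negligible_subset)
  show "negligible (frontier K)" using element_facts(6)[OF assms(1)] by (rule negligible_convex_frontier)
  show "K \<inter> K' \<subseteq> frontier K" using element_unique[OF assms(1,2)] assms(3) closure_subset unfolding frontier_def
      by blast
qed

text \<open>Packing: different elements overlap in null sets, and each has at least the volume of a
  ball of radius c h.\<close>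

lemma count_elements:
  assumes "S \<subseteq> \<T>" "\<Union>S \<subseteq> cball x R" "R \<ge> 0"
  shows "real (card S) * (c * h) ^ CARD('n) \<le> R ^ CARD('n)"
proof -
  have fS: "finite S" using assms(1) finite_tri finite_subset by blast
  have "unit_ball_vol (real CARD('n)) * (real (card S) * (c * h) ^ CARD('n))
      = (\<Sum>K\<in>S. unit_ball_vol (real CARD('n)) * (c * h) ^ CARD('n))" by simp
  also have "\<dots> \<le> (\<Sum>K\<in>S. measure lebesgue K)" using assms(1) element_measure_lower by (intro sum_mono) auto
  also have "\<dots> = measure lebesgue (\<Union>S)"
    using assms(1) element_lmeasurable element_Int_negligible 
    by (intro measure_negligible_finite_Union[symmetric] fS) (auto simp: pairwise_def subset_iff)
  also have "\<dots> \<le> measure lebesgue (cball x R)"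
    using assms(1) fS element_lmeasurable 
    by (intro measure_mono_fmeasurable assms(2) fmeasurableD) (auto intro!: fmeasurable.finite_Union)
  also have "\<dots> = unit_ball_vol (real CARD('n)) * R ^ CARD('n)" by (rule measure_cball[OF assms(3)])
  finally show ?thesis using unit_ball_pos by (meson mult_le_cancel_left_pos)
qed

section \<open>The mesh as a partition up to null sets\<close>

lemma AE_element:
  "AE x in lebesgue. (x \<in> \<Omega> \<longrightarrow> (\<exists>K\<in>\<T>. x \<in> interior K \<and> (\<forall>K'\<in>\<T>. x \<in> K' \<longrightarrow> K' = K))) \<and> (x \<notin> \<Omega> \<longrightarrow> (\<forall>K\<in>\<T>. x \<notin> K))"
proof -
  \<comment> \<open>Off this set an element that contains a point contains it in its interior, and
    is then the only such element.\<close>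
  have "negligible (frontier \<Omega> \<union> (\<Union>K\<in>\<T>. frontier K))"
    using null_frontier finite_tri negligible_convex_frontier[OF element_facts(6)]
        by (intro negligible_Un negligible_Union) auto
  then have "AE x in lebesgue. x \<notin> frontier \<Omega> \<union> (\<Union>K\<in>\<T>. frontier K)"
    by (intro AE_not_in) (simp add: negligible_iff_null_sets)
  then show ?thesis
  proof eventually_elim
    case (elim x)
    have int: "x \<in> interior K" if "K \<in> \<T>" "x \<in> K" for K
      using elim that closure_subset[of K] unfolding frontier_def by blast
    show ?case
    proof (intro conjI impI ballI notI)
      assume "x \<in> \<Omega>"
      then obtain K where K: "K \<in> \<T>" "x \<in> K" using Union_tri closure_subset by blast
      then show "\<exists>K\<in>\<T>. x \<in> interior K \<and> (\<forall>K'\<in>\<T>. x \<in> K' \<longrightarrow> K' = K)"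
        using int[OF K] element_unique[OF K(1)] by blast
    next
      fix K assume "x \<notin> \<Omega>" "K \<in> \<T>" "x \<in> K"
      then have "x \<in> frontier \<Omega>" using element_subset open_dom unfolding frontier_def by (auto simp: interior_open)
      then show False using elim by simp
    qed
  qed
qed

text \<open>The exceptional set does not depend on \<open>F\<close>, so the quantifier stands
  inside, and sums with different \<open>F\<close> can be evaluated at the same point.\<close>

lemma AE_sum_element:
  fixes F :: "(real^'n) set \<Rightarrow> real^'n \<Rightarrow> 'b::real_vector"
  shows "AE x in lebesgue. \<forall>F. (\<Sum>K\<in>\<T>. indicator K x *\<^sub>R F K) = (if x \<in> \<Omega> then F (THE K. K \<in> \<T> \<and> x \<in> K) else
      (0::'b::real_vector))"
  using AE_element
proof eventually_elim
  case (elim x)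
  show ?case
  proof (cases "x \<in> \<Omega>")
    case True
    then obtain K where K: "K \<in> \<T>" "x \<in> interior K" "\<forall>K'\<in>\<T>. x \<in> K' \<longrightarrow> K' = K" using elim by blast
    have xK: "x \<in> K" using K interior_subset by blast
    have "(THE K. K \<in> \<T> \<and> x \<in> K) = K" by (rule the_equality) (use K xK in blast)+
    moreover have "(\<Sum>K\<in>\<T>. indicator K x *\<^sub>R F K) = F K" for F :: "(real^'n) set \<Rightarrow> 'b"
    proof -
      have "(\<Sum>K'\<in>\<T>. indicator K' x *\<^sub>R F K') = (\<Sum>K'\<in>{K}. indicator K' x *\<^sub>R F K')"
        using K finite_tri by (intro sum.mono_neutral_right) (auto simp: indicator_def)
      then show ?thesis using xK by simp
    qed
    ultimately show ?thesis using True by simp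
  next
    case False
    then show ?thesis using elim by (auto intro!: sum.neutral simp: indicator_def)
  qed
qed

lemma AE_indicator_sum: "AE x in lebesgue. indicator \<Omega> x = (\<Sum>K\<in>\<T>. indicator K x :: real)"
  using AE_sum_element[where 'b=real]
proof eventually_elim
  case (elim x)
  from elim[rule_format, of "\<lambda>_. 1"] show ?case by (simp add: indicator_def)
qed

lemma integral_split:
  fixes f :: "real^'n \<Rightarrow> real"
  assumes "integrable lebesgue (\<lambda>x. indicator \<Omega> x * f x)"
  shows "\<And>K. K \<in> \<T> \<Longrightarrow> integrable lebesgue (\<lambda>x. indicator K x * f x)"
    "(LINT x|lebesgue. indicator \<Omega> x * f x) = (\<Sum>K\<in>\<T>. LINT x|lebesgue. indicator K x * f x)"
proof -
  have eq: "AE x in lebesgue. indicator K x * f x = indicator K x * (indicator \<Omega> x * f x)" if "K \<in> \<T>" for K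
    using AE_element by eventually_elim (use that in \<open>auto simp: indicator_def\<close>)
  have i1: "integrable lebesgue (\<lambda>x. indicator K x * (indicator \<Omega> x * f x))" if "K \<in> \<T>" for K
    using integrable_real_mult_indicator[OF fmeasurableD[OF element_lmeasurable[OF that]] assms]
        by (simp add: mult.commute)
  show i2: "integrable lebesgue (\<lambda>x. indicator K x * f x)" if K: "K \<in> \<T>" for K
  proof -
    have eq': "AE x in lebesgue. indicator K x * (indicator \<Omega> x * f x) = indicator K x * f x"
      using eq[OF K] by eventually_elim simp
    have "(\<lambda>x. indicator K x * f x) \<in> borel_measurable lebesgue"
      by (rule borel_measurable_AE[OF _ eq']) (use i1[OF K] in auto)
    then show ?thesis by (rule integrable_cong_AE_imp[OF i1[OF K] _ eq'])
  qed
  have "(LINT x|lebesgue. indicator \<Omega> x * f x) = (LINT x|lebesgue. (\<Sum>K\<in>\<T>. indicator K x * f x))"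
  proof (rule integral_cong_AE)
    show "AE x in lebesgue. indicator \<Omega> x * f x = (\<Sum>K\<in>\<T>. indicator K x * f x)"
      using AE_indicator_sum by eventually_elim (simp add: sum_distrib_right[symmetric])
  qed (use assms i2 in auto)
  also have "\<dots> = (\<Sum>K\<in>\<T>. LINT x|lebesgue. indicator K x * f x)" by (rule Bochner_Integration.integral_sum) (rule i2)
  finally show "(LINT x|lebesgue. indicator \<Omega> x * f x) = (\<Sum>K\<in>\<T>. LINT x|lebesgue. indicator K x * f x)" .
qed

section \<open>The elementwise gradient is the weak gradient\<close>

definition pw_grad :: "(real^'n \<Rightarrow> real) \<Rightarrow> real^'n \<Rightarrow> real^'n" where
  "pw_grad v x = (\<Sum>K\<in>\<T>. indicator K x *\<^sub>R fe_grad v K)"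

text \<open>On shared faces \<open>pw_grad\<close> adds several slopes, so squaring passes through
  the sum only almost everywhere.\<close>

lemma pw_grad_norm: "AE x in lebesgue. indicator \<Omega> x * (norm (pw_grad v x))\<^sup>2
    = (\<Sum>K\<in>\<T>. indicator K x * (norm (fe_grad v K))\<^sup>2)"
  using AE_sum_element[where 'b=real] AE_sum_element[where 'b="real^'n"]
proof eventually_elim
  case (elim x)
  from elim(1)[rule_format, of "\<lambda>K. (norm (fe_grad v K))\<^sup>2"] elim(2)[rule_format, of "fe_grad v"]
  show ?case by (simp add: pw_grad_def indicator_def)
qed

lemma pw_grad_measurable: "pw_grad v \<in> borel_measurable lebesgue"
  unfolding pw_grad_def[abs_def] using fmeasurableD[OF element_lmeasurable] by measurable

lemma pw_grad_integrable: "integrable lebesgue (\<lambda>x. \<Sum>K\<in>\<T>. indicator K x * (norm (fe_grad v K))\<^sup>2)"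
  using element_lmeasurable
  by (intro Bochner_Integration.integrable_sum integrable_mult_left) (simp add: lmeasurable_iff_integrable)

lemma pw_grad_L2: "pw_grad v \<in> L2_space \<Omega>"
  unfolding L2_space_iff[OF dom_sets]
proof
  show m: "(\<lambda>x. indicator \<Omega> x *\<^sub>R pw_grad v x) \<in> borel_measurable lebesgue" using pw_grad_measurable dom_sets
      by measurable
  have "(\<lambda>x. (norm (indicator \<Omega> x *\<^sub>R pw_grad v x))\<^sup>2) \<in> borel_measurable lebesgue" using m by measurable
  then have m2: "(\<lambda>x. indicator \<Omega> x * (norm (pw_grad v x))\<^sup>2) \<in> borel_measurable lebesgue"
    by (rule measurable_cong[THEN iffD1, rotated]) (auto simp: indicator_def)
  show "integrable lebesgue (\<lambda>x. indicator \<Omega> x * (norm (pw_grad v x))\<^sup>2)"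
    by (rule integrable_cong_AE[THEN iffD2, OF m2 _ pw_grad_norm pw_grad_integrable]) (use pw_grad_integrable in auto)
qed

lemma pw_grad_L2_norm: "(L2_norm \<Omega> (pw_grad v))\<^sup>2 = (\<Sum>K\<in>\<T>. measure lebesgue K * (norm (fe_grad v K))\<^sup>2)"
proof -
  have "(L2_norm \<Omega> (pw_grad v))\<^sup>2 = (LINT x|lebesgue. indicator \<Omega> x * (norm (pw_grad v x))\<^sup>2)"
    by (rule L2_norm_square[OF dom_sets])
  also have "\<dots> = (LINT x|lebesgue. (\<Sum>K\<in>\<T>. indicator K x * (norm (fe_grad v K))\<^sup>2))"
    by (rule integral_cong_AE[OF _ _ pw_grad_norm]) 
      (use pw_grad_L2[of v] pw_grad_integrable[of v] in \<open>auto simp: L2_space_iff[OF dom_sets]\<close>)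
  also have "\<dots> = (\<Sum>K\<in>\<T>. LINT x|lebesgue. indicator K x * (norm (fe_grad v K))\<^sup>2)"
    using element_lmeasurable
    by (intro Bochner_Integration.integral_sum integrable_mult_left) (simp add: lmeasurable_iff_integrable)
  also have "\<dots> = (\<Sum>K\<in>\<T>. measure lebesgue K * (norm (fe_grad v K))\<^sup>2)"
    using element_lmeasurable by (intro sum.cong refl) auto
  finally show ?thesis .
qed

text \<open>The closed elements cut the segment into finitely many closed pieces on which
  \<open>v\<close> is affine, and Lipschitz bounds glue. The crude constant depends on the mesh; it
  only provides a dominating function for \<open>fe_weak_grad\<close>.\<close>

lemma fe_segment_lipschitz:
  assumes v: "v \<in> fe_space \<Omega> \<T>" and seg: "\<And>s. s \<in> {0..1} \<Longrightarrow> x + s *\<^sub>R y \<in> closure \<Omega>"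
  shows "\<bar>v (x + y) - v x\<bar> \<le> (\<Sum>K\<in>\<T>. norm (fe_grad v K)) * norm y"
proof -
  let ?L = "\<Sum>K\<in>\<T>. norm (fe_grad v K)"
  have "(?L * norm y)-lipschitz_on {0..1} (\<lambda>s. v (x + s *\<^sub>R y))"
  proof (rule lipschitz_on_closed_Union[where I=\<T> and U="\<lambda>K. {s. x + s *\<^sub>R y \<in> K}"])
    fix K assume K: "K \<in> \<T>"
    have gL: "norm (fe_grad v K) \<le> ?L" by (rule member_le_sum) (use K finite_tri in auto)
    show "(?L * norm y)-lipschitz_on {s. x + s *\<^sub>R y \<in> K} (\<lambda>s. v (x + s *\<^sub>R y))"
    proof (rule lipschitz_onI)
      fix s t assume "s \<in> {s. x + s *\<^sub>R y \<in> K}" "t \<in> {s. x + s *\<^sub>R y \<in> K}"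
      then have "v (x + s *\<^sub>R y) - v (x + t *\<^sub>R y) = fe_grad v K \<bullet> ((s - t) *\<^sub>R y)"
        using fe_grad_diff[OF v K, of "x + s *\<^sub>R y" "x + t *\<^sub>R y"] by (simp add: scaleR_left_diff_distrib)
      then have "\<bar>v (x + s *\<^sub>R y) - v (x + t *\<^sub>R y)\<bar> \<le> norm (fe_grad v K) * norm ((s - t) *\<^sub>R y)"
        using Cauchy_Schwarz_ineq2 by metis
      also have "\<dots> \<le> ?L * norm ((s - t) *\<^sub>R y)" using gL by (rule mult_right_mono) simp
      finally show "dist (v (x + s *\<^sub>R y)) (v (x + t *\<^sub>R y)) \<le> ?L * norm y * dist s t"
        by (simp add: dist_norm mult_ac)
    qed (simp add: sum_nonneg)
    have "closed K" using element_facts(5)[OF K] by (rule compact_imp_closed)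
    then have "closed ((\<lambda>s. x + s *\<^sub>R y) -` K)" by (intro continuous_closed_vimage) (auto intro!: continuous_intros)
    then show "closed {s. x + s *\<^sub>R y \<in> K}" by (simp add: vimage_def)
  qed (use finite_tri seg Union_tri in \<open>auto simp: sum_nonneg\<close>)
  from lipschitz_onD[OF this, of 1 0] show ?thesis by (simp add: dist_norm)
qed

text \<open>Integration by parts on single elements would produce face terms. Instead a translation
  moves the difference quotient from \<phi> to \<open>v\<close>, and both sides converge by
  dominated convergence: one by the mean value theorem, the other by
  \<open>fe_segment_lipschitz\<close>.\<close>

lemma fe_weak_grad:
  assumes v: "v \<in> fe_space \<Omega> \<T>"
  shows "is_weak_grad \<Omega> v (pw_grad v)"
  unfolding is_weak_grad_def
proof (intro ballI allI)
  fix \<phi> :: "real^'n \<Rightarrow> real" and i assume \<phi>: "\<phi> \<in> test_functions \<Omega>"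
  let ?e = "axis i 1 :: real^'n"
  let ?S = "closure {x. \<phi> x \<noteq> 0}"
  let ?L = "\<Sum>K\<in>\<T>. norm (fe_grad v K)"
  have S: "compact ?S" "?S \<subseteq> \<Omega>" using \<phi> by (auto simp: test_functions_def)
  obtain d where d: "d > 0" "(\<Union>x\<in>?S. cball x d) \<subseteq> \<Omega>"
    using compact_subset_open_imp_cball_epsilon_subset[OF S(1) open_dom S(2)] by metis
  obtain M where M: "M \<ge> 0" "\<And>x. \<bar>\<phi> x\<bar> \<le> M" "\<And>i x. \<bar>partial_deriv i \<phi> x\<bar> \<le> M" using test_functions_bounded[OF \<phi>]
      by blast
  obtain B where B: "B \<ge> 0" "\<And>x. \<bar>v x\<bar> \<le> B" using fe_bounded[OF v] by blast
  have vm[measurable]: "v \<in> borel_measurable borel" by (rule fe_measurable[OF v])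
  have \<phi>m[measurable]: "\<phi> \<in> borel_measurable borel" by (rule test_functions_measurable[OF \<phi>])
  have pm[measurable]: "partial_deriv i \<phi> \<in> borel_measurable borel"
    by (rule borel_measurable_continuous_onI[OF test_functions_partial_continuous[OF \<phi>]])
  have lbg: "f \<in> borel_measurable borel \<Longrightarrow> f \<in> borel_measurable lebesgue" for f :: "real^'n \<Rightarrow> real"
    by (simp add: measurable_completion)
  have vi: "integrable lebesgue v"
    by (rule integrable_bounded_support[OF lbg[OF vm] B(2)]) (use v in \<open>auto simp: fe_space_def\<close>)
  have \<phi>0: "\<phi> x = 0" if "x \<notin> \<Omega>" for x using that S(2) closure_subset[of "{x. \<phi> x \<noteq> 0}"] by blast
  have \<phi>i: "integrable lebesgue \<phi>"
    by (rule integrable_bounded_support[OF lbg[OF \<phi>m] M(2)]) (use \<phi>0 closure_subset in blast)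
  \<comment> \<open>Steps of length at most \<open>d\<close> keep the translated support of \<phi>
    inside \<Omega>.\<close>
  define t where "t k = d / (real k + 1)" for k :: nat
  have t: "t k > 0" "t k \<le> d" for k using d by (auto simp: t_def field_simps)
  have t0: "t \<longlonglongrightarrow> 0" unfolding t_def
    using tendsto_mult[OF tendsto_const[of d] LIMSEQ_inverse_real_of_nat] by (simp add: divide_inverse add.commute)
  have lim1: "(\<lambda>k. LINT x|lebesgue. v x * ((\<phi> (x + t k *\<^sub>R ?e) - \<phi> x) / t k)) \<longlonglongrightarrow> (LINT x|lebesgue. v x * partial_deriv
      i \<phi> x)"
  proof (rule integral_dominated_convergence[where w="\<lambda>x. \<bar>v x\<bar> * M"])
    show "AE x in lebesgue. (\<lambda>k. v x * ((\<phi> (x + t k *\<^sub>R ?e) - \<phi> x) / t k)) \<longlonglongrightarrow> v x * partial_deriv i \<phi> x"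
    proof (intro AE_I2 tendsto_mult tendsto_const)
      fix x
      have "(\<lambda>h. (\<phi> (x + (0 + h) *\<^sub>R ?e) - \<phi> (x + 0 *\<^sub>R ?e)) / h) \<midarrow>0\<rightarrow> partial_deriv i \<phi> (x + 0 *\<^sub>R ?e)"
        using test_function_partial_DERIV[OF \<phi>, of x i 0] unfolding DERIV_def .
      moreover have "filterlim t (at 0) sequentially" using t0 t by (intro filterlim_atI)
          (auto simp: less_imp_neq[symmetric] eventually_sequentially)
      ultimately show "(\<lambda>k. (\<phi> (x + t k *\<^sub>R ?e) - \<phi> x) / t k) \<longlonglongrightarrow> partial_deriv i \<phi> x"
        using filterlim_compose by fastforce
    qed
    show "AE x in lebesgue. norm (v x * ((\<phi> (x + t k *\<^sub>R ?e) - \<phi> x) / t k)) \<le> \<bar>v x\<bar> * M" for k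
    proof (rule AE_I2)
      fix x
      have "\<exists>z. 0 < z \<and> z < t k \<and> \<phi> (x + t k *\<^sub>R ?e) - \<phi> (x + 0 *\<^sub>R ?e) = (t k - 0) * partial_deriv i \<phi>
          (x + z *\<^sub>R ?e)"
        by (rule MVT2[OF t(1)]) (rule test_function_partial_DERIV[OF \<phi>])
      then obtain z where "\<phi> (x + t k *\<^sub>R ?e) - \<phi> x = t k * partial_deriv i \<phi> (x + z *\<^sub>R ?e)" by auto
      then have "(\<phi> (x + t k *\<^sub>R ?e) - \<phi> x) / t k = partial_deriv i \<phi> (x + z *\<^sub>R ?e)" using t(1)[of k] by simp
      then show "norm (v x * ((\<phi> (x + t k *\<^sub>R ?e) - \<phi> x) / t k)) \<le> \<bar>v x\<bar> * M"
        using M(3) by (simp add: abs_mult mult_left_mono)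
    qed
    show "integrable lebesgue (\<lambda>x. \<bar>v x\<bar> * M)" using vi by simp
  qed (auto intro!: lbg)
  have lim2: "(\<lambda>k. LINT x|lebesgue. (v (x - t k *\<^sub>R ?e) - v x) / t k * \<phi> x) \<longlonglongrightarrow> (LINT x|lebesgue. - (pw_grad v x $ i) *
      \<phi> x)"
  proof (rule integral_dominated_convergence[where w="\<lambda>x. ?L * \<bar>\<phi> x\<bar>"])
    show "AE x in lebesgue. (\<lambda>k. (v (x - t k *\<^sub>R ?e) - v x) / t k * \<phi> x) \<longlonglongrightarrow> - (pw_grad v x $ i) * \<phi> x"
      using AE_element
    proof eventually_elim
      case (elim x)
      show ?case
      proof (cases "x \<in> \<Omega>")
        case True
        then obtain K where K: "K \<in> \<T>" "x \<in> interior K" "\<forall>K'\<in>\<T>. x \<in> K' \<longrightarrow> K' = K" using elim by blast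
        have xK: "x \<in> K" using K interior_subset by blast
        have "pw_grad v x = (\<Sum>K'\<in>{K}. indicator K' x *\<^sub>R fe_grad v K')"
          unfolding pw_grad_def using K finite_tri by (intro sum.mono_neutral_right) (auto simp: indicator_def)
        then have pg: "pw_grad v x = fe_grad v K" using xK by simp
        have "(\<lambda>k. x - t k *\<^sub>R ?e) \<longlonglongrightarrow> x - 0 *\<^sub>R ?e" by (intro tendsto_intros t0)
        then have "\<forall>\<^sub>F k in sequentially. x - t k *\<^sub>R ?e \<in> interior K"
          using K(2) by (intro topological_tendstoD) auto
        then have "\<forall>\<^sub>F k in sequentially. - (pw_grad v x $ i) * \<phi> x = (v (x - t k *\<^sub>R ?e) - v x) / t k * \<phi> x"
        proof eventually_elim
          case (elim k)
          then have "x - t k *\<^sub>R ?e \<in> K" using interior_subset by blast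
          then have "v (x - t k *\<^sub>R ?e) - v x = - (t k * fe_grad v K $ i)"
            using fe_grad_diff[OF v K(1) _ xK] by (simp add: inner_axis)
          then show ?case using t(1)[of k] by (simp add: pg)
        qed
        then show ?thesis by (rule Lim_transform_eventually[OF tendsto_const])
      qed (simp add: \<phi>0)
    qed
    show "AE x in lebesgue. norm ((v (x - t k *\<^sub>R ?e) - v x) / t k * \<phi> x) \<le> ?L * \<bar>\<phi> x\<bar>" for k
    proof (rule AE_I2)
      fix x
      show "norm ((v (x - t k *\<^sub>R ?e) - v x) / t k * \<phi> x) \<le> ?L * \<bar>\<phi> x\<bar>"
      proof (cases "\<phi> x = 0")
        case False
        then have xS: "x \<in> ?S" using closure_subset[of "{x. \<phi> x \<noteq> 0}"] by blast
        have "x + s *\<^sub>R (- t k *\<^sub>R ?e) \<in> closure \<Omega>" if "s \<in> {0..1}" for s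
        proof -
          have "s * t k \<le> 1 * d" using that t[of k] by (intro mult_mono) auto
          then have "x + s *\<^sub>R (- t k *\<^sub>R ?e) \<in> cball x d" using that t(1)[of k]
              by (simp add: dist_norm norm_axis_1 abs_mult)
          then show ?thesis using d(2) xS closure_subset by blast
        qed
        from fe_segment_lipschitz[OF v this]
        have "\<bar>v (x - t k *\<^sub>R ?e) - v x\<bar> \<le> ?L * t k" using t(1)[of k] by (simp add: norm_axis_1)
        then have "\<bar>v (x - t k *\<^sub>R ?e) - v x\<bar> / t k \<le> ?L" using t(1)[of k] by (simp add: pos_divide_le_eq)
        from mult_right_mono[OF this abs_ge_zero[of "\<phi> x"]] show ?thesis using t(1)[of k] by (simp add: abs_mult)
      qed simp
    qed
    show "integrable lebesgue (\<lambda>x. ?L * \<bar>\<phi> x\<bar>)" using \<phi>i by simp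
    show "(\<lambda>x. - (pw_grad v x $ i) * \<phi> x) \<in> borel_measurable lebesgue"
      using pw_grad_measurable[of v] lbg[OF \<phi>m] by (simp add: cart_eq_inner_axis)
  qed (auto intro!: lbg)
  have qk: "(LINT x|lebesgue. v x * ((\<phi> (x + t k *\<^sub>R ?e) - \<phi> x) / t k))
      = (LINT x|lebesgue. (v (x - t k *\<^sub>R ?e) - v x) / t k * \<phi> x)" for k
  proof -
    have lb: "integrable lborel v" "integrable lborel \<phi>" using vi \<phi>i by (auto simp: integrable_completion)
    have i: "integrable lborel (\<lambda>x. v x * \<phi> (x + t k *\<^sub>R ?e))" "integrable lborel (\<lambda>x. v x * \<phi> x)"
        "integrable lborel (\<lambda>x. v (x - t k *\<^sub>R ?e) * \<phi> x)"
      using M B integrable_lborel_translate[OF lb(1), of "- t k *\<^sub>R ?e"] lb(1)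
          by (auto intro!: integrable_bounded_mult)
    have "(LINT x|lborel. v x * \<phi> (x + t k *\<^sub>R ?e)) = (LINT x|lborel. v (x - t k *\<^sub>R ?e) * \<phi> x)"
      using integral_lborel_translate[of "\<lambda>x. v (x - t k *\<^sub>R ?e) * \<phi> x" "t k *\<^sub>R ?e"] by simp
    then have "(LINT x|lborel. v x * \<phi> (x + t k *\<^sub>R ?e) - v x * \<phi> x)
        = (LINT x|lborel. v (x - t k *\<^sub>R ?e) * \<phi> x - v x * \<phi> x)"
      using i by simp
    then have "(LINT x|lborel. (v x * \<phi> (x + t k *\<^sub>R ?e) - v x * \<phi> x) / t k)
        = (LINT x|lborel. (v (x - t k *\<^sub>R ?e) * \<phi> x - v x * \<phi> x) / t k)"
      by simp
    then have "(LINT x|lborel. v x * ((\<phi> (x + t k *\<^sub>R ?e) - \<phi> x) / t k))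
        = (LINT x|lborel. (v (x - t k *\<^sub>R ?e) - v x) / t k * \<phi> x)"
      by (simp add: right_diff_distrib left_diff_distrib diff_divide_distrib)
    then show ?thesis by (simp add: integral_completion)
  qed
  have eq: "(LINT x|lebesgue. v x * partial_deriv i \<phi> x) = (LINT x|lebesgue. - (pw_grad v x $ i) * \<phi> x)"
    by (rule LIMSEQ_unique[OF lim1[unfolded qk] lim2])
  have p0: "partial_deriv i \<phi> x = 0" if "x \<notin> \<Omega>" for x using that S(2) by (intro partial_deriv_zero_outside) auto
  have "(LINT x|lebesgue_on \<Omega>. v x * partial_deriv i \<phi> x) = (LINT x|lebesgue. v x * partial_deriv i \<phi> x)"
    using dom_sets p0 by (subst integral_restrict_space) (auto intro!: Bochner_Integration.integral_cong simp:
        indicator_def)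
  moreover have "(LINT x|lebesgue_on \<Omega>. pw_grad v x $ i * \<phi> x) = (LINT x|lebesgue. pw_grad v x $ i * \<phi> x)"
    using dom_sets \<phi>0 by (subst integral_restrict_space) (auto intro!: Bochner_Integration.integral_cong simp:
        indicator_def)
  ultimately show "(LINT x|lebesgue_on \<Omega>. v x * partial_deriv i \<phi> x)
      = - (LINT x|lebesgue_on \<Omega>. pw_grad v x $ i * \<phi> x)"
    using eq by simp
qed

end

section \<open>The orthogonal projection\<close>

lemma summable_geometric_polynomial:
  fixes \<rho> :: real
  assumes "0 \<le> \<rho>" "\<rho> < 1"
  shows "summable (\<lambda>k. \<rho>^k * (real k + 1)^n)"
proof -
  have "(\<lambda>k. \<rho> * (1 + inverse (real (Suc k)))^n) \<longlonglongrightarrow> \<rho> * (1 + 0)^n"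
    by (intro tendsto_intros LIMSEQ_inverse_real_of_nat)
  moreover have "\<rho> * (1 + 0)^n < (1 + \<rho>)/2" using assms by simp
  ultimately have "\<forall>\<^sub>F k in sequentially. \<rho> * (1 + inverse (real (Suc k)))^n < (1 + \<rho>)/2"
    by (rule order_tendstoD)
  then obtain N where N: "\<And>k. k \<ge> N \<Longrightarrow> \<rho> * (1 + inverse (real (Suc k)))^n \<le> (1 + \<rho>)/2"
    unfolding eventually_sequentially by (meson less_imp_le)
  show ?thesis
  proof (rule summable_ratio_test[of "(1 + \<rho>)/2" N])
    show "(1 + \<rho>)/2 < 1" using assms by simp
    fix k assume "k \<ge> N"
    have e: "real (Suc k) + 1 = (1 + inverse (real (Suc k))) * (real k + 1)" by (simp add: field_simps)
    have "norm (\<rho>^Suc k * (real (Suc k) + 1)^n) = (\<rho> * (1 + inverse (real (Suc k)))^n) * (\<rho>^k * (real k + 1)^n)"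
      unfolding e power_mult_distrib using assms by (simp add: abs_mult)
    also have "\<dots> \<le> (1 + \<rho>)/2 * (\<rho>^k * (real k + 1)^n)"
      by (intro mult_right_mono N \<open>k \<ge> N\<close>) (use assms in simp)
    finally show "norm (\<rho>^Suc k * (real (Suc k) + 1)^n) \<le> (1 + \<rho>)/2 * norm (\<rho>^k * (real k + 1)^n)"
      using assms by (simp add: abs_mult)
  qed
qed

text \<open>The quotient subtracted from 1 is the ratio of the bounds \<open>mass_lower\<close> and \<open>mass_upper\<close> for the spectrum
  of the mass matrix, and the last factor is the node count of \<open>count_nodes\<close>.\<close>

definition projection_const :: "nat \<Rightarrow> real \<Rightarrow> real" where
  "projection_const n c = c^n * (\<Sum>k. (1 - c^n * c^n / (real (n + 1) * 4^(n+1)))^k *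
      (real (n + 1) * ((real k + 1) / c)^n))"

section \<open>Integrals of bounded functions over the domain and its elements\<close>

context fe_mesh
begin

text \<open>Contains the finite element functions and the bounded competitors and is closed under
  products, so integrability is automatic. Vanishing off the closure turns integrals over \<Omega>
  into integrals over the whole space.\<close>

definition bounded_functions :: "(real^'n \<Rightarrow> real) set" where
  "bounded_functions = {f \<in> borel_measurable lebesgue. (\<exists>M. \<forall>x. \<bar>f x\<bar> \<le> M) \<and> (\<forall>x. x \<notin> closure \<Omega> \<longrightarrow> f x = 0)}"

lemma bounded_functions_integrable: "f \<in> bounded_functions \<Longrightarrow> integrable lebesgue f"
  unfolding bounded_functions_def using integrable_bounded_support by blast

lemma fe_bounded_functions: "v \<in> fe_space \<Omega> \<T> \<Longrightarrow> v \<in> bounded_functions"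
  unfolding bounded_functions_def using fe_measurable[of v] fe_bounded[of v]
  by (auto simp: fe_space_def measurable_completion) metis

lemma bounded_functions_mult: "f \<in> bounded_functions \<Longrightarrow> g \<in> bounded_functions \<Longrightarrow> (\<lambda>x. f x * g x) \<in> bounded_functions"
proof -
  assume f: "f \<in> bounded_functions" and g: "g \<in> bounded_functions"
  obtain M M' where M: "\<And>x. \<bar>f x\<bar> \<le> M" "\<And>x. \<bar>g x\<bar> \<le> M'" using f g unfolding bounded_functions_def by blast
  have "\<bar>f x * g x\<bar> \<le> M * M'" for x
    unfolding abs_mult using M(1)[of x] M(2)[of x] by (intro mult_mono) auto
  then show ?thesis using f g unfolding bounded_functions_def by auto
qed

lemma bounded_functions_lin: "f \<in> bounded_functions \<Longrightarrow> g \<in> bounded_functions \<Longrightarrow> (\<lambda>x. f x - g x) \<in> bounded_functions"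
proof -
  assume f: "f \<in> bounded_functions" and g: "g \<in> bounded_functions"
  obtain M M' where M: "\<And>x. \<bar>f x\<bar> \<le> M" "\<And>x. \<bar>g x\<bar> \<le> M'" using f g unfolding bounded_functions_def by blast
  have "\<bar>f x - g x\<bar> \<le> M + M'" for x using M(1)[of x] M(2)[of x] by linarith
  then show ?thesis using f g unfolding bounded_functions_def by auto
qed

lemma bounded_functions_indicator: "f \<in> bounded_functions \<Longrightarrow> K \<in> \<T> \<Longrightarrow> integrable lebesgue (\<lambda>x. indicator K x * f x)"
  using integrable_real_mult_indicator[OF fmeasurableD[OF element_lmeasurable] bounded_functions_integrable]
      by (simp add: mult.commute)

lemma AE_indicator_dom: "(\<And>x. x \<notin> closure \<Omega> \<Longrightarrow> f x = (0::real)) \<Longrightarrow> AE x in lebesgue. indicator \<Omega> x * f x = f x"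
proof -
  assume z: "\<And>x. x \<notin> closure \<Omega> \<Longrightarrow> f x = (0::real)"
  have "AE x in lebesgue. x \<notin> frontier \<Omega>" using null_frontier by (intro AE_not_in)
      (simp add: negligible_iff_null_sets)
  then show ?thesis
    by eventually_elim (use z open_dom in \<open>auto simp: frontier_def interior_open indicator_def\<close>)
qed

lemma integral_dom: "f \<in> bounded_functions \<Longrightarrow> (LINT x|lebesgue. indicator \<Omega> x * f x) = (LINT x|lebesgue. f x)"
  and integrable_dom: "f \<in> bounded_functions \<Longrightarrow> integrable lebesgue (\<lambda>x. indicator \<Omega> x * f x)"
proof -
  assume f: "f \<in> bounded_functions"
  then have m: "f \<in> borel_measurable lebesgue" by (auto simp: bounded_functions_def)
  have "AE x in lebesgue. indicator \<Omega> x * f x = f x" by (rule AE_indicator_dom)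
      (use f in \<open>auto simp: bounded_functions_def\<close>)
  then show "(LINT x|lebesgue. indicator \<Omega> x * f x) = (LINT x|lebesgue. f x)"
    by (intro integral_cong_AE) (use m dom_sets in auto)
  show "integrable lebesgue (\<lambda>x. indicator \<Omega> x * f x)"
    using integrable_real_mult_indicator[OF dom_sets bounded_functions_integrable[OF f]] by (simp add: mult.commute)
qed

lemma integral_elements: "f \<in> bounded_functions \<Longrightarrow> (LINT x|lebesgue. f x)
    = (\<Sum>K\<in>\<T>. LINT x|lebesgue. indicator K x * f x)"
  using integral_split(2)[OF integrable_dom] integral_dom by simp

lemma L2_inner_eq: "f \<in> bounded_functions \<Longrightarrow> g \<in> bounded_functions \<Longrightarrow> L2_inner \<Omega> f g = (LINT x|lebesgue. f x * g x)"
  using integral_dom[OF bounded_functions_mult] by (simp add: L2_inner_indicator[OF dom_sets])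

section \<open>The mass matrix: spectrum, band width and the projection\<close>

lemma fe_element_max:
  assumes v: "v \<in> fe_space \<Omega> \<T>" and K: "K \<in> \<T>"
  obtains a where "a \<in> vertices K" "\<And>x. x \<in> K \<Longrightarrow> \<bar>v x\<bar> \<le> \<bar>v a\<bar>"
proof -
  have "vertices K \<noteq> {}" using element_facts(4)[OF K] by auto
  then have "Max ((\<lambda>b. \<bar>v b\<bar>) ` vertices K) \<in> (\<lambda>b. \<bar>v b\<bar>) ` vertices K"
    using element_facts(2)[OF K] by (intro Max_in) auto
  then obtain a where a: "a \<in> vertices K" and aM: "\<bar>v a\<bar> = Max ((\<lambda>b. \<bar>v b\<bar>) ` vertices K)" by force
  have a2: "\<bar>v b\<bar> \<le> \<bar>v a\<bar>" if "b \<in> vertices K" for b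
    unfolding aM by (rule Max_ge) (use that element_facts(2)[OF K] in auto)
  have "\<bar>v x\<bar> \<le> \<bar>v a\<bar>" if "x \<in> K" for x
  proof -
    have "(\<lambda>x. - v x) \<in> fe_space \<Omega> \<T>" using fe_space_lin[OF v v, of "-1" 0] by simp
    from fe_space_le[OF this K that, of "\<bar>v a\<bar>"] fe_space_le[OF v K that, of "\<bar>v a\<bar>"] a2
    show ?thesis by (force simp: abs_le_iff)
  qed
  then show ?thesis using that a by blast
qed

text \<open>Shrinking the element by the factor 1/4 towards the vertex where \<open>\<bar>v\<bar>\<close> is largest keeps
  \<open>\<bar>v\<bar>\<close> above half its maximum.\<close>

lemma fe_mass_lower:
  assumes v: "v \<in> fe_space \<Omega> \<T>" and K: "K \<in> \<T>" and a: "a \<in> K"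
  shows "measure lebesgue K * (v a)\<^sup>2 \<le> 4^(CARD('n) + 1) * (LINT x|lebesgue. indicator K x * (v x)\<^sup>2)"
proof -
  obtain b where b: "b \<in> vertices K" "\<And>x. x \<in> K \<Longrightarrow> \<bar>v x\<bar> \<le> \<bar>v b\<bar>" using fe_element_max[OF v K] by blast
  have bK: "b \<in> K" using b element_facts(7)[OF K] by blast
  define K' where "K' = (\<lambda>x. (1/4) *\<^sub>R x + (3/4) *\<^sub>R b) ` K"
  have K'K: "K' \<subseteq> K" unfolding K'_def using convexD[OF element_facts(6)[OF K] _ bK, of _ "1/4" "3/4"] by auto
  have m: "measure lebesgue K' = (1/4)^CARD('n) * measure lebesgue K"
    unfolding K'_def by (subst measure_lebesgue_affine) simp
  have "compact K'" unfolding K'_def using element_facts(5)[OF K]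
      by (intro compact_continuous_image continuous_intros)
  then have K's: "K' \<in> lmeasurable" by (rule lmeasurable_compact)
  have low: "(v b)\<^sup>2 / 4 \<le> (v y)\<^sup>2" if yK': "y \<in> K'" for y
  proof -
    obtain x where x: "x \<in> K" "y = (1/4) *\<^sub>R x + (3/4) *\<^sub>R b" using yK' unfolding K'_def by auto
    have "v y - v b = fe_grad v K \<bullet> (y - b)" using fe_grad_diff[OF v K _ bK] K'K yK' by blast
    also have "y - b = (1/4) *\<^sub>R (x - b)" unfolding x(2) by (simp add: scaleR_diff_right algebra_simps flip:
        scaleR_add_left)
    also have "fe_grad v K \<bullet> ((1/4) *\<^sub>R (x - b)) = (1/4) * (v x - v b)" unfolding fe_grad_diff[OF v K x(1) bK] by simp
    finally have "v y = 3/4 * v b + 1/4 * v x" by simp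
    then have "\<bar>v b / 2\<bar> \<le> \<bar>v y\<bar>" using b(2)[OF x(1)] by linarith
    then have "(v b / 2)\<^sup>2 \<le> (v y)\<^sup>2" by (simp only: abs_le_square_iff)
    then show ?thesis by (simp add: power_divide)
  qed
  have vv: "(\<lambda>x. (v x)\<^sup>2) \<in> bounded_functions"
    using bounded_functions_mult[OF fe_bounded_functions[OF v] fe_bounded_functions[OF v]]
        by (simp add: power2_eq_square)
  have "measure lebesgue K' * ((v b)\<^sup>2 / 4) = (LINT x|lebesgue. indicator K' x * ((v b)\<^sup>2 / 4))"
    using K's by simp
  also have "\<dots> \<le> (LINT x|lebesgue. indicator K x * (v x)\<^sup>2)"
  proof (rule integral_mono)
    show "integrable lebesgue (\<lambda>x. indicator K' x * ((v b)\<^sup>2 / 4))"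
      using K's by (intro integrable_mult_left) (simp add: lmeasurable_iff_integrable)
    show "integrable lebesgue (\<lambda>x. indicator K x * (v x)\<^sup>2)" by (rule bounded_functions_indicator[OF vv K])
    show "indicator K' x * ((v b)\<^sup>2 / 4) \<le> indicator K x * (v x)\<^sup>2" for x
      using low[of x] K'K by (auto simp: indicator_def)
  qed
  \<comment> \<open>The constant is 4^n for the volume of the shrunken copy, times 4 for the square
    of one half.\<close>
  finally have "measure lebesgue K * (v b)\<^sup>2 \<le> 4^(CARD('n) + 1) * (LINT x|lebesgue. indicator K x * (v x)\<^sup>2)"
    unfolding m by (simp add: power_divide field_simps)
  moreover have "(v a)\<^sup>2 \<le> (v b)\<^sup>2" using b(2)[OF a] by (simp only: abs_le_square_iff)
  then have "measure lebesgue K * (v a)\<^sup>2 \<le> measure lebesgue K * (v b)\<^sup>2" by (rule mult_left_mono) simp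
  ultimately show ?thesis by linarith
qed

lemma count_elements_at_node:
  "real (card {K\<in>\<T>. a \<in> K}) \<le> 1 / c^CARD('n)"
proof -
  have "\<Union>{K\<in>\<T>. a \<in> K} \<subseteq> cball a h" using element_cball by blast
  from count_elements[OF _ this] h_pos
  have "real (card {K\<in>\<T>. a \<in> K}) * (c * h) ^ CARD('n) \<le> h ^ CARD('n)" by auto
  then have "real (card {K\<in>\<T>. a \<in> K}) * c ^ CARD('n) * h ^ CARD('n) \<le> 1 * h ^ CARD('n)"
      by (simp add: power_mult_distrib mult_ac)
  then have "real (card {K\<in>\<T>. a \<in> K}) * c ^ CARD('n) \<le> 1" using h_pos by (subst (asm) mult_le_cancel_right_pos) auto
  then show ?thesis using c_pos by (simp add: field_simps)
qed

text \<open>An element with a vertex within k h reaches at most \<open>h\<close> further, hence the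
  radius (k + 1) h; such elements are counted by packing, with n + 1 vertices each.\<close>

lemma count_nodes:
  assumes a: "a \<in> mesh_nodes \<T>"
  shows "real (card {b\<in>mesh_nodes \<T>. dist a b \<le> real k * h}) \<le> real (CARD('n) + 1) * ((real k + 1) / c)^CARD('n)"
proof -
  let ?S = "{K\<in>\<T>. K \<subseteq> cball a ((real k + 1) * h)}"
  have fS: "finite ?S" using finite_tri by simp
  have sub: "{b\<in>mesh_nodes \<T>. dist a b \<le> real k * h} \<subseteq> (\<Union>K\<in>?S. vertices K)"
  proof
    fix b assume "b \<in> {b\<in>mesh_nodes \<T>. dist a b \<le> real k * h}"
    then obtain K where K: "K \<in> \<T>" "b \<in> vertices K" "dist a b \<le> real k * h" unfolding nodes_eq by auto
    have "K \<subseteq> cball a ((real k + 1) * h)"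
    proof
      fix x assume "x \<in> K"
      then have "dist b x \<le> h" using element_dist[OF K(1), of b x] element_facts(7)[OF K(1)] K(2)
          by (auto simp: dist_norm)
      then show "x \<in> cball a ((real k + 1) * h)" using K(3) dist_triangle[of a x b] by (simp add: algebra_simps)
    qed
    then show "b \<in> (\<Union>K\<in>?S. vertices K)" using K by blast
  qed
  have "card {b\<in>mesh_nodes \<T>. dist a b \<le> real k * h} \<le> card (\<Union>K\<in>?S. vertices K)"
    by (rule card_mono[OF _ sub]) (use fS element_facts(2) in auto)
  also have "\<dots> \<le> (\<Sum>K\<in>?S. card (vertices K))" by (rule card_UN_le[OF fS])
  also have "\<dots> = (\<Sum>K\<in>?S. CARD('n) + 1)" by (intro sum.cong refl) (use element_facts(4) in auto)
  also have "\<dots> = (CARD('n) + 1) * card ?S" by simp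
  finally have "card {b\<in>mesh_nodes \<T>. dist a b \<le> real k * h} \<le> (CARD('n) + 1) * card ?S" .
  from of_nat_mono[OF this, where 'a=real]
  have 1: "real (card {b\<in>mesh_nodes \<T>. dist a b \<le> real k * h}) \<le> real (CARD('n) + 1) * real (card ?S)"
    by (simp only: of_nat_mult)
  have "real (card ?S) * (c * h) ^ CARD('n) \<le> ((real k + 1) * h) ^ CARD('n)"
    by (rule count_elements[of ?S a]) (use h_pos in auto)
  then have "real (card ?S) \<le> ((real k + 1) * h) ^ CARD('n) / (c * h) ^ CARD('n)"
    using h_pos c_pos by (simp add: pos_le_divide_eq)
  also have "\<dots> = ((real k + 1) / c)^CARD('n)" using h_pos by (simp add: power_divide[symmetric])
  finally have "real (CARD('n) + 1) * real (card ?S) \<le> real (CARD('n) + 1) * ((real k + 1) / c)^CARD('n)"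
    by (rule mult_left_mono) simp
  with 1 show ?thesis by linarith
qed

lemma nodal_interp_sum: "nodal_interp \<Omega> \<T> f = (\<lambda>x. \<Sum>a\<in>mesh_nodes \<T>. f a * nodal_basis \<Omega> \<T> a x)"
  by (simp add: nodal_interp_def fun_eq_iff)

lemma fe_expansion: "v \<in> fe_space \<Omega> \<T> \<Longrightarrow> v = (\<lambda>x. \<Sum>a\<in>mesh_nodes \<T>. v a * nodal_basis \<Omega> \<T> a x)"
  using nodal_interp_eq[of v v] nodal_interp_sum[of v] by simp

lemma nodal_basis_support:
  assumes "a \<in> mesh_nodes \<T>" "nodal_basis \<Omega> \<T> a x \<noteq> 0" "K \<in> \<T>" "x \<in> K"
  shows "a \<in> K"
proof (rule ccontr)
  assume n: "a \<notin> K"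
  then have z: "nodal_basis \<Omega> \<T> a b = 0" if "b \<in> vertices K" for b
    using nodal_basis(2)[OF assms(1) vertex_node[OF assms(3) that]] that element_facts(7)[OF assms(3)] by auto
  obtain b where "b \<in> vertices K" "\<bar>nodal_basis \<Omega> \<T> a x\<bar> \<le> \<bar>nodal_basis \<Omega> \<T> a b\<bar>"
    using fe_element_max[OF nodal_basis(1)[OF assms(1)] assms(3)] assms(4) by metis
  then show False using z assms(2) by auto
qed

lemma nodal_basis_support_closure:
  assumes "a \<in> mesh_nodes \<T>" "nodal_basis \<Omega> \<T> a x \<noteq> 0"
  obtains K where "K \<in> \<T>" "x \<in> K" "a \<in> K"
proof -
  have "x \<in> closure \<Omega>" using nodal_basis(1)[OF assms(1)] assms(2) by (auto simp: fe_space_def)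
  then obtain K where "K \<in> \<T>" "x \<in> K" using Union_tri by auto
  then show ?thesis using that nodal_basis_support[OF assms] by blast
qed

lemma nodal_basis_le_1: "a \<in> mesh_nodes \<T> \<Longrightarrow> \<bar>nodal_basis \<Omega> \<T> a x\<bar> \<le> 1"
  by (rule fe_abs_le) (auto simp: nodal_basis)

text \<open>Every node is a vertex of some element, where \<open>fe_mass_lower\<close> bounds its
  value. The n + 1 vertices of an element all use the same integral, which gives the divisor n +
  1.\<close>

lemma mass_lower:
  assumes v: "v \<in> fe_space \<Omega> \<T>"
  shows "unit_ball_vol (real CARD('n)) * (c * h)^CARD('n) / (real (CARD('n) + 1) * 4^(CARD('n)+1)) * (\<Sum>a\<in>mesh_nodes \<T>.
      (v a)\<^sup>2) \<le> (LINT x|lebesgue. v x * v x)"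
proof -
  let ?w = "unit_ball_vol (real CARD('n)) * (c * h)^CARD('n)"
  have w: "?w > 0" using c_pos h_pos by simp
  have vv: "(\<lambda>x. v x * v x) \<in> bounded_functions" by (intro bounded_functions_mult fe_bounded_functions v)
  have "?w * (\<Sum>a\<in>mesh_nodes \<T>. (v a)\<^sup>2) \<le> ?w * (\<Sum>K\<in>\<T>. \<Sum>a\<in>vertices K. (v a)\<^sup>2)"
  proof (rule mult_left_mono)
    have vK: "(\<Sum>K\<in>\<T>. \<Sum>a\<in>vertices K. (v a)\<^sup>2) = (\<Sum>K\<in>\<T>. \<Sum>a\<in>{a\<in>mesh_nodes \<T>. a \<in> vertices K}. (v a)\<^sup>2)"
      by (intro sum.cong refl) (auto simp: vertex_node)
    have "(\<Sum>a\<in>mesh_nodes \<T>. (v a)\<^sup>2) \<le> (\<Sum>a\<in>mesh_nodes \<T>. \<Sum>K\<in>{K\<in>\<T>. a \<in> vertices K}. (v a)\<^sup>2)"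
    proof (rule sum_mono)
      fix a assume "a \<in> mesh_nodes \<T>"
      then have "{K\<in>\<T>. a \<in> vertices K} \<noteq> {}" by (auto simp: nodes_eq)
      then have "1 \<le> real (card {K\<in>\<T>. a \<in> vertices K})" using finite_tri by (simp add: Suc_le_eq card_gt_0_iff)
      from mult_right_mono[OF this zero_le_power2[of "v a"]]
      show "(v a)\<^sup>2 \<le> (\<Sum>K\<in>{K\<in>\<T>. a \<in> vertices K}. (v a)\<^sup>2)" by simp
    qed
    also have "\<dots> = (\<Sum>K\<in>\<T>. \<Sum>a\<in>vertices K. (v a)\<^sup>2)"
      unfolding vK by (rule sum.swap_restrict[OF finite_nodes finite_tri])
    finally show "(\<Sum>a\<in>mesh_nodes \<T>. (v a)\<^sup>2) \<le> (\<Sum>K\<in>\<T>. \<Sum>a\<in>vertices K. (v a)\<^sup>2)" .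
  qed (use w in simp)
  also have "\<dots> = (\<Sum>K\<in>\<T>. \<Sum>a\<in>vertices K. ?w * (v a)\<^sup>2)" by (simp add: sum_distrib_left)
  also have "\<dots> \<le> (\<Sum>K\<in>\<T>. \<Sum>a\<in>vertices K. 4^(CARD('n) + 1) * (LINT x|lebesgue. indicator K x * (v x)\<^sup>2))"
  proof (intro sum_mono)
    fix K a assume K: "K \<in> \<T>" and a: "a \<in> vertices K"
    have "?w * (v a)\<^sup>2 \<le> measure lebesgue K * (v a)\<^sup>2" by (intro mult_right_mono element_measure_lower K) simp
    also have "\<dots> \<le> 4^(CARD('n) + 1) * (LINT x|lebesgue. indicator K x * (v x)\<^sup>2)"
      by (rule fe_mass_lower[OF v K]) (use a element_facts(7)[OF K] in auto)
    finally show "?w * (v a)\<^sup>2 \<le> 4^(CARD('n) + 1) * (LINT x|lebesgue. indicator K x * (v x)\<^sup>2)" .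
  qed
  also have "\<dots> = real (CARD('n) + 1) * 4^(CARD('n) + 1) * (LINT x|lebesgue. v x * v x)"
    unfolding integral_elements[OF vv] sum_distrib_left
    by (intro sum.cong refl) (simp add: element_facts(4) power2_eq_square)
  finally have le: "?w * (\<Sum>a\<in>mesh_nodes \<T>. (v a)\<^sup>2) \<le> real (CARD('n) + 1) * 4^(CARD('n) + 1) * (LINT x|lebesgue. v x *
      v x)" .
  have "real (CARD('n) + 1) * 4^(CARD('n) + 1) > 0" by (intro mult_pos_pos) auto
  then have "?w * (\<Sum>a\<in>mesh_nodes \<T>. (v a)\<^sup>2) / (real (CARD('n) + 1) * 4^(CARD('n) + 1))
      \<le> (LINT x|lebesgue. v x * v x)"
    using le by (subst pos_divide_le_eq) (simp_all only: mult.commute)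
  then show ?thesis by (simp only: times_divide_eq_left)
qed

text \<open>On an element \<bar>v\<bar> is at most its largest vertex value, and by packing a node
  is a vertex of at most c^-n elements.\<close>

lemma mass_upper:
  assumes v: "v \<in> fe_space \<Omega> \<T>"
  shows "(LINT x|lebesgue. v x * v x) \<le> unit_ball_vol (real CARD('n)) * h^CARD('n) / c^CARD('n) * (\<Sum>a\<in>mesh_nodes \<T>.
      (v a)\<^sup>2)"
proof -
  let ?w = "unit_ball_vol (real CARD('n)) * h^CARD('n)"
  have w: "?w > 0" using h_pos by simp
  have vv: "(\<lambda>x. v x * v x) \<in> bounded_functions" by (intro bounded_functions_mult fe_bounded_functions v)
  have vK: "vertices K = {a\<in>mesh_nodes \<T>. a \<in> vertices K}" if "K \<in> \<T>" for K using that vertex_node by auto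
  have "(LINT x|lebesgue. v x * v x) = (\<Sum>K\<in>\<T>. LINT x|lebesgue. indicator K x * (v x * v x))"
      by (rule integral_elements[OF vv])
  also have "\<dots> \<le> (\<Sum>K\<in>\<T>. ?w * (\<Sum>a\<in>vertices K. (v a)\<^sup>2))"
  proof (rule sum_mono)
    fix K assume K: "K \<in> \<T>"
    obtain b where b: "b \<in> vertices K" "\<And>x. x \<in> K \<Longrightarrow> \<bar>v x\<bar> \<le> \<bar>v b\<bar>" using fe_element_max[OF v K] by blast
    have "(LINT x|lebesgue. indicator K x * (v x * v x)) \<le> (LINT x|lebesgue. indicator K x * (v b)\<^sup>2)"
    proof (rule integral_mono)
      show "integrable lebesgue (\<lambda>x. indicator K x * (v b)\<^sup>2)"
        using element_lmeasurable[OF K] by (intro integrable_mult_left) (simp add: lmeasurable_iff_integrable)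
      show "indicator K x * (v x * v x) \<le> indicator K x * (v b)\<^sup>2" for x
        using b(2)[of x] abs_le_square_iff[of "v x" "v b"] by (auto simp: indicator_def power2_eq_square)
    qed (rule bounded_functions_indicator[OF vv K])
    also have "\<dots> = measure lebesgue K * (v b)\<^sup>2" using element_lmeasurable[OF K] by simp
    also have "\<dots> \<le> ?w * (\<Sum>a\<in>vertices K. (v a)\<^sup>2)"
      using element_measure_upper[OF K] w element_facts(2)[OF K] b(1)
      by (intro mult_mono member_le_sum) auto
    finally show "(LINT x|lebesgue. indicator K x * (v x * v x)) \<le> ?w * (\<Sum>a\<in>vertices K. (v a)\<^sup>2)" .
  qed
  also have "\<dots> = ?w * (\<Sum>K\<in>\<T>. \<Sum>a\<in>{a\<in>mesh_nodes \<T>. a \<in> vertices K}. (v a)\<^sup>2)"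
    unfolding sum_distrib_left[symmetric] using vK by simp
  finally have 1: "(LINT x|lebesgue. v x * v x) \<le> ?w * (\<Sum>K\<in>\<T>. \<Sum>a\<in>{a\<in>mesh_nodes \<T>. a \<in> vertices K}. (v a)\<^sup>2)" .
  have "(\<Sum>K\<in>\<T>. \<Sum>a\<in>{a\<in>mesh_nodes \<T>. a \<in> vertices K}. (v a)\<^sup>2) = (\<Sum>a\<in>mesh_nodes \<T>. \<Sum>K\<in>{K\<in>\<T>. a \<in> vertices K}. (v a)\<^sup>2)"
    by (rule sum.swap_restrict[OF finite_tri finite_nodes])
  also have "\<dots> \<le> (\<Sum>a\<in>mesh_nodes \<T>. 1 / c^CARD('n) * (v a)\<^sup>2)"
  proof (rule sum_mono)
    fix a assume "a \<in> mesh_nodes \<T>"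
    have "card {K\<in>\<T>. a \<in> vertices K} \<le> card {K\<in>\<T>. a \<in> K}" using finite_tri element_facts(7) by (intro card_mono) auto
    then have "real (card {K\<in>\<T>. a \<in> vertices K}) \<le> 1 / c^CARD('n)" using count_elements_at_node[of a] by linarith
    then show "(\<Sum>K\<in>{K\<in>\<T>. a \<in> vertices K}. (v a)\<^sup>2) \<le> 1 / c^CARD('n) * (v a)\<^sup>2"
      by (simp only: sum_constant) (rule mult_right_mono, auto)
  qed
  finally have "?w * (\<Sum>K\<in>\<T>. \<Sum>a\<in>{a\<in>mesh_nodes \<T>. a \<in> vertices K}. (v a)\<^sup>2)
      \<le> ?w * (\<Sum>a\<in>mesh_nodes \<T>. 1 / c^CARD('n) * (v a)\<^sup>2)"
    using w by (intro mult_left_mono) auto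
  with 1 show ?thesis by (simp add: sum_divide_distrib[symmetric])
qed

text \<open>The normal equations form a banded system: basis functions of nodes further apart than
  \<open>h\<close> have disjoint supports. \<open>banded_system_solution\<close> therefore yields
  existence and the sup bound together.\<close>

lemma L2_projection:
  assumes p: "p \<in> bounded_functions" and \<beta>: "\<And>x. \<bar>p x\<bar> \<le> \<beta>"
  obtains r where "r \<in> fe_space \<Omega> \<T>" "\<And>q. q \<in> fe_space \<Omega> \<T> \<Longrightarrow> (LINT x|lebesgue. q x * r x)
      = (LINT x|lebesgue. q x * p x)"
    "\<And>a. a \<in> mesh_nodes \<T> \<Longrightarrow> \<bar>r a\<bar> \<le> \<beta> * projection_const CARD('n) c"
proof -
  let ?n = "CARD('n)" let ?N = "mesh_nodes \<T>" let ?\<omega> = "unit_ball_vol (real ?n)"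
  define \<phi> where "\<phi> = nodal_basis \<Omega> \<T>"
  have hn: "h ^ ?n > 0" using h_pos by simp
  have \<beta>0: "\<beta> \<ge> 0" using \<beta>[of 0] by linarith
  have \<phi>B: "\<phi> a \<in> bounded_functions" if "a \<in> ?N" for a unfolding \<phi>_def using nodal_basis(1)[OF that]
      by (rule fe_bounded_functions)
  \<comment> \<open>Division by h^n removes the scaling of volumes, so the spectral bounds
    \<open>M1\<close> and \<open>M2\<close> do not depend on \<open>h\<close>.\<close>
  define A where "A a b = (LINT x|lebesgue. \<phi> a x * \<phi> b x) / h^?n" for a b
  define f where "f a = (LINT x|lebesgue. \<phi> a x * p x) / h^?n" for a
  define M1 where "M1 = ?\<omega> * c^?n / (real (?n + 1) * 4^(?n+1))"
  define M2 where "M2 = ?\<omega> / c^?n"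
  have M: "M1 > 0" "M2 > 0" using c_pos by (auto simp: M1_def M2_def)
  have ratio: "M1 / M2 = c^?n * c^?n / (real (?n + 1) * 4^(?n+1))"
    using c_pos less_imp_neq[OF unit_ball_pos] by (simp add: M1_def M2_def)
  have r1: "M1 / M2 \<le> 1"
  proof -
    have "c^?n * c^?n \<le> 1 * 1" using c_pos c_le_1 by (intro mult_mono power_le_one) auto
    also have "\<dots> \<le> real (?n + 1) * 4^(?n+1)" by (intro mult_mono one_le_power) auto
    finally show ?thesis unfolding ratio by (simp add: divide_le_eq_1)
  qed
  have form: "(\<Sum>a\<in>?N. \<Sum>b\<in>?N. x a * A a b * x b) = (LINT y|lebesgue. nodal_interp \<Omega> \<T> x y * nodal_interp \<Omega> \<T> x y) /
      h^?n" for x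
  proof -
    have "(LINT y|lebesgue. nodal_interp \<Omega> \<T> x y * nodal_interp \<Omega> \<T> x y)
        = (LINT y|lebesgue. (\<Sum>a\<in>?N. \<Sum>b\<in>?N. (x a * x b) * (\<phi> a y * \<phi> b y)))"
      unfolding nodal_interp_sum \<phi>_def sum_product by (intro Bochner_Integration.integral_cong refl sum.cong) simp
    also have "\<dots> = (\<Sum>a\<in>?N. \<Sum>b\<in>?N. (x a * x b) * (LINT y|lebesgue. \<phi> a y * \<phi> b y))"
    proof -
      have I: "integrable lebesgue (\<lambda>y. (x a * x b) * (\<phi> a y * \<phi> b y))" if "a \<in> ?N" "b \<in> ?N" for a b
        using bounded_functions_integrable[OF bounded_functions_mult[OF \<phi>B[OF that(1)] \<phi>B[OF that(2)]]] by simp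
      have "(LINT y|lebesgue. (\<Sum>a\<in>?N. \<Sum>b\<in>?N. (x a * x b) * (\<phi> a y * \<phi> b y)))
          = (\<Sum>a\<in>?N. LINT y|lebesgue. (\<Sum>b\<in>?N. (x a * x b) * (\<phi> a y * \<phi> b y)))"
        by (rule Bochner_Integration.integral_sum) (intro Bochner_Integration.integrable_sum I)
      also have "\<dots> = (\<Sum>a\<in>?N. \<Sum>b\<in>?N. LINT y|lebesgue. (x a * x b) * (\<phi> a y * \<phi> b y))"
        by (intro sum.cong refl Bochner_Integration.integral_sum I)
      finally show ?thesis by simp
    qed
    finally show ?thesis by (simp add: A_def sum_divide_distrib mult_ac)
  qed
  have sm: "summable (\<lambda>k. (1 - M1/M2)^k * (real (?n + 1) * ((real k + 1) / c)^?n))"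
  proof -
    have "summable (\<lambda>k. (1 - M1/M2)^k * (real k + 1)^?n)" using M r1 by (intro summable_geometric_polynomial) auto
    from summable_mult[OF this, of "real (?n + 1) / c^?n"] show ?thesis by (simp add: power_divide mult_ac)
  qed
  obtain x where x: "\<And>a. a \<in> ?N \<Longrightarrow> (\<Sum>b\<in>?N. A a b * x b) = f a"
    "\<And>a. a \<in> ?N \<Longrightarrow> \<bar>x a\<bar> \<le> (\<beta> * ?\<omega>) / M2 * (\<Sum>k. (1 - M1/M2)^k * (real (?n + 1) * ((real k + 1) / c)^?n))"
  proof (rule banded_system_solution[of ?N A M1 M2 h "\<lambda>k. real (?n + 1) * ((real k + 1) / c)^?n" f "\<beta> * ?\<omega>"])
    show "finite ?N" by (rule finite_nodes)
    show "A a b = A b a" for a b by (simp add: A_def mult.commute)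
    show "M1 * (\<Sum>a\<in>?N. (x a)\<^sup>2) \<le> (\<Sum>a\<in>?N. \<Sum>b\<in>?N. x a * A a b * x b)" for x
      unfolding form using mass_lower[OF nodal_interp(1)[of x]] hn by (simp add: nodal_interp(2) M1_def field_simps)
    show "(\<Sum>a\<in>?N. \<Sum>b\<in>?N. x a * A a b * x b) \<le> M2 * (\<Sum>a\<in>?N. (x a)\<^sup>2)" for x
      unfolding form using mass_upper[OF nodal_interp(1)[of x]] hn by (simp add: nodal_interp(2) M2_def field_simps)
    show "0 < M1" "M1 \<le> M2" "0 \<le> h" using M r1 h_pos by (auto simp: field_simps)
    show "A a b = 0" if ab: "a \<in> ?N" "b \<in> ?N" "dist a b > h" for a b
    proof -
      have z: "\<phi> a x * \<phi> b x = 0" for x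
      proof (rule ccontr)
        assume "\<phi> a x * \<phi> b x \<noteq> 0"
        then have nz: "nodal_basis \<Omega> \<T> a x \<noteq> 0" "nodal_basis \<Omega> \<T> b x \<noteq> 0" by (auto simp: \<phi>_def)
        obtain K where K: "K \<in> \<T>" "x \<in> K" "a \<in> K" using nodal_basis_support_closure[OF ab(1) nz(1)] by blast
        have "b \<in> K" by (rule nodal_basis_support[OF ab(2) nz(2) K(1,2)])
        from element_dist[OF K(1,3) this] show False using ab(3) by (simp add: dist_norm)
      qed
      show ?thesis unfolding A_def z by simp
    qed
    \<comment> \<open>The count would allow the square root of the stated number; as that number is
      at least 1, it may stand for its own root.\<close>
    show "real (card {b\<in>?N. dist a b \<le> real k * h}) \<le> (real (?n + 1) * ((real k + 1) / c)^?n)\<^sup>2" if "a \<in> ?N" for a k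
    proof -
      let ?m = "real (?n + 1) * ((real k + 1) / c)^?n"
      have "1 \<le> (real k + 1) / c" using c_pos c_le_1 by (simp add: field_simps)
      then have "1 * 1 \<le> ?m" by (intro mult_mono one_le_power) auto
      then have "?m * 1 \<le> ?m * ?m" by (intro mult_left_mono) auto
      with count_nodes[OF that, of k] show ?thesis unfolding power2_eq_square by linarith
    qed
    show "0 \<le> real (?n + 1) * ((real k + 1) / c)^?n" for k using c_pos by simp
    show "\<bar>f a\<bar> \<le> \<beta> * ?\<omega>" if a: "a \<in> ?N" for a
    proof -
      have i: "integrable lebesgue (\<lambda>x. \<phi> a x * p x)" by (intro bounded_functions_integrable bounded_functions_mult \<phi>B
          a p)
      have "\<bar>LINT x|lebesgue. \<phi> a x * p x\<bar> \<le> (LINT x|lebesgue. \<bar>\<phi> a x * p x\<bar>)" by (rule integral_abs_bound)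
      also have "\<dots> \<le> (LINT x|lebesgue. indicator (cball a h) x * \<beta>)"
      proof (rule integral_mono)
        show "integrable lebesgue (\<lambda>x. \<bar>\<phi> a x * p x\<bar>)" using i by simp
        show "integrable lebesgue (\<lambda>x. indicator (cball a h) x * \<beta>)"
          by (intro integrable_mult_left) (simp add: lmeasurable_iff_integrable[symmetric])
        show "\<bar>\<phi> a x * p x\<bar> \<le> indicator (cball a h) x * \<beta>" for x
        proof (cases "\<phi> a x = 0")
          case False
          then obtain K where "K \<in> \<T>" "x \<in> K" "a \<in> K" using nodal_basis_support_closure[OF a, of x] unfolding \<phi>_def
              by metis
          then have "x \<in> cball a h" using element_cball by blast
          moreover have "\<bar>\<phi> a x * p x\<bar> \<le> 1 * \<beta>" unfolding abs_mult \<phi>_def using nodal_basis_le_1[OF a] \<beta>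
              by (intro mult_mono) auto
          ultimately show ?thesis by simp
        qed (simp add: \<beta>0)
      qed
      also have "\<dots> = ?\<omega> * h^?n * \<beta>" using measure_cball[of h a] h_pos by simp
      finally show ?thesis unfolding f_def using hn by (simp add: abs_divide pos_divide_le_eq mult_ac)
    qed
    show "0 \<le> \<beta> * ?\<omega>" using \<beta>0 unit_ball_pos by simp
  qed (use sm in auto)
  define r where "r = nodal_interp \<Omega> \<T> x"
  have r: "r \<in> fe_space \<Omega> \<T>" unfolding r_def by (rule nodal_interp)
  have b1: "(LINT y|lebesgue. \<phi> a y * r y) = (LINT y|lebesgue. \<phi> a y * p y)" if a: "a \<in> ?N" for a
  proof -
    have "(LINT y|lebesgue. \<phi> a y * r y) = (LINT y|lebesgue. (\<Sum>b\<in>?N. x b * (\<phi> a y * \<phi> b y)))"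
      unfolding r_def nodal_interp_sum \<phi>_def sum_distrib_left
          by (intro Bochner_Integration.integral_cong refl sum.cong) simp
    also have "\<dots> = (\<Sum>b\<in>?N. x b * (LINT y|lebesgue. \<phi> a y * \<phi> b y))"
      using bounded_functions_integrable[OF bounded_functions_mult[OF \<phi>B[OF a] \<phi>B]]
      by (subst Bochner_Integration.integral_sum) auto
    also have "\<dots> = h^?n * (\<Sum>b\<in>?N. A a b * x b)" using h_pos by (simp add: A_def sum_distrib_left mult_ac)
    also have "\<dots> = (LINT y|lebesgue. \<phi> a y * p y)" unfolding x(1)[OF a] using h_pos by (simp add: f_def)
    finally show ?thesis .
  qed
  have b2: "(LINT y|lebesgue. q y * g y) = (\<Sum>a\<in>?N. q a * (LINT y|lebesgue. \<phi> a y * g y))"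
    if q: "q \<in> fe_space \<Omega> \<T>" and g: "g \<in> bounded_functions" for q g
  proof -
    have qy: "q y = (\<Sum>a\<in>?N. q a * \<phi> a y)" for y unfolding \<phi>_def by (rule fun_cong[OF fe_expansion[OF q]])
    have "(LINT y|lebesgue. q y * g y) = (LINT y|lebesgue. (\<Sum>a\<in>?N. q a * (\<phi> a y * g y)))"
      by (intro Bochner_Integration.integral_cong refl) (subst qy, simp add: sum_distrib_right mult.assoc)
    also have "\<dots> = (\<Sum>a\<in>?N. q a * (LINT y|lebesgue. \<phi> a y * g y))"
      using bounded_functions_integrable[OF bounded_functions_mult[OF \<phi>B g]]
      by (subst Bochner_Integration.integral_sum) auto
    finally show ?thesis .
  qed
  show ?thesis
  proof (rule that[OF r])
    fix q assume q: "q \<in> fe_space \<Omega> \<T>"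
    show "(LINT x|lebesgue. q x * r x) = (LINT x|lebesgue. q x * p x)"
      unfolding b2[OF q fe_bounded_functions[OF r]] b2[OF q p] using b1 by simp
  next
    fix a assume a: "a \<in> ?N"
    have "?\<omega> / M2 = c^?n" using less_imp_neq[OF unit_ball_pos] c_pos by (simp add: M2_def)
    then have "\<beta> * ?\<omega> / M2 = \<beta> * c^?n" by (metis times_divide_eq_right)
    then show "\<bar>r a\<bar> \<le> \<beta> * projection_const ?n c"
      using x(2)[OF a] unfolding projection_const_def r_def nodal_interp(2)[OF a] ratio[symmetric]
          by (simp add: mult.assoc)
  qed
qed

end

section \<open>Approximation by local averages\<close>

text \<open>Borel functions on the whole space stand in for a bounded function on \<open>\<Omega>\<close> and its weak gradient,
  because Tonelli's theorem is available for \<open>lborel\<close> only.\<close>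

definition bounded_weak_pair :: "(real^'n) set \<Rightarrow> real \<Rightarrow> (real^'n \<Rightarrow> real) \<Rightarrow> (real^'n \<Rightarrow> real^'n) \<Rightarrow> bool" where
  "bounded_weak_pair \<Omega> \<beta> p g \<longleftrightarrow>
     p \<in> borel_measurable borel \<and> (\<forall>x. \<bar>p x\<bar> \<le> \<beta>) \<and> (\<forall>x. x \<notin> \<Omega> \<longrightarrow> p x = 0) \<and>
     integrable lborel g \<and> integrable lborel (\<lambda>x. (norm (g x))\<^sup>2) \<and>
     (\<forall>\<phi>\<in>test_functions \<Omega>. \<forall>i. (LINT x|lborel. p x * partial_deriv i \<phi> x) = - (LINT x|lborel. g x $ i * \<phi> x))"

lemma bounded_weak_pairD:
  assumes "bounded_weak_pair \<Omega> \<beta> p g"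
  shows "p \<in> borel_measurable borel" "\<bar>p x\<bar> \<le> \<beta>" "x \<notin> \<Omega> \<Longrightarrow> p x = 0"
    "integrable lborel g" "integrable lborel (\<lambda>x. (norm (g x))\<^sup>2)"
    "\<phi> \<in> test_functions \<Omega> \<Longrightarrow> (LINT x|lborel. p x * partial_deriv i \<phi> x) = - (LINT x|lborel. g x $ i * \<phi> x)"
  using assms by (auto simp: bounded_weak_pair_def)

text \<open>Expanding about the mean over \<open>B\<close>, the cross term vanishes and the variance
  is nonnegative. With q = p x this passes from a double integral of differences to the distance
  from the average.\<close>

lemma average_variance_le:
  fixes p :: "real^'n \<Rightarrow> real" and q :: real
  assumes p: "p \<in> borel_measurable borel" "\<And>x. \<bar>p x\<bar> \<le> \<beta>" and B: "B \<in> sets borel" "emeasure lborel B = ennreal m"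
      "m > 0"
  shows "ennreal m * ennreal ((q - (LINT y|lborel. indicator B y * p y) / m)\<^sup>2)
      \<le> (\<integral>\<^sup>+y. indicator B y * ennreal ((q - p y)\<^sup>2) \<partial>lborel)"
proof -
  let ?r = "(LINT y|lborel. indicator B y * p y) / m"
  have pm[measurable]: "p \<in> borel_measurable borel" and Bm[measurable]: "B \<in> sets borel" by fact+
  have iB: "integrable lborel (\<lambda>y. indicator B y :: real)" using B by (simp add: integrable_indicator_iff)
  have mB: "measure lborel B = m" using B by (simp add: measure_def)
  have bq: "\<bar>q - p y\<bar> \<le> \<bar>q\<bar> + \<beta>" for y using p(2)[of y] by linarith
  have i1: "integrable lborel (\<lambda>y. indicator B y * p y)" by (rule integrable_bounded_mult[OF iB]) (use p in auto)
  have i2: "integrable lborel (\<lambda>y. indicator B y * (q - p y)\<^sup>2)"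
  proof (rule integrable_bounded_mult[OF iB])
    show "\<bar>(q - p y)\<^sup>2\<bar> \<le> (\<bar>q\<bar> + \<beta>)\<^sup>2" for y using power_mono[OF bq[of y], of 2] by simp
  qed auto
  have i3: "integrable lborel (\<lambda>y. indicator B y * (?r - p y)\<^sup>2)"
  proof (rule integrable_bounded_mult[OF iB])
    have "\<bar>?r - p y\<bar> \<le> \<bar>?r\<bar> + \<beta>" for y using p(2)[of y] by linarith
    from power_mono[OF this, of _ 2] show "\<bar>(?r - p y)\<^sup>2\<bar> \<le> (\<bar>?r\<bar> + \<beta>)\<^sup>2" for y by simp
  qed auto
  have "(LINT y|lborel. indicator B y * (q - p y)\<^sup>2) = (LINT y|lborel. (q - ?r)\<^sup>2 * indicator B y + 2 * (q - ?r) *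
      (?r * indicator B y - indicator B y * p y) + indicator B y * (?r - p y)\<^sup>2)"
    by (intro Bochner_Integration.integral_cong refl) (simp add: power2_eq_square algebra_simps)
  also have "\<dots> = (q - ?r)\<^sup>2 * m + 2 * (q - ?r) * (?r * m - (LINT y|lborel. indicator B y * p y)) +
      (LINT y|lborel. indicator B y * (?r - p y)\<^sup>2)"
    using iB i1 i3 mB by simp
  also have "\<dots> \<ge> m * (q - ?r)\<^sup>2"
  proof -
    have "(LINT y|lborel. indicator B y * (?r - p y)\<^sup>2) \<ge> 0" by (intro integral_nonneg_AE AE_I2) simp
    then show ?thesis using B(3) by simp
  qed
  finally have "m * (q - ?r)\<^sup>2 \<le> (LINT y|lborel. indicator B y * (q - p y)\<^sup>2)" .
  then have "ennreal (m * (q - ?r)\<^sup>2) \<le> ennreal (LINT y|lborel. indicator B y * (q - p y)\<^sup>2)" by (rule ennreal_leI)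
  also have "\<dots> = (\<integral>\<^sup>+y. ennreal (indicator B y * (q - p y)\<^sup>2) \<partial>lborel)"
    by (rule nn_integral_eq_integral[symmetric, OF i2]) auto
  also have "\<dots> = (\<integral>\<^sup>+y. indicator B y * ennreal ((q - p y)\<^sup>2) \<partial>lborel)"
    by (intro nn_integral_cong) (auto simp: indicator_def)
  finally show ?thesis using B(3) by (simp add: ennreal_mult)
qed

section \<open>Inverse estimate and averaged interpolation\<close>

context fe_mesh
begin

text \<open>On an element with largest vertex value v(b), vertex differences are at most 2 \<bar>v
  b\<bar>, so the gradient is at most \<bar>v b\<bar> / (c h); \<open>fe_mass_lower\<close> bounds
  v(b) by the integral.\<close>

lemma fe_inverse_estimate:
  assumes v: "v \<in> fe_space \<Omega> \<T>"
  shows "(\<Sum>K\<in>\<T>. measure lebesgue K * (norm (fe_grad v K))\<^sup>2) \<le> 4^(CARD('n) + 1) / (c * h)\<^sup>2 * (LINT x|lebesgue. v x *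
      v x)"
proof -
  have ch: "c * h > 0" using c_pos h_pos by simp
  have vv: "(\<lambda>x. v x * v x) \<in> bounded_functions" by (intro bounded_functions_mult fe_bounded_functions v)
  have "(\<Sum>K\<in>\<T>. measure lebesgue K * (norm (fe_grad v K))\<^sup>2) \<le> (\<Sum>K\<in>\<T>. 4^(CARD('n) + 1) / (c * h)\<^sup>2 * (LINT x|lebesgue.
      indicator K x * (v x * v x)))"
  proof (rule sum_mono)
    fix K assume K: "K \<in> \<T>"
    obtain b where b: "b \<in> vertices K" "\<And>x. x \<in> K \<Longrightarrow> \<bar>v x\<bar> \<le> \<bar>v b\<bar>" using fe_element_max[OF v K] by blast
    note vK = element_facts(7)[OF K]
    have "norm (fe_grad v K) \<le> (2 * \<bar>v b\<bar>) / (2 * c * h)"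
    proof (rule fe_grad_bound[OF v K])
      fix x y assume "x \<in> vertices K" "y \<in> vertices K"
      then have "x \<in> K" "y \<in> K" using vK by auto
      from b(2)[OF this(1)] b(2)[OF this(2)] show "v x - v y \<le> 2 * \<bar>v b\<bar>" by linarith
    qed
    then have "norm (fe_grad v K) \<le> \<bar>v b\<bar> / (c * h)" by simp
    then have "(norm (fe_grad v K))\<^sup>2 \<le> (\<bar>v b\<bar> / (c * h))\<^sup>2" by (rule power_mono) simp
    then have "measure lebesgue K * (norm (fe_grad v K))\<^sup>2 \<le> measure lebesgue K * ((v b)\<^sup>2 / (c * h)\<^sup>2)"
      by (intro mult_left_mono) (auto simp: power_divide)
    also have "\<dots> = (measure lebesgue K * (v b)\<^sup>2) / (c * h)\<^sup>2" by simp
    also have "\<dots> \<le> (4^(CARD('n) + 1) * (LINT x|lebesgue. indicator K x * (v x)\<^sup>2)) / (c * h)\<^sup>2"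
      by (intro divide_right_mono fe_mass_lower[OF v K]) (use b vK in auto)
    finally show "measure lebesgue K * (norm (fe_grad v K))\<^sup>2 \<le> 4^(CARD('n) + 1) / (c * h)\<^sup>2 * (LINT x|lebesgue.
        indicator K x * (v x * v x))"
      by (simp add: power2_eq_square)
  qed
  also have "\<dots> = 4^(CARD('n) + 1) / (c * h)\<^sup>2 * (LINT x|lebesgue. v x * v x)"
    unfolding integral_elements[OF vv] sum_distrib_left ..
  finally show ?thesis .
qed

lemma bounded_weak_pair_bounded: "bounded_weak_pair \<Omega> \<beta> p g \<Longrightarrow> p \<in> bounded_functions"
  unfolding bounded_functions_def bounded_weak_pair_def using closure_subset[of \<Omega>]
  by (auto simp: measurable_completion)

text \<open>\<open>poincare_two_sets\<close> for the element and the averaging ball about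
  \<open>z\<close>, after which \<open>average_variance_le\<close> removes the variable of the ball.
  The volume of the ball appears on both sides and cancels. The centre \<open>a\<close> only
  localises the gradient.\<close>

lemma local_approximation:
  fixes p :: "real^'n \<Rightarrow> real" and g :: "real^'n \<Rightarrow> real^'n"
  assumes pg: "bounded_weak_pair \<Omega> \<beta> p g"
    and K: "K \<in> \<T>" 
    and seg: "\<And>x y t. x \<in> K \<inter> \<Omega> \<Longrightarrow> y \<in> cball z h \<Longrightarrow> t \<in> {0..1} \<Longrightarrow> x + t *\<^sub>R (y - x) \<in> \<Omega> \<inter> cball a (\<Lambda> * h)"
    and D: "\<And>x y. x \<in> K \<inter> \<Omega> \<Longrightarrow> y \<in> cball z h \<Longrightarrow> norm (y - x) \<le> \<Lambda> * h"
  defines "r \<equiv> (LINT y|lborel. indicator (cball z h) y * p y) / (unit_ball_vol (real CARD('n)) * h ^ CARD('n))"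
  shows "(LINT x|lebesgue. indicator K x * (p x - r)\<^sup>2) \<le> (\<Lambda> * h)\<^sup>2 * 2^CARD('n) * (LINT x|lebesgue. indicator
      (cball a (\<Lambda> * h)) x * (norm (g x))\<^sup>2)"
proof -
  note pm = bounded_weak_pairD(1)[OF pg] and pb = bounded_weak_pairD(2)[OF pg] and p0 = bounded_weak_pairD(3)[OF pg]
    and g = bounded_weak_pairD(4)[OF pg] and g2 = bounded_weak_pairD(5)[OF pg] and wg = bounded_weak_pairD(6)[OF pg]
  let ?m = "unit_ball_vol (real CARD('n)) * h ^ CARD('n)"
  let ?A = "K \<inter> \<Omega>" let ?B = "cball z h" let ?W = "cball a (\<Lambda> * h)"
  have m: "?m > 0" using h_pos by simp
  have pmm[measurable]: "p \<in> borel_measurable borel" and gm[measurable]: "g \<in> borel_measurable borel" using pm g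
      by auto
  have Kb[measurable]: "K \<in> sets borel" using element_facts(5)[OF K] by (auto intro: borel_closed compact_imp_closed)
  have Ob[measurable]: "\<Omega> \<in> sets borel" using open_dom by auto
  have pB: "p \<in> bounded_functions" by (rule bounded_weak_pair_bounded[OF pg])
  have p: "integrable lborel p"
    using bounded_functions_integrable[OF pB] pm by (simp add: integrable_completion)
  have eB: "emeasure lborel ?B = ennreal ?m" using emeasure_cball[of h z] h_pos by simp
  \<comment> \<open>An element is no larger than a ball of radius \<open>h\<close>, so one volume
    serves as the bound for both sets.\<close>
  have eA: "emeasure lborel ?A \<le> ennreal ?m"
  proof -
    have "emeasure lborel ?A \<le> emeasure lborel K" by (intro emeasure_mono) auto
    also have "emeasure lborel K = ennreal (measure lebesgue K)"
      using emeasure_bounded_finite[OF compact_imp_bounded[OF element_facts(5)[OF K]]] Kb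
      by (simp add: emeasure_eq_ennreal_measure measure_completion)
    also have "\<dots> \<le> ennreal ?m" by (intro ennreal_leI element_measure_upper K)
    finally show ?thesis .
  qed
  have main: "(\<integral>\<^sup>+x. \<integral>\<^sup>+y. indicator ?A x * indicator ?B y * ennreal ((p x - p y)\<^sup>2) \<partial>lborel \<partial>lborel)
    \<le> ennreal ((\<Lambda> * h)\<^sup>2) * (ennreal ?m * (ennreal (2^CARD('n)) * (\<integral>\<^sup>+x. indicator ?W x * ennreal ((norm (g x))\<^sup>2)
        \<partial>lborel)))"
    by (rule poincare_two_sets[OF p g wg open_dom]) (use eA eB seg D in auto)
  define J where "J = (LINT x|lebesgue. indicator ?W x * (norm (g x))\<^sup>2)"
  have iJ: "integrable lborel (\<lambda>x. indicator ?W x * (norm (g x))\<^sup>2)"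
    using integrable_real_mult_indicator[OF _ g2, of ?W] by (simp add: mult.commute)
  have J: "(\<integral>\<^sup>+x. indicator ?W x * ennreal ((norm (g x))\<^sup>2) \<partial>lborel) = ennreal J"
  proof -
    have "(\<integral>\<^sup>+x. indicator ?W x * ennreal ((norm (g x))\<^sup>2) \<partial>lborel) = (\<integral>\<^sup>+x. ennreal (indicator ?W x * (norm (g x))\<^sup>2)
        \<partial>lborel)"
      by (intro nn_integral_cong) (auto simp: indicator_def)
    also have "\<dots> = ennreal (LINT x|lborel. indicator ?W x * (norm (g x))\<^sup>2)"
      by (rule nn_integral_eq_integral[OF iJ]) auto
    finally show ?thesis by (simp add: J_def integral_completion[OF borel_measurable_integrable[OF iJ]])
  qed
  have J0: "J \<ge> 0" unfolding J_def by (intro integral_nonneg_AE AE_I2) simp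
  define I where "I = (LINT x|lebesgue. indicator K x * (p x - r)\<^sup>2)"
  have I_lb: "I = (LINT x|lborel. indicator ?A x * (p x - r)\<^sup>2)"
  proof -
    have "I = (LINT x|lebesgue. indicator ?A x * (p x - r)\<^sup>2)"
      unfolding I_def
    proof (rule integral_cong_AE)
      show "AE x in lebesgue. indicator K x * (p x - r)\<^sup>2 = indicator ?A x * (p x - r)\<^sup>2"
        using AE_element
      proof eventually_elim
        case (elim x)
        then have "x \<in> K \<longrightarrow> x \<in> \<Omega>" using K by blast
        then show ?case by (simp add: indicator_def)
      qed
      show "(\<lambda>x. indicator K x * (p x - r)\<^sup>2) \<in> borel_measurable lebesgue" by (rule measurable_completion) measurable
      show "(\<lambda>x. indicator ?A x * (p x - r)\<^sup>2) \<in> borel_measurable lebesgue" by (rule measurable_completion) measurable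
    qed
    then show ?thesis by (simp add: integral_completion)
  qed
  have iI: "integrable lborel (\<lambda>x. indicator ?A x * (p x - r)\<^sup>2)"
  proof (rule integrable_bounded_mult)
    show "integrable lborel (\<lambda>x. indicator ?A x :: real)" using eA
        by (auto simp: integrable_indicator_iff intro: le_less_trans)
    have "\<bar>p x - r\<bar> \<le> \<beta> + \<bar>r\<bar>" for x using pb[of x] by linarith
    from power_mono[OF this, of _ 2] show "\<bar>(p x - r)\<^sup>2\<bar> \<le> (\<beta> + \<bar>r\<bar>)\<^sup>2" for x by simp
  qed auto
  have I0: "I \<ge> 0" unfolding I_def by (intro integral_nonneg_AE AE_I2) simp
  have "ennreal ?m * ennreal I = ennreal ?m * (\<integral>\<^sup>+x. ennreal (indicator ?A x * (p x - r)\<^sup>2) \<partial>lborel)"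
    unfolding I_lb by (subst nn_integral_eq_integral[OF iI]) auto
  also have "\<dots> = (\<integral>\<^sup>+x. ennreal ?m * ennreal (indicator ?A x * (p x - r)\<^sup>2) \<partial>lborel)"
    by (rule nn_integral_cmult[symmetric]) simp
  also have "\<dots> \<le> (\<integral>\<^sup>+x. \<integral>\<^sup>+y. indicator ?A x * indicator ?B y * ennreal ((p x - p y)\<^sup>2) \<partial>lborel \<partial>lborel)"
  proof (rule nn_integral_mono)
    fix x
    show "ennreal ?m * ennreal (indicator ?A x * (p x - r)\<^sup>2) \<le> (\<integral>\<^sup>+y. indicator ?A x * indicator ?B y * ennreal
        ((p x - p y)\<^sup>2) \<partial>lborel)"
      using average_variance_le[OF pm pb _ eB m, of "p x"] unfolding r_def by (auto simp: indicator_def)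
  qed
  also note main
  also have "ennreal ((\<Lambda> * h)\<^sup>2) * (ennreal ?m * (ennreal (2^CARD('n)) * (\<integral>\<^sup>+x. indicator ?W x * ennreal
      ((norm (g x))\<^sup>2) \<partial>lborel)))
     = ennreal ((\<Lambda> * h)\<^sup>2 * (?m * (2^CARD('n) * J)))"
    unfolding J using m J0 by (simp add: ennreal_mult)
  finally have "ennreal (?m * I) \<le> ennreal ((\<Lambda> * h)\<^sup>2 * (?m * (2^CARD('n) * J)))"
    using m I0 by (simp add: ennreal_mult)
  then have "?m * I \<le> (\<Lambda> * h)\<^sup>2 * (?m * (2^CARD('n) * J))"
    using m J0 by (subst (asm) ennreal_le_iff) (auto intro!: mult_nonneg_nonneg)
  then have "?m * I \<le> ?m * ((\<Lambda> * h)\<^sup>2 * 2^CARD('n) * J)" by (simp add: mult_ac)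
  then show ?thesis using m unfolding I_def J_def by (simp only: mult_le_cancel_left_pos)
qed

text \<open>If a vertex of \<open>K\<close> lies within \<Lambda> h of \<open>x\<close>, all of
  \<open>K\<close> lies within (\<Lambda> + 1) h of \<open>x\<close>; such elements are counted by
  packing. The local estimates can therefore be summed at a bounded cost.\<close>

lemma overlap_count:
  assumes "\<Lambda> \<ge> 0"
  shows "(\<Sum>K\<in>\<T>. \<Sum>a\<in>vertices K. indicator (cball a (\<Lambda> * h)) x) \<le> real (CARD('n) + 1) * ((\<Lambda> + 1) / c)^CARD('n)"
proof -
  let ?S = "{K\<in>\<T>. K \<subseteq> cball x ((\<Lambda> + 1) * h)}"
  have fS: "finite ?S" using finite_tri by simp
  have "(\<Sum>K\<in>\<T>. \<Sum>a\<in>vertices K. indicator (cball a (\<Lambda> * h)) x :: real)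
      \<le> (\<Sum>K\<in>\<T>. if K \<in> ?S then real (CARD('n) + 1) else 0)"
  proof (rule sum_mono)
    fix K assume K: "K \<in> \<T>"
    show "(\<Sum>a\<in>vertices K. indicator (cball a (\<Lambda> * h)) x) \<le> (if K \<in> ?S then real (CARD('n) + 1) else 0)"
    proof (cases "K \<in> ?S")
      case True
      have "(\<Sum>a\<in>vertices K. indicator (cball a (\<Lambda> * h)) x) \<le> (\<Sum>a\<in>vertices K. 1 :: real)"
        by (rule sum_mono) (simp add: indicator_def)
      then show ?thesis using True element_facts(4)[OF K] by simp
    next
      case False
      have "indicator (cball a (\<Lambda> * h)) x = (0::real)" if a: "a \<in> vertices K" for a
      proof (rule ccontr)
        assume "indicator (cball a (\<Lambda> * h)) x \<noteq> (0::real)"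
        then have ax: "dist a x \<le> \<Lambda> * h" by (auto simp: indicator_def split: if_splits)
        have "K \<subseteq> cball x ((\<Lambda> + 1) * h)"
        proof
          fix y assume "y \<in> K"
          then have "dist a y \<le> h" using element_dist[OF K, of a y] a element_facts(7)[OF K] by (auto simp: dist_norm)
          then show "y \<in> cball x ((\<Lambda> + 1) * h)" using ax dist_triangle[of x y a]
              by (simp add: dist_commute algebra_simps)
        qed
        then show False using False K by simp
      qed
      then show ?thesis using False by simp
    qed
  qed
  also have "\<dots> = real (CARD('n) + 1) * real (card ?S)"
    using finite_tri by (simp add: sum.If_cases Collect_conj_eq[symmetric] Int_def)
  also have "\<dots> \<le> real (CARD('n) + 1) * ((\<Lambda> + 1) / c)^CARD('n)"
  proof (rule mult_left_mono)
    have "real (card ?S) * (c * h) ^ CARD('n) \<le> ((\<Lambda> + 1) * h) ^ CARD('n)"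
      by (rule count_elements[of ?S x]) (use h_pos assms in auto)
    then have "real (card ?S) \<le> ((\<Lambda> + 1) * h) ^ CARD('n) / (c * h) ^ CARD('n)"
      using h_pos c_pos by (simp add: pos_le_divide_eq)
    also have "\<dots> = ((\<Lambda> + 1) / c)^CARD('n)" using h_pos by (simp add: power_divide[symmetric])
    finally show "real (card ?S) \<le> ((\<Lambda> + 1) / c)^CARD('n)" .
  qed simp
  finally show ?thesis .
qed

text \<open>A quasi-interpolant of Clement type. On an element both its error and its gradient are
  controlled by the distances of \<open>p\<close> from the averages at the vertices. In
  \<open>CP\<close>, the factor \<Lambda>^2 2^n comes from the Poincare inequality and the rest from
  the overlap of the balls.\<close>

lemma averaged_interpolant:
  fixes p :: "real^'n \<Rightarrow> real" and g :: "real^'n \<Rightarrow> real^'n"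
  assumes pg: "bounded_weak_pair \<Omega> \<beta> p g"
    and seg: "\<And>K a x y t. K \<in> \<T> \<Longrightarrow> a \<in> vertices K \<Longrightarrow> x \<in> K \<inter> \<Omega> \<Longrightarrow> y \<in> cball (z a) h \<Longrightarrow> t \<in> {0..1} \<Longrightarrow>
        x + t *\<^sub>R (y - x) \<in> \<Omega> \<inter> cball a (\<Lambda> * h)"
    and D: "\<And>K a x y. K \<in> \<T> \<Longrightarrow> a \<in> vertices K \<Longrightarrow> x \<in> K \<inter> \<Omega> \<Longrightarrow> y \<in> cball (z a) h \<Longrightarrow> norm (y - x) \<le> \<Lambda> * h"
    and \<Lambda>: "\<Lambda> \<ge> 0"
  defines "CP \<equiv> \<Lambda>\<^sup>2 * 2^CARD('n) * (real (CARD('n) + 1) * ((\<Lambda> + 1) / c)^CARD('n))"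
  obtains R where "R \<in> fe_space \<Omega> \<T>"
    "(LINT x|lebesgue. (p x - R x)\<^sup>2) \<le> CP * h\<^sup>2 * (LINT x|lebesgue. (norm (g x))\<^sup>2)"
    "(\<Sum>K\<in>\<T>. measure lebesgue K * (norm (fe_grad R K))\<^sup>2) \<le> CP / c\<^sup>2 * (LINT x|lebesgue. (norm (g x))\<^sup>2)"
proof -
  note pm = bounded_weak_pairD(1)[OF pg] and pb = bounded_weak_pairD(2)[OF pg] and g2 = bounded_weak_pairD(5)[OF pg]
  define r where "r a = (LINT y|lborel. indicator (cball (z a) h) y * p y) / (unit_ball_vol (real CARD('n)) * h ^
      CARD('n))" for a
  define R where "R = nodal_interp \<Omega> \<T> r"
  have R: "R \<in> fe_space \<Omega> \<T>" "\<And>a. a \<in> mesh_nodes \<T> \<Longrightarrow> R a = r a" unfolding R_def by (rule nodal_interp)+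
  have pB: "p \<in> bounded_functions" by (rule bounded_weak_pair_bounded[OF pg])
  have pR: "(\<lambda>x. (p x - R x)\<^sup>2) \<in> bounded_functions"
    using bounded_functions_mult[OF bounded_functions_lin bounded_functions_lin, OF pB fe_bounded_functions[OF R(1)]
        pB fe_bounded_functions[OF R(1)]]
    by (simp add: power2_eq_square)
  define E where "E K a = (LINT x|lebesgue. indicator K x * (p x - r a)\<^sup>2)" for K a
  have E0: "E K a \<ge> 0" for K a unfolding E_def by (intro integral_nonneg_AE AE_I2) simp
  define S where "S K = (\<Sum>a\<in>vertices K. E K a)" for K
  have iE: "integrable lebesgue (\<lambda>x. indicator K x * (p x - q)\<^sup>2)" if K: "K \<in> \<T>" for K q
  proof (rule integrable_bounded_mult)
    show "integrable lebesgue (\<lambda>x. indicator K x :: real)" using element_lmeasurable[OF K]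
        by (simp add: lmeasurable_iff_integrable)
    have "\<bar>p x - q\<bar> \<le> \<beta> + \<bar>q\<bar>" for x using pb[of x] by linarith
    from power_mono[OF this, of _ 2] show "\<bar>(p x - q)\<^sup>2\<bar> \<le> (\<beta> + \<bar>q\<bar>)\<^sup>2" for x by simp
    show "(\<lambda>x. (p x - q)\<^sup>2) \<in> borel_measurable lebesgue" using pm by (intro measurable_completion) simp
  qed
  have G2: "integrable lebesgue (\<lambda>x. (norm (g x))\<^sup>2)" using g2 by (simp add: integrable_completion)
  have sumS: "(\<Sum>K\<in>\<T>. S K) \<le> CP * h\<^sup>2 * (LINT x|lebesgue. (norm (g x))\<^sup>2)"
  proof -
    let ?O = "real (CARD('n) + 1) * ((\<Lambda> + 1) / c)^CARD('n)"
    have iW: "integrable lebesgue (\<lambda>x. indicator (cball a (\<Lambda> * h)) x * (norm (g x))\<^sup>2)" for a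
      using integrable_real_mult_indicator[OF _ G2, of "cball a (\<Lambda> * h)"] by (simp add: mult.commute)
    have "(\<Sum>K\<in>\<T>. S K) \<le> (\<Sum>K\<in>\<T>. \<Sum>a\<in>vertices K. (\<Lambda> * h)\<^sup>2 * 2^CARD('n) * (LINT x|lebesgue. indicator (cball a (\<Lambda> * h)) x
        * (norm (g x))\<^sup>2))"
      unfolding S_def E_def r_def
      by (intro sum_mono local_approximation[OF pg]) (use seg D in blast)+
    also have "\<dots> = (\<Lambda> * h)\<^sup>2 * 2^CARD('n) * (\<Sum>K\<in>\<T>. \<Sum>a\<in>vertices K. LINT x|lebesgue. indicator (cball a (\<Lambda> * h)) x *
        (norm (g x))\<^sup>2)"
      by (simp add: sum_distrib_left)
    also have "(\<Sum>K\<in>\<T>. \<Sum>a\<in>vertices K. LINT x|lebesgue. indicator (cball a (\<Lambda> * h)) x * (norm (g x))\<^sup>2)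
       = (LINT x|lebesgue. (\<Sum>K\<in>\<T>. \<Sum>a\<in>vertices K. indicator (cball a (\<Lambda> * h)) x * (norm (g x))\<^sup>2))"
      using iW by (simp add: Bochner_Integration.integral_sum)
    finally have 1: "(\<Sum>K\<in>\<T>. S K) \<le> (\<Lambda> * h)\<^sup>2 * 2^CARD('n) * (LINT x|lebesgue. (\<Sum>K\<in>\<T>. \<Sum>a\<in>vertices K. indicator
        (cball a (\<Lambda> * h)) x * (norm (g x))\<^sup>2))" .
    have "(LINT x|lebesgue. (\<Sum>K\<in>\<T>. \<Sum>a\<in>vertices K. indicator (cball a (\<Lambda> * h)) x * (norm (g x))\<^sup>2))
        \<le> (LINT x|lebesgue. ?O * (norm (g x))\<^sup>2)"
    proof (rule integral_mono)
      show "integrable lebesgue (\<lambda>x. \<Sum>K\<in>\<T>. \<Sum>a\<in>vertices K. indicator (cball a (\<Lambda> * h)) x * (norm (g x))\<^sup>2)"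
        by (intro Bochner_Integration.integrable_sum iW)
      show "integrable lebesgue (\<lambda>x. ?O * (norm (g x))\<^sup>2)" using G2 by simp
      show "(\<Sum>K\<in>\<T>. \<Sum>a\<in>vertices K. indicator (cball a (\<Lambda> * h)) x * (norm (g x))\<^sup>2) \<le> ?O * (norm (g x))\<^sup>2" for x
        using mult_right_mono[OF overlap_count[OF \<Lambda>, of x], of "(norm (g x))\<^sup>2"] by (simp add: sum_distrib_right)
    qed
    then have "(\<Lambda> * h)\<^sup>2 * 2^CARD('n) * (LINT x|lebesgue. (\<Sum>K\<in>\<T>. \<Sum>a\<in>vertices K. indicator (cball a (\<Lambda> * h)) x *
        (norm (g x))\<^sup>2)) 
       \<le> (\<Lambda> * h)\<^sup>2 * 2^CARD('n) * (LINT x|lebesgue. ?O * (norm (g x))\<^sup>2)" by (rule mult_left_mono) simp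
    also have "\<dots> = CP * h\<^sup>2 * (LINT x|lebesgue. (norm (g x))\<^sup>2)"
      by (simp add: CP_def power_mult_distrib mult_ac)
    finally show ?thesis using 1 by linarith
  qed
  have e1: "(LINT x|lebesgue. indicator K x * (p x - R x)\<^sup>2) \<le> S K" if K: "K \<in> \<T>" for K
  proof -
    have "(LINT x|lebesgue. indicator K x * (p x - R x)\<^sup>2) \<le> (LINT x|lebesgue. (\<Sum>a\<in>vertices K. indicator K x *
        (p x - r a)\<^sup>2))"
    proof (rule integral_mono)
      show "integrable lebesgue (\<lambda>x. indicator K x * (p x - R x)\<^sup>2)" by (rule bounded_functions_indicator[OF pR K])
      show "integrable lebesgue (\<lambda>x. \<Sum>a\<in>vertices K. indicator K x * (p x - r a)\<^sup>2)"
        by (intro Bochner_Integration.integrable_sum iE K)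
      show "indicator K x * (p x - R x)\<^sup>2 \<le> (\<Sum>a\<in>vertices K. indicator K x * (p x - r a)\<^sup>2)" for x
      proof (cases "x \<in> K")
        case True
        \<comment> \<open>At fixed \<open>x\<close> every vertex value of \<open>R\<close> is within
          this distance of \<open>p x\<close>, and so is \<open>R x\<close>, since \<open>R\<close>
          lies between its vertex values.\<close>
        let ?s = "sqrt (\<Sum>a\<in>vertices K. (p x - r a)\<^sup>2)"
        have le: "\<bar>p x - R a\<bar> \<le> ?s" if "a \<in> vertices K" for a
        proof -
          have "(p x - r a)\<^sup>2 \<le> (\<Sum>a\<in>vertices K. (p x - r a)\<^sup>2)"
            by (rule member_le_sum[OF that]) (use element_facts(2)[OF K] in auto)
          then show ?thesis using R(2)[OF vertex_node[OF K that]] by (simp add: real_le_rsqrt)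
        qed
        have "R x \<le> p x + ?s" by (rule fe_space_le[OF R(1) K True]) (use le in \<open>force simp: abs_le_iff\<close>)
        moreover have "- R x \<le> ?s - p x"
          by (rule fe_space_le[OF _ K True, of "\<lambda>x. - R x"]) (use le fe_space_lin[OF R(1) R(1), of "-1" 0] in \<open>force
              simp: abs_le_iff\<close>)+
        ultimately have "\<bar>p x - R x\<bar> \<le> ?s" by simp
        then have "\<bar>p x - R x\<bar>\<^sup>2 \<le> ?s\<^sup>2" by (rule power_mono) simp
        then show ?thesis using True by (simp add: sum_nonneg)
      qed simp
    qed
    also have "\<dots> = S K" unfolding S_def E_def by (rule Bochner_Integration.integral_sum) (rule iE[OF K])
    finally show ?thesis .
  qed
  have "(LINT x|lebesgue. (p x - R x)\<^sup>2) = (\<Sum>K\<in>\<T>. LINT x|lebesgue. indicator K x * (p x - R x)\<^sup>2)"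
    by (rule integral_elements[OF pR])
  also have "\<dots> \<le> (\<Sum>K\<in>\<T>. S K)" by (intro sum_mono e1)
  finally have r1: "(LINT x|lebesgue. (p x - R x)\<^sup>2) \<le> CP * h\<^sup>2 * (LINT x|lebesgue. (norm (g x))\<^sup>2)" using sumS
      by linarith
  have e2: "measure lebesgue K * (norm (fe_grad R K))\<^sup>2 \<le> S K / (c * h)\<^sup>2" if K: "K \<in> \<T>" for K
  proof -
    let ?k = "measure lebesgue K"
    have k: "?k > 0" by (rule element_measure_pos[OF K])
    have ch: "c * h > 0" using c_pos h_pos by simp
    have S0: "S K \<ge> 0" unfolding S_def by (intro sum_nonneg E0)
    \<comment> \<open>Averages at two vertices are compared through \<open>p\<close> itself, by
      integrating the constant (r a - r b)^2 over their common element.\<close>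
    have diff: "r a - r b \<le> 2 * sqrt (S K / ?k)" if ab: "a \<in> vertices K" "b \<in> vertices K" for a b
    proof -
      have "?k * (r a - r b)\<^sup>2 = (LINT x|lebesgue. indicator K x * (r a - r b)\<^sup>2)" using element_lmeasurable[OF K]
          by simp
      also have "\<dots> \<le> (LINT x|lebesgue. 2 * (indicator K x * (p x - r a)\<^sup>2) + 2 * (indicator K x * (p x - r b)\<^sup>2))"
      proof (rule integral_mono)
        show "integrable lebesgue (\<lambda>x. indicator K x * (r a - r b)\<^sup>2)"
          using element_lmeasurable[OF K] by (intro integrable_mult_left) (simp add: lmeasurable_iff_integrable)
        show "integrable lebesgue (\<lambda>x. 2 * (indicator K x * (p x - r a)\<^sup>2) + 2 * (indicator K x * (p x - r b)\<^sup>2))"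
          using iE[OF K] by simp
        show "indicator K x * (r a - r b)\<^sup>2 \<le> 2 * (indicator K x * (p x - r a)\<^sup>2) + 2 *
            (indicator K x * (p x - r b)\<^sup>2)" for x
        proof -
          have "0 \<le> ((p x - r a) + (p x - r b))\<^sup>2" by simp
          then have "(r a - r b)\<^sup>2 \<le> 2 * (p x - r a)\<^sup>2 + 2 * (p x - r b)\<^sup>2"
              by (simp add: power2_eq_square algebra_simps)
          then show ?thesis by (simp add: indicator_def)
        qed
      qed
      also have "\<dots> = 2 * E K a + 2 * E K b" unfolding E_def using iE[OF K] by simp
      also have "\<dots> \<le> 4 * S K"
      proof -
        have "E K a \<le> S K" "E K b \<le> S K" unfolding S_def using ab element_facts(2)[OF K] E0
            by (auto intro!: member_le_sum)
        then show ?thesis by simp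
      qed
      finally have "(r a - r b)\<^sup>2 \<le> 4 * (S K / ?k)" using k by (simp add: field_simps)
      then have "r a - r b \<le> sqrt (4 * (S K / ?k))" by (rule real_le_rsqrt)
      also have "\<dots> = 2 * sqrt (S K / ?k)" by (subst real_sqrt_mult) simp
      finally show ?thesis .
    qed
    have "norm (fe_grad R K) \<le> 2 * sqrt (S K / ?k) / (2 * c * h)"
      by (rule fe_grad_bound[OF R(1) K]) (use diff R(2) vertex_node[OF K] in simp)
    then have "norm (fe_grad R K) \<le> sqrt (S K / ?k) / (c * h)" by simp
    then have "(norm (fe_grad R K))\<^sup>2 \<le> (sqrt (S K / ?k) / (c * h))\<^sup>2" by (rule power_mono) simp
    also have "\<dots> = S K / ?k / (c * h)\<^sup>2" using S0 k by (simp add: power_divide)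
    finally have "?k * (norm (fe_grad R K))\<^sup>2 \<le> ?k * (S K / ?k / (c * h)\<^sup>2)" using k by (intro mult_left_mono) auto
    then show ?thesis using k by simp
  qed
  have "(\<Sum>K\<in>\<T>. measure lebesgue K * (norm (fe_grad R K))\<^sup>2) \<le> (\<Sum>K\<in>\<T>. S K / (c * h)\<^sup>2)" by (intro sum_mono e2)
  also have "\<dots> = (\<Sum>K\<in>\<T>. S K) / (c * h)\<^sup>2" by (simp add: sum_divide_distrib)
  also have "\<dots> \<le> (CP * h\<^sup>2 * (LINT x|lebesgue. (norm (g x))\<^sup>2)) / (c * h)\<^sup>2" using sumS
      by (rule divide_right_mono) simp
  also have "\<dots> = CP / c\<^sup>2 * (LINT x|lebesgue. (norm (g x))\<^sup>2)" using h_pos by (simp add: power_mult_distrib)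
  finally show ?thesis using that R(1) r1 by blast
qed

end

section \<open>Norms of finite element functions and Borel representatives\<close>

lemma weak_grad_spec:
  assumes "u \<in> H1_space \<Omega>"
  shows "weak_grad \<Omega> u \<in> L2_space \<Omega>" "is_weak_grad \<Omega> u (weak_grad \<Omega> u)"
proof -
  have "\<exists>g. g \<in> L2_space \<Omega> \<and> is_weak_grad \<Omega> u g" using assms by (auto simp: H1_space_def)
  from someI_ex[OF this] show "weak_grad \<Omega> u \<in> L2_space \<Omega>" "is_weak_grad \<Omega> u (weak_grad \<Omega> u)"
    unfolding weak_grad_def by auto
qed

lemma lebesgue_borel_representative:
  fixes f :: "real^'n \<Rightarrow> real"
  assumes "f \<in> borel_measurable lebesgue"
  obtains f' where "f' \<in> borel_measurable borel" "AE x in lebesgue. f x = f' x"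
proof -
  obtain f' where f': "f' \<in> borel_measurable lborel" "AE x in lborel. f x = f' x"
    using completion_ex_borel_measurable_real[OF assms] by blast
  have "AE x in lebesgue. f x = f' x" using f'(2) by (rule AE_completion)
  then show ?thesis using that f'(1) by simp
qed

lemma norm_vec_square: "(norm (v :: 'a::euclidean_space^'m))\<^sup>2 = (\<Sum>i\<in>UNIV. (norm (v $ i))\<^sup>2)"
  by (simp add: norm_vec_def L2_set_def sum_nonneg)

context fe_mesh
begin

lemma Linf_norm_nonneg:
  assumes "f \<in> borel_measurable (lebesgue_on \<Omega>)"
  shows "0 \<le> Linf_norm \<Omega> f"
proof -
  have "emeasure lebesgue \<Omega> \<noteq> 0"
    using open_not_negligible[OF open_dom nonempty_dom] dom_sets by (auto simp: negligible_iff_null_sets)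
  then have "emeasure (lebesgue_on \<Omega>) (space (lebesgue_on \<Omega>)) \<noteq> 0"
    using dom_sets by (simp add: emeasure_restrict_space)
  from esssup_const[OF this, of 0]
  have "0 = esssup (lebesgue_on \<Omega>) (\<lambda>x. 0)" by simp
  also have "\<dots> \<le> esssup (lebesgue_on \<Omega>) (\<lambda>x. ereal (norm (f x)))"
    by (rule esssup_mono) auto
  finally show ?thesis unfolding Linf_norm_def by (rule real_of_ereal_pos)
qed

lemma Linf_norm_AE:
  assumes "f \<in> Linf_space \<Omega>"
  shows "AE x in lebesgue. x \<in> \<Omega> \<longrightarrow> norm (f x) \<le> Linf_norm \<Omega> f"
proof -
  let ?E = "esssup (lebesgue_on \<Omega>) (\<lambda>x. ereal (norm (f x)))"
  have E: "?E < \<infinity>" using assms by (simp add: Linf_space_def)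
  have "AE x in lebesgue_on \<Omega>. ereal (norm (f x)) \<le> ?E" by (rule esssup_AE)
  then have "AE x in lebesgue_on \<Omega>. norm (f x) \<le> Linf_norm \<Omega> f"
  proof eventually_elim
    case (elim x)
    then show ?case using E unfolding Linf_norm_def by (cases ?E) auto
  qed
  then show ?thesis using dom_sets by (simp add: AE_restrict_space_iff)
qed

lemma Linf_norm_le:
  assumes "f \<in> borel_measurable (lebesgue_on \<Omega>)" "\<And>x. norm (f x) \<le> m"
  shows "Linf_norm \<Omega> f \<le> m" "f \<in> Linf_space \<Omega>"
proof -
  have E: "esssup (lebesgue_on \<Omega>) (\<lambda>x. ereal (norm (f x))) \<le> ereal m"
    by (rule esssup_I) (use assms in auto)
  then show "f \<in> Linf_space \<Omega>" using assms(1) by (auto simp: Linf_space_def intro: le_less_trans)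
  have "0 \<le> m" using assms(2)[of undefined] norm_ge_zero order_trans by blast
  then show "Linf_norm \<Omega> f \<le> m" unfolding Linf_norm_def using E
    by (cases "esssup (lebesgue_on \<Omega>) (\<lambda>x. ereal (norm (f x)))") auto
qed

lemma fe_H1:
  assumes v: "v \<in> fe_space \<Omega> \<T>"
  shows "v \<in> H1_space \<Omega>"
proof -
  have vB: "v \<in> bounded_functions" by (rule fe_bounded_functions[OF v])
  have "v \<in> L2_space \<Omega>"
    unfolding L2_space_iff[OF dom_sets]
  proof
    show "(\<lambda>x. indicator \<Omega> x *\<^sub>R v x) \<in> borel_measurable lebesgue"
      using integrable_dom[OF vB] by auto
    show "integrable lebesgue (\<lambda>x. indicator \<Omega> x * (norm (v x))\<^sup>2)"
      using integrable_dom[OF bounded_functions_mult[OF vB vB]] by (simp add: power2_eq_square)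
  qed
  then show ?thesis using fe_weak_grad[OF v] pw_grad_L2 by (auto simp: H1_space_def)
qed

lemma fe_weak_grad_L2_norm:
  assumes v: "v \<in> fe_space \<Omega> \<T>"
  shows "(L2_norm \<Omega> (weak_grad \<Omega> v))\<^sup>2 = (\<Sum>K\<in>\<T>. measure lebesgue K * (norm (fe_grad v K))\<^sup>2)"
proof -
  note w = weak_grad_spec[OF fe_H1[OF v]]
  have "AE x in lebesgue. x \<in> \<Omega> \<longrightarrow> weak_grad \<Omega> v x = pw_grad v x"
    by (rule weak_grad_unique[OF open_dom bounded_dom w(2) fe_weak_grad[OF v] w(1) pw_grad_L2])
  then have ae: "AE x in lebesgue. indicator \<Omega> x * (norm (weak_grad \<Omega> v x))\<^sup>2
      = indicator \<Omega> x * (norm (pw_grad v x))\<^sup>2"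
    by eventually_elim (simp add: indicator_def)
  have "(L2_norm \<Omega> (weak_grad \<Omega> v))\<^sup>2 = (L2_norm \<Omega> (pw_grad v))\<^sup>2"
    unfolding L2_norm_square[OF dom_sets]
    by (rule integral_cong_AE[OF _ _ ae]) (use w(1) pw_grad_L2[of v] in \<open>auto simp: L2_space_iff[OF dom_sets]\<close>)
  then show ?thesis by (simp add: pw_grad_L2_norm)
qed

lemma fe_weak_grad_vec_L2_norm:
  assumes w: "w \<in> fe_vec_space \<Omega> \<T>"
  shows "(L2_norm \<Omega> (weak_grad_vec \<Omega> w))\<^sup>2 = (\<Sum>i\<in>UNIV. \<Sum>K\<in>\<T>. measure lebesgue K * (norm (fe_grad (\<lambda>x. w x $ i) K))\<^sup>2)"
proof -
  have wi: "(\<lambda>x. w x $ i) \<in> fe_space \<Omega> \<T>" for i using w by (simp add: fe_vec_space_def)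
  have int: "integrable lebesgue (\<lambda>x. indicator \<Omega> x * (norm (weak_grad \<Omega> (\<lambda>y. w y $ i) x))\<^sup>2)" for i
    using weak_grad_spec(1)[OF fe_H1[OF wi]] by (simp add: L2_space_iff[OF dom_sets])
  have "(L2_norm \<Omega> (weak_grad_vec \<Omega> w))\<^sup>2 = (LINT x|lebesgue.
      (\<Sum>i\<in>UNIV. indicator \<Omega> x * (norm (weak_grad \<Omega> (\<lambda>y. w y $ i) x))\<^sup>2))"
    unfolding L2_norm_square[OF dom_sets] norm_vec_square weak_grad_vec_def by (simp add: sum_distrib_left)
  also have "\<dots> = (\<Sum>i\<in>UNIV. LINT x|lebesgue. indicator \<Omega> x * (norm (weak_grad \<Omega> (\<lambda>y. w y $ i) x))\<^sup>2)"
    by (rule Bochner_Integration.integral_sum) (rule int)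
  also have "\<dots> = (\<Sum>i\<in>UNIV. (L2_norm \<Omega> (weak_grad \<Omega> (\<lambda>y. w y $ i)))\<^sup>2)"
    by (simp add: L2_norm_square[OF dom_sets])
  finally show ?thesis by (simp add: fe_weak_grad_L2_norm[OF wi])
qed

text \<open>A Borel version is truncated and cut off outside \<Omega>, so that bound and support
  hold at every point. This changes nothing almost everywhere in \<Omega>, and the weak gradient
  identity survives. The gradient is treated component by component.\<close>

lemma H1_Linf_representative:
  assumes P: "P \<in> H1_space \<Omega> \<inter> Linf_space \<Omega>"
  obtains p g where "bounded_weak_pair \<Omega> (Linf_norm \<Omega> P) p g"
    "(LINT x|lebesgue. (norm (g x))\<^sup>2) = (L2_norm \<Omega> (weak_grad \<Omega> P))\<^sup>2"
    "AE x in lebesgue. x \<in> \<Omega> \<longrightarrow> P x = p x"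
proof -
  let ?\<beta> = "Linf_norm \<Omega> P" let ?G = "weak_grad \<Omega> P"
  have PL: "P \<in> L2_space \<Omega>" and PH: "P \<in> H1_space \<Omega>" and Pi: "P \<in> Linf_space \<Omega>" using P by (auto simp: H1_space_def)
  note G = weak_grad_spec[OF PH]
  have \<beta>0: "?\<beta> \<ge> 0" using Pi by (intro Linf_norm_nonneg) (simp add: Linf_space_def)
  have Ob[measurable]: "\<Omega> \<in> sets borel" using open_dom by auto
  have "(\<lambda>x. indicator \<Omega> x *\<^sub>R P x) \<in> borel_measurable lebesgue" using PL by (simp add: L2_space_iff[OF dom_sets])
  then obtain p0 where p0[measurable]: "p0 \<in> borel_measurable borel" and p0e: "AE x in lebesgue. indicator \<Omega> x *\<^sub>R P x
      = p0 x"
    by (rule lebesgue_borel_representative)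
  \<comment> \<open>Clamping to [-\<beta>, \<beta>] alters \<open>p0\<close> only where the
    essential bound fails.\<close>
  define p where "p x = indicator \<Omega> x * max (- ?\<beta>) (min ?\<beta> (p0 x))" for x
  have pm[measurable]: "p \<in> borel_measurable borel" unfolding p_def by measurable
  have pb: "\<bar>p x\<bar> \<le> ?\<beta>" for x using \<beta>0 by (auto simp: p_def indicator_def)
  have p00: "x \<notin> \<Omega> \<Longrightarrow> p x = 0" for x by (simp add: p_def)
  have pe: "AE x in lebesgue. x \<in> \<Omega> \<longrightarrow> P x = p x"
    using p0e Linf_norm_AE[OF Pi] by eventually_elim (auto simp: p_def)
  have GL: "integrable lebesgue (\<lambda>x. indicator \<Omega> x *\<^sub>R ?G x)" by (rule L2_space_integrable[OF dom_lmeasurable G(1)])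
  have Gim: "(\<lambda>x. indicator \<Omega> x * ?G x $ i) \<in> borel_measurable lebesgue" for i
    using borel_measurable_integrable[OF integrable_inner_left[of "axis i 1" lebesgue "\<lambda>x. indicator \<Omega> x *\<^sub>R ?G x"]]
        GL
    by (simp add: inner_axis)
  have "\<forall>i. \<exists>g0. g0 \<in> borel_measurable borel \<and> (AE x in lebesgue. indicator \<Omega> x * ?G x $ i = g0 x)"
  proof
    fix i
    show "\<exists>g0. g0 \<in> borel_measurable borel \<and> (AE x in lebesgue. indicator \<Omega> x * ?G x $ i = g0 x)"
      by (rule lebesgue_borel_representative[OF Gim[of i]]) blast
  qed
  from choice[OF this] obtain g0 where g0: "\<And>i. g0 i \<in> borel_measurable borel" "\<And>i. AE x in lebesgue. indicator \<Omega> x *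
      ?G x $ i = g0 i x"
    by auto
  define g :: "real^'n \<Rightarrow> real^'n" where "g x = (\<Sum>i\<in>UNIV. g0 i x *\<^sub>R axis i 1)" for x
  have gi: "g x $ i = g0 i x" for x i
    by (simp add: g_def axis_def if_distrib[of "\<lambda>t. _ * t"] cong: if_cong)
  have gm[measurable]: "g \<in> borel_measurable borel" unfolding g_def using g0(1) by measurable
  have "AE x in lebesgue. \<forall>i. indicator \<Omega> x * ?G x $ i = g0 i x"
    using g0(2) by (subst AE_all_countable) auto
  then have ge: "AE x in lebesgue. indicator \<Omega> x *\<^sub>R ?G x = g x"
    by eventually_elim (simp add: vec_eq_iff gi)
  have gml: "g \<in> borel_measurable lebesgue" using gm by (simp add: measurable_completion)
  have gI: "integrable lebesgue g" by (rule integrable_cong_AE_imp[OF GL gml ge])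
  have ge2: "AE x in lebesgue. indicator \<Omega> x * (norm (?G x))\<^sup>2 = (norm (g x))\<^sup>2"
    using ge by eventually_elim (auto simp: indicator_def split: if_splits)
  have G2: "integrable lebesgue (\<lambda>x. indicator \<Omega> x * (norm (?G x))\<^sup>2)" using G(1)
      by (simp add: L2_space_iff[OF dom_sets])
  have g2m: "(\<lambda>x. (norm (g x))\<^sup>2) \<in> borel_measurable lebesgue" using gml by measurable
  have gI2: "integrable lebesgue (\<lambda>x. (norm (g x))\<^sup>2)" by (rule integrable_cong_AE_imp[OF G2 g2m ge2])
  have wg: "(LINT x|lborel. p x * partial_deriv i \<phi> x) = - (LINT x|lborel. g x $ i * \<phi> x)"
      if \<phi>: "\<phi> \<in> test_functions \<Omega>" for \<phi> i
  proof -
    have \<phi>m[measurable]: "\<phi> \<in> borel_measurable borel" by (rule test_functions_measurable[OF \<phi>])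
    have dm[measurable]: "partial_deriv i \<phi> \<in> borel_measurable borel"
      by (rule borel_measurable_continuous_onI[OF test_functions_partial_continuous[OF \<phi>]])
    have lb: "f \<in> borel_measurable borel \<Longrightarrow> f \<in> borel_measurable lebesgue" for f :: "real^'n \<Rightarrow> real"
      by (simp add: measurable_completion)
    have "(LINT x|lborel. p x * partial_deriv i \<phi> x) = (LINT x|lebesgue. p x * partial_deriv i \<phi> x)"
      by (subst integral_completion) auto
    also have "\<dots> = (LINT x|lebesgue. indicator \<Omega> x * P x * partial_deriv i \<phi> x)"
    proof (rule integral_cong_AE)
      show "AE x in lebesgue. p x * partial_deriv i \<phi> x = indicator \<Omega> x * P x * partial_deriv i \<phi> x"
        using pe by eventually_elim (auto simp: p00 indicator_def)
      show "(\<lambda>x. p x * partial_deriv i \<phi> x) \<in> borel_measurable lebesgue" by (rule lb) measurable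
      have "(\<lambda>x. indicator \<Omega> x * P x) \<in> borel_measurable lebesgue" using PL by (simp add: L2_space_iff[OF dom_sets])
      then show "(\<lambda>x. indicator \<Omega> x * P x * partial_deriv i \<phi> x) \<in> borel_measurable lebesgue"
        using lb[OF dm] by (rule borel_measurable_times)
    qed
    also have "\<dots> = (LINT x|lebesgue_on \<Omega>. P x * partial_deriv i \<phi> x)"
      using dom_sets by (subst integral_restrict_space) (auto simp: mult.assoc)
    also have "\<dots> = - (LINT x|lebesgue_on \<Omega>. ?G x $ i * \<phi> x)"
      by (rule G(2)[unfolded is_weak_grad_def, rule_format, OF \<phi>])
    also have "(LINT x|lebesgue_on \<Omega>. ?G x $ i * \<phi> x) = (LINT x|lebesgue. indicator \<Omega> x * ?G x $ i * \<phi> x)"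
      using dom_sets by (subst integral_restrict_space) (auto simp: mult.assoc)
    also have "\<dots> = (LINT x|lebesgue. g x $ i * \<phi> x)"
    proof (rule integral_cong_AE)
      show "AE x in lebesgue. indicator \<Omega> x * ?G x $ i * \<phi> x = g x $ i * \<phi> x"
        using g0(2)[of i] by eventually_elim (simp add: gi)
      show "(\<lambda>x. indicator \<Omega> x * ?G x $ i * \<phi> x) \<in> borel_measurable lebesgue"
        using Gim lb[OF \<phi>m] by (rule borel_measurable_times)
      show "(\<lambda>x. g x $ i * \<phi> x) \<in> borel_measurable lebesgue"
        using lb[OF g0(1)[of i]] lb[OF \<phi>m] unfolding gi by (rule borel_measurable_times)
    qed
    also have "\<dots> = (LINT x|lborel. g x $ i * \<phi> x)"
      unfolding gi using g0(1)[of i] by (subst integral_completion) auto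
    finally show ?thesis .
  qed
  show ?thesis
  proof (rule that[OF _ _ pe])
    show "bounded_weak_pair \<Omega> ?\<beta> p g"
      unfolding bounded_weak_pair_def using pm pb p00 wg gI gI2 gm by (simp add: integrable_completion)
    show "(LINT x|lebesgue. (norm (g x))\<^sup>2) = (L2_norm \<Omega> (weak_grad \<Omega> P))\<^sup>2"
      unfolding L2_norm_square[OF dom_sets]
      by (rule integral_cong_AE[symmetric]) (use ge2 g2m G2 in auto)
  qed
qed

text \<open>Pythagoras. Orthogonality is asked against \<open>r\<close> alone, so the lemma also
  applies to the difference of \<open>r\<close> and a finite element function \<open>R\<close>,
  viewed as the projection of p - R.\<close>

lemma projection_L2_stable:
  assumes r: "r \<in> fe_space \<Omega> \<T>" and p: "p \<in> bounded_functions"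
    and orth: "(LINT x|lebesgue. r x * r x) = (LINT x|lebesgue. r x * p x)"
  shows "(LINT x|lebesgue. r x * r x) \<le> (LINT x|lebesgue. p x * p x)"
proof -
  have rB: "r \<in> bounded_functions" by (rule fe_bounded_functions[OF r])
  note i = bounded_functions_integrable[OF bounded_functions_mult]
  have "(LINT x|lebesgue. (r x - p x) * (r x - p x)) = (LINT x|lebesgue. r x * r x - 2 * (r x * p x) + p x * p x)"
    by (intro Bochner_Integration.integral_cong refl) (simp add: algebra_simps)
  also have "\<dots> = (LINT x|lebesgue. r x * r x) - 2 * (LINT x|lebesgue. r x * p x) + (LINT x|lebesgue. p x * p x)"
    using i[OF rB rB] i[OF rB p] i[OF p p] by simp
  finally have "(LINT x|lebesgue. p x * p x) - (LINT x|lebesgue. r x * r x)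
      = (LINT x|lebesgue. (r x - p x) * (r x - p x))"
    using orth by simp
  also have "\<dots> \<ge> 0" by (intro integral_nonneg_AE AE_I2) simp
  finally show ?thesis by simp
qed

text \<open>The projection reproduces finite element functions, so r - R is the projection of p - R
  and has L2 norm of order \<open>h\<close>. The inverse estimate loses exactly 1/h, and the
  gradient of \<open>R\<close> is bounded already.\<close>

lemma projection_H1_stable_small:
  fixes p :: "real^'n \<Rightarrow> real" and g :: "real^'n \<Rightarrow> real^'n"
  assumes pg: "bounded_weak_pair \<Omega> \<beta> p g"
    and r: "r \<in> fe_space \<Omega> \<T>" and orth: "\<And>q. q \<in> fe_space \<Omega> \<T> \<Longrightarrow> (LINT x|lebesgue. q x * r x)
        = (LINT x|lebesgue. q x * p x)"
    and cone: "uniform_cone \<Omega> d k"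
    and k: "0 < k" "k \<le> 1" and h: "h < k * d / 2"
  defines "\<Lambda> \<equiv> 2 / k + 2"
  defines "CP \<equiv> \<Lambda>\<^sup>2 * 2^CARD('n) * (real (CARD('n) + 1) * ((\<Lambda> + 1) / c)^CARD('n))"
  shows "(\<Sum>K\<in>\<T>. measure lebesgue K * (norm (fe_grad r K))\<^sup>2) \<le> (4^(CARD('n) + 1) + 1) * CP / (2 * c^4) *
      (LINT x|lebesgue. (norm (g x))\<^sup>2)"
proof -
  have "\<forall>a\<in>mesh_nodes \<T>. \<exists>e. norm e = 1 \<and> (\<forall>y\<in>closure \<Omega>. \<forall>t z.
      dist y a < d \<longrightarrow> 0 < t \<longrightarrow> t < d \<longrightarrow> norm z \<le> k \<longrightarrow> y + t *\<^sub>R (e + z) \<in> \<Omega>)"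
    using cone node_in_closure unfolding uniform_cone_def by blast
  then obtain e where "\<forall>a\<in>mesh_nodes \<T>. norm (e a) = 1 \<and> (\<forall>y\<in>closure \<Omega>. \<forall>t z.
      dist y a < d \<longrightarrow> 0 < t \<longrightarrow> t < d \<longrightarrow> norm z \<le> k \<longrightarrow> y + t *\<^sub>R (e a + z) \<in> \<Omega>)"
    unfolding bchoice_iff by blast
  then have e1: "\<And>a. a \<in> mesh_nodes \<T> \<Longrightarrow> norm (e a) = 1"
    and e: "\<And>a y t z. a \<in> mesh_nodes \<T> \<Longrightarrow> y \<in> closure \<Omega> \<Longrightarrow> dist y a < d \<Longrightarrow> 0 < t \<Longrightarrow> t < d \<Longrightarrow> norm z \<le> k \<Longrightarrow>
        y + t *\<^sub>R (e a + z) \<in> \<Omega>"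
    by auto
  \<comment> \<open>Element points are within \<open>h\<close> of \<open>a\<close> and ball points
    within \<open>h\<close> of the ball centre. Together they deviate by 2 h = k s, the opening of
    the cone at distance \<open>s\<close>; the assumption on \<open>h\<close> says s < d.\<close>
  define s where "s = 2 * h / k"
  have s: "s > 0" "s < d" using k h h_pos by (auto simp: s_def field_simps)
  have kd: "k * d / 2 \<le> d" using k s mult_right_mono[of k 1 d] by (simp add: less_imp_le)
  have hd: "h < d" using h kd by linarith
  have \<Lambda>: "\<Lambda> \<ge> 0" "\<Lambda> * h = s + 2 * h" using k h_pos by (auto simp: \<Lambda>_def s_def field_simps)
  define z where "z a = a + s *\<^sub>R e a" for a
  have bnd: "norm (y - a) \<le> s + h" "norm (x - a) \<le> h" "norm (y - x) \<le> \<Lambda> * h"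
    if "K \<in> \<T>" "a \<in> vertices K" "x \<in> K \<inter> \<Omega>" "y \<in> cball (z a) h" for K a x y
  proof -
    have "norm (y - z a) \<le> h" using that(4) by (simp add: dist_norm norm_minus_commute)
    moreover have "norm (s *\<^sub>R e a) = s" using e1[OF vertex_node[OF that(1,2)]] s by simp
    moreover have eq: "y - a = (y - z a) + s *\<^sub>R e a" by (simp add: z_def)
    ultimately show 1: "norm (y - a) \<le> s + h"
      unfolding eq using norm_triangle_ineq[of "y - z a" "s *\<^sub>R e a"] by linarith
    show 2: "norm (x - a) \<le> h" using element_dist[OF that(1), of x a] that element_facts(7)[OF that(1)] by auto
    show "norm (y - x) \<le> \<Lambda> * h" using 1 2 \<Lambda>(2) norm_triangle_ineq4[of "y - a" "x - a"] by simp
  qed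
  obtain R where R: "R \<in> fe_space \<Omega> \<T>"
    "(LINT x|lebesgue. (p x - R x)\<^sup>2) \<le> CP * h\<^sup>2 * (LINT x|lebesgue. (norm (g x))\<^sup>2)"
    "(\<Sum>K\<in>\<T>. measure lebesgue K * (norm (fe_grad R K))\<^sup>2) \<le> CP / c\<^sup>2 * (LINT x|lebesgue. (norm (g x))\<^sup>2)"
    unfolding CP_def
  proof (rule averaged_interpolant[OF pg _ _ \<Lambda>(1)])
    fix K a x y and t :: real
    assume a: "K \<in> \<T>" "a \<in> vertices K" "x \<in> K \<inter> \<Omega>" "y \<in> cball (z a) h"
    show "norm (y - x) \<le> \<Lambda> * h" by (rule bnd[OF a])
    assume t: "t \<in> {0..1}"
    note b = bnd[OF a]
    have "x + t *\<^sub>R (y - x) \<in> \<Omega>"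
    \<comment> \<open>The cone contains only positive steps; at t = 0 the point is \<open>x\<close>
      itself.\<close>
    proof (cases "t = 0")
      case False
      \<comment> \<open>The deviation of y - x from s e(a), relative to \<open>s\<close>: the whole
        segment is a ray of the cone with apex \<open>x\<close>.\<close>
      define \<zeta> where "\<zeta> = (1 / s) *\<^sub>R ((a - x) + (y - z a))"
      have "norm ((a - x) + (y - z a)) \<le> 2 * h"
        using norm_triangle_ineq[of "a - x" "y - z a"] b(2) a(4) by (simp add: dist_norm norm_minus_commute)
      then have "norm \<zeta> \<le> 2 * h / s" using s by (simp add: \<zeta>_def divide_right_mono)
      also have "\<dots> = k" using k h_pos by (simp add: s_def)
      finally have \<zeta>: "norm \<zeta> \<le> k" .
      have ys: "y - x = s *\<^sub>R (e a + \<zeta>)" using s by (simp add: \<zeta>_def z_def scaleR_add_right)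
      have "t * s \<le> 1 * s" using t s by (intro mult_right_mono) auto
      then have "t * s < d" using s(2) by linarith
      moreover have "0 < t * s" using t False s by auto
      moreover have "x \<in> closure \<Omega>" using a(3) closure_subset by blast
      moreover have "dist x a < d" using b(2) hd by (simp add: dist_norm)
      ultimately have "x + (t * s) *\<^sub>R (e a + \<zeta>) \<in> \<Omega>" using e[OF vertex_node[OF a(1,2)]] \<zeta> by blast
      then show ?thesis by (simp add: ys)
    qed (use a in auto)
    moreover have "norm (x + t *\<^sub>R (y - x) - a) \<le> \<Lambda> * h"
    proof -
      have "x + t *\<^sub>R (y - x) - a = (1 - t) *\<^sub>R (x - a) + t *\<^sub>R (y - a)" by (simp add: algebra_simps)
      also have "norm \<dots> \<le> norm ((1 - t) *\<^sub>R (x - a)) + norm (t *\<^sub>R (y - a))" by (rule norm_triangle_ineq)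
      also have "\<dots> \<le> 1 * h + 1 * (s + h)"
      proof (rule add_mono)
        have "(1 - t) * norm (x - a) \<le> 1 * h" using t b(2) h_pos by (intro mult_mono) auto
        then show "norm ((1 - t) *\<^sub>R (x - a)) \<le> 1 * h" using t by simp
        have "t * norm (y - a) \<le> 1 * (s + h)" using t b(1) s h_pos by (intro mult_mono) auto
        then show "norm (t *\<^sub>R (y - a)) \<le> 1 * (s + h)" using t by simp
      qed
      finally show ?thesis using \<Lambda>(2) by simp
    qed
    ultimately show "x + t *\<^sub>R (y - x) \<in> \<Omega> \<inter> cball a (\<Lambda> * h)" by (simp add: dist_norm norm_minus_commute)
  qed
  let ?G = "LINT x|lebesgue. (norm (g x))\<^sup>2"
  have pB: "p \<in> bounded_functions" by (rule bounded_weak_pair_bounded[OF pg])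
  have RB: "R \<in> bounded_functions" by (rule fe_bounded_functions[OF R(1)])
  have rB: "r \<in> bounded_functions" by (rule fe_bounded_functions[OF r])
  note im = bounded_functions_integrable[OF bounded_functions_mult]
  define \<epsilon> where "\<epsilon> x = r x - R x" for x
  have \<epsilon>: "\<epsilon> \<in> fe_space \<Omega> \<T>" unfolding \<epsilon>_def by (rule fe_space_diff[OF r R(1)])
  have \<epsilon>B: "\<epsilon> \<in> bounded_functions" by (rule fe_bounded_functions[OF \<epsilon>])
  have "(LINT x|lebesgue. \<epsilon> x * \<epsilon> x) \<le> (LINT x|lebesgue. (p x - R x) * (p x - R x))"
  proof (rule projection_L2_stable[OF \<epsilon> bounded_functions_lin[OF pB RB]])
    have "(LINT x|lebesgue. \<epsilon> x * \<epsilon> x) = (LINT x|lebesgue. \<epsilon> x * r x - \<epsilon> x * R x)"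
      by (intro Bochner_Integration.integral_cong refl) (simp add: \<epsilon>_def[of x for x] algebra_simps)
    also have "\<dots> = (LINT x|lebesgue. \<epsilon> x * r x) - (LINT x|lebesgue. \<epsilon> x * R x)"
      by (rule Bochner_Integration.integral_diff[OF im[OF \<epsilon>B rB] im[OF \<epsilon>B RB]])
    also have "\<dots> = (LINT x|lebesgue. \<epsilon> x * p x) - (LINT x|lebesgue. \<epsilon> x * R x)" using orth[OF \<epsilon>] by simp
    also have "\<dots> = (LINT x|lebesgue. \<epsilon> x * (p x - R x))"
      using im[OF \<epsilon>B pB] im[OF \<epsilon>B RB] by (simp add: right_diff_distrib)
    finally show "(LINT x|lebesgue. \<epsilon> x * \<epsilon> x) = (LINT x|lebesgue. \<epsilon> x * (p x - R x))" .
  qed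
  also have "\<dots> \<le> CP * h\<^sup>2 * ?G" using R(2) by (simp add: power2_eq_square)
  finally have "4^(CARD('n) + 1) / (c * h)\<^sup>2 * (LINT x|lebesgue. \<epsilon> x * \<epsilon> x) \<le> 4^(CARD('n) + 1) / (c * h)\<^sup>2 *
      (CP * h\<^sup>2 * ?G)"
    by (rule mult_left_mono) simp
  also have "\<dots> = 4^(CARD('n) + 1) * CP / c\<^sup>2 * ?G" using h_pos by (simp add: power_mult_distrib)
  finally have E: "(\<Sum>K\<in>\<T>. measure lebesgue K * (norm (fe_grad \<epsilon> K))\<^sup>2) \<le> 4^(CARD('n) + 1) * CP / c\<^sup>2 * ?G"
    using fe_inverse_estimate[OF \<epsilon>] by linarith
  have "(\<Sum>K\<in>\<T>. measure lebesgue K * (norm (fe_grad r K))\<^sup>2) \<le> (\<Sum>K\<in>\<T>. 1 / (2 * c\<^sup>2) *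
      (measure lebesgue K * (norm (fe_grad \<epsilon> K))\<^sup>2 + measure lebesgue K * (norm (fe_grad R K))\<^sup>2))"
  proof (rule sum_mono)
    fix K assume K: "K \<in> \<T>"
    let ?x = "norm (fe_grad \<epsilon> K)" and ?y = "norm (fe_grad R K)"
    \<comment> \<open>The gradients of r - R and \<open>R\<close> are combined through vertex
      differences, at the price of a factor 1/(2c); squared, it accounts for the c^4 in the
      constant.\<close>
    have "norm (fe_grad r K) \<le> (h * ?x + h * ?y) / (2 * c * h)"
    proof (rule fe_grad_bound[OF r K])
      fix a b assume "a \<in> vertices K" "b \<in> vertices K"
      then have ab: "a \<in> K" "b \<in> K" using element_facts(7)[OF K] by auto
      show "r a - r b \<le> h * ?x + h * ?y"
        using fe_vertex_diff[OF \<epsilon> K ab] fe_vertex_diff[OF R(1) K ab] by (simp add: \<epsilon>_def abs_le_iff)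
    qed
    also have "h * ?x + h * ?y = (?x + ?y) * h" by (simp add: algebra_simps)
    also have "(?x + ?y) * h / (2 * c * h) = (?x + ?y) / (2 * c)" using h_pos by simp
    finally have "(norm (fe_grad r K))\<^sup>2 \<le> ((?x + ?y) / (2 * c))\<^sup>2" by (rule power_mono) simp
    also have "\<dots> \<le> 1 / (2 * c\<^sup>2) * (?x\<^sup>2 + ?y\<^sup>2)"
    proof -
      have "0 \<le> (?x - ?y)\<^sup>2" by simp
      then have "(?x + ?y)\<^sup>2 \<le> 2 * (?x\<^sup>2 + ?y\<^sup>2)" by (simp add: power2_eq_square algebra_simps)
      then have "(?x + ?y)\<^sup>2 / (4 * c\<^sup>2) \<le> 2 * (?x\<^sup>2 + ?y\<^sup>2) / (4 * c\<^sup>2)" by (rule divide_right_mono) simp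
      moreover have "2 * S / (4 * c\<^sup>2) = 1 / (2 * c\<^sup>2) * S" "(S / (2 * c))\<^sup>2 = S\<^sup>2 / (4 * c\<^sup>2)" for S
        by (simp_all add: power_divide power_mult_distrib)
      ultimately show ?thesis by (simp only:)
    qed
    finally have "measure lebesgue K * (norm (fe_grad r K))\<^sup>2 \<le> measure lebesgue K * (1 / (2 * c\<^sup>2) * (?x\<^sup>2 + ?y\<^sup>2))"
      by (rule mult_left_mono) simp
    then show "measure lebesgue K * (norm (fe_grad r K))\<^sup>2 \<le> 1 / (2 * c\<^sup>2) * (measure lebesgue K * ?x\<^sup>2 + measure
        lebesgue K * ?y\<^sup>2)"
      by (simp add: algebra_simps)
  qed
  also have "\<dots> = 1 / (2 * c\<^sup>2) * ((\<Sum>K\<in>\<T>. measure lebesgue K * (norm (fe_grad \<epsilon> K))\<^sup>2) + (\<Sum>K\<in>\<T>. measure lebesgue K *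
      (norm (fe_grad R K))\<^sup>2))"
    by (simp add: sum_distrib_left[symmetric] sum.distrib sum_divide_distrib[symmetric])
  also have "\<dots> \<le> 1 / (2 * c\<^sup>2) * (4^(CARD('n) + 1) * CP / c\<^sup>2 * ?G + CP / c\<^sup>2 * ?G)"
    by (intro mult_left_mono add_mono E R(3)) simp
  also have "\<dots> = (4^(CARD('n) + 1) + 1) * CP / (2 * c^4) * ?G"
    using c_pos by (simp add: field_simps power2_eq_square power4_eq_xxxx)
  finally show ?thesis .
qed

end

section \<open>The inf-sup condition\<close>

text \<open>The two summands under the root belong to the two ranges of the mesh size. The first is
  the constant of \<open>projection_H1_stable_small\<close>; the second is the inverse estimate at
  the threshold h = k d / 2, with \<mu> the volume of \<Omega>.\<close>

definition stability_const :: "nat \<Rightarrow> real \<Rightarrow> real \<Rightarrow> real \<Rightarrow> real \<Rightarrow> real" where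
  "stability_const n c d k \<mu> =
     (let \<Lambda> = 2 / k + 2;
          CP = \<Lambda>\<^sup>2 * 2^n * (real (n + 1) * ((\<Lambda> + 1) / c)^n)
      in sqrt ((4^(n + 1) + 1) * CP / (2 * c^4) + 4^(n + 1) / (c * (k * d / 2))\<^sup>2 * \<mu>))"

text \<open>After the 1, which ensures positivity, the terms bound the part r \<nabla>u of the
  product rule, the part u \<nabla>r, and the sup norm. Absolute values spare a discussion of the
  sign of \<open>projection_const\<close>.\<close>

definition inf_sup_const :: "nat \<Rightarrow> real \<Rightarrow> real \<Rightarrow> real \<Rightarrow> real \<Rightarrow> real" where
  "inf_sup_const n c d k \<mu> =
     1 + \<bar>projection_const n c\<bar> / c + real n * stability_const n c d k \<mu> / c + \<bar>projection_const n c\<bar>"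

lemma stability_const_nonneg: "c > 0 \<Longrightarrow> k > 0 \<Longrightarrow> \<mu> \<ge> 0 \<Longrightarrow> stability_const n c d k \<mu> \<ge> 0"
  unfolding stability_const_def Let_def by (intro real_sqrt_ge_zero add_nonneg_nonneg mult_nonneg_nonneg
      divide_nonneg_nonneg) auto

context fe_mesh
begin

lemma projection_H1_stable:
  fixes p :: "real^'n \<Rightarrow> real" and g :: "real^'n \<Rightarrow> real^'n"
  assumes pg: "bounded_weak_pair \<Omega> \<beta> p g"
    and r: "r \<in> fe_space \<Omega> \<T>" and orth: "\<And>q. q \<in> fe_space \<Omega> \<T> \<Longrightarrow> (LINT x|lebesgue. q x * r x)
        = (LINT x|lebesgue. q x * p x)"
    and cone: "uniform_cone \<Omega> d k"
    and k: "0 < k" "k \<le> 1" and d: "d > 0"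
    and \<gamma>: "(LINT x|lebesgue. (norm (g x))\<^sup>2) = \<gamma>\<^sup>2" "\<gamma> \<ge> 0"
  shows "L2_norm \<Omega> (weak_grad \<Omega> r) \<le> stability_const CARD('n) c d k (measure lebesgue \<Omega>) * (\<gamma> + \<beta>)"
proof -
  note pb = bounded_weak_pairD(2)[OF pg] and p0 = bounded_weak_pairD(3)[OF pg]
  define \<Lambda> where "\<Lambda> = 2 / k + 2"
  define CH where "CH = (4^(CARD('n) + 1) + 1) * (\<Lambda>\<^sup>2 * 2^CARD('n) * (real (CARD('n) + 1) * ((\<Lambda> + 1) / c)^CARD('n))) /
      (2 * c^4)"
  let ?\<mu> = "measure lebesgue \<Omega>"
  define CL where "CL = 4^(CARD('n) + 1) / (c * (k * d / 2))\<^sup>2 * ?\<mu>"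
  have st: "stability_const CARD('n) c d k ?\<mu> = sqrt (CH + CL)"
    by (simp add: stability_const_def CH_def CL_def \<Lambda>_def Let_def)
  have \<Lambda>0: "\<Lambda> \<ge> 0" using k by (simp add: \<Lambda>_def)
  have C0: "CH \<ge> 0" "CL \<ge> 0" using \<Lambda>0 c_pos unfolding CH_def CL_def
    by (intro mult_nonneg_nonneg divide_nonneg_nonneg; simp)+
  have \<beta>0: "\<beta> \<ge> 0" using pb[of 0] by linarith
  have "(L2_norm \<Omega> (weak_grad \<Omega> r))\<^sup>2 \<le> CH * \<gamma>\<^sup>2 + CL * \<beta>\<^sup>2"
  proof (cases "h < k * d / 2")
    case True
    have "(L2_norm \<Omega> (weak_grad \<Omega> r))\<^sup>2 \<le> CH * \<gamma>\<^sup>2"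
      unfolding fe_weak_grad_L2_norm[OF r] CH_def \<Lambda>_def \<gamma>(1)[symmetric]
      by (rule projection_H1_stable_small[OF pg r orth cone k True])
    then show ?thesis using C0 by (simp add: add_increasing2)
  next
    case False
    have pB: "p \<in> bounded_functions" by (rule bounded_weak_pair_bounded[OF pg])
    have "(LINT x|lebesgue. r x * r x) \<le> (LINT x|lebesgue. p x * p x)"
      by (rule projection_L2_stable[OF r pB orth[OF r]])
    also have "\<dots> \<le> (LINT x|lebesgue. indicator \<Omega> x * \<beta>\<^sup>2)"
    proof (rule integral_mono)
      show "integrable lebesgue (\<lambda>x. p x * p x)" by (rule bounded_functions_integrable[OF bounded_functions_mult[OF pB
          pB]])
      show "integrable lebesgue (\<lambda>x. indicator \<Omega> x * \<beta>\<^sup>2)"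
        using dom_lmeasurable by (intro integrable_mult_left) (simp add: lmeasurable_iff_integrable)
      show "p x * p x \<le> indicator \<Omega> x * \<beta>\<^sup>2" for x
        using power_mono[OF pb[of x] abs_ge_zero, of 2] p0[of x] by (cases "x \<in> \<Omega>") (auto simp: power2_eq_square)
    qed
    also have "\<dots> = ?\<mu> * \<beta>\<^sup>2" using dom_lmeasurable by simp
    finally have rr: "(LINT x|lebesgue. r x * r x) \<le> ?\<mu> * \<beta>\<^sup>2" .
    have "c * (k * d / 2) \<le> c * h" using False c_pos by (intro mult_left_mono) auto
    then have "(c * (k * d / 2))\<^sup>2 \<le> (c * h)\<^sup>2" using c_pos k d by (intro power_mono) auto
    then have "4^(CARD('n) + 1) / (c * h)\<^sup>2 \<le> 4^(CARD('n) + 1) / (c * (k * d / 2))\<^sup>2"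
      using c_pos k d h_pos by (intro divide_left_mono) auto
    then have "4^(CARD('n) + 1) / (c * h)\<^sup>2 * (LINT x|lebesgue. r x * r x) \<le> 4^(CARD('n) + 1) / (c * (k * d / 2))\<^sup>2 *
        (?\<mu> * \<beta>\<^sup>2)"
      using rr by (intro mult_mono) (auto intro!: integral_nonneg_AE AE_I2)
    then have "(L2_norm \<Omega> (weak_grad \<Omega> r))\<^sup>2 \<le> CL * \<beta>\<^sup>2"
      using fe_inverse_estimate[OF r] unfolding fe_weak_grad_L2_norm[OF r] CL_def by (simp only: mult.assoc)
    then show ?thesis using C0 by (simp add: add_increasing)
  qed
  also have "\<dots> \<le> CH * (\<gamma> + \<beta>)\<^sup>2 + CL * (\<gamma> + \<beta>)\<^sup>2"
    using C0 \<beta>0 \<gamma>(2) by (intro add_mono mult_left_mono power_mono) auto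
  also have "\<dots> = (sqrt (CH + CL) * (\<gamma> + \<beta>))\<^sup>2" using C0 by (simp add: power_mult_distrib distrib_right)
  finally show ?thesis unfolding st
    by (rule power2_le_imp_le) (use C0 \<beta>0 \<gamma>(2) in auto)
qed

section \<open>Vector fields and the discrete product rule\<close>

lemma fe_vec_norm_le:
  assumes w: "w \<in> fe_vec_space \<Omega> \<T>" and b: "\<And>a. a \<in> mesh_nodes \<T> \<Longrightarrow> norm (w a) \<le> m" and m: "m \<ge> 0"
  shows "norm (w x) \<le> m"
proof (cases "w x = 0")
  case False
  \<comment> \<open>Testing with the direction of \<open>w x\<close> reduces to a scalar function,
    without the loss of a componentwise estimate.\<close>
  let ?e = "sgn (w x)"
  have "(\<lambda>y. \<Sum>i\<in>UNIV. ?e $ i * w y $ i) \<in> fe_space \<Omega> \<T>"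
    using w by (intro fe_space_sum) (auto simp: fe_vec_space_def)
  then have f: "(\<lambda>y. ?e \<bullet> w y) \<in> fe_space \<Omega> \<T>" by (simp add: inner_vec_def)
  have "\<bar>?e \<bullet> w x\<bar> \<le> m"
  proof (rule fe_abs_le[OF f _ m])
    fix a assume a: "a \<in> mesh_nodes \<T>"
    have "\<bar>?e \<bullet> w a\<bar> \<le> norm ?e * norm (w a)" by (rule Cauchy_Schwarz_ineq2)
    also have "\<dots> \<le> m" using b[OF a] False by (simp add: norm_sgn)
    finally show "\<bar>?e \<bullet> w a\<bar> \<le> m" .
  qed
  moreover have "?e \<bullet> w x = norm (w x)" using False
    by (simp add: sgn_div_norm power2_norm_eq_inner[symmetric] power2_eq_square)
  ultimately show ?thesis by simp
qed (use m in simp)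

lemma fe_vec_measurable:
  assumes w: "w \<in> fe_vec_space \<Omega> \<T>"
  shows "w \<in> borel_measurable (lebesgue_on \<Omega>)"
proof -
  have "w = (\<lambda>x. \<Sum>i\<in>UNIV. w x $ i *\<^sub>R axis i 1)"
    by (rule ext) (simp add: vec_eq_iff axis_def if_distrib[of "\<lambda>t. _ * t"] cong: if_cong)
  moreover have "(\<lambda>x. \<Sum>i\<in>UNIV. w x $ i *\<^sub>R (axis i 1 :: real^'n)) \<in> borel_measurable borel"
    using w fe_measurable by (intro borel_measurable_sum borel_measurable_scaleR) (auto simp: fe_vec_space_def)
  ultimately have "w \<in> borel_measurable borel" by simp
  then show ?thesis by (intro measurable_restrict_space1 measurable_completion) simp
qed

text \<open>The product rule for vertex differences: \<open>h\<close> times a gradient bounds a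
  difference, and differences bound the new gradient up to 1/(2 c h), so the powers of
  \<open>h\<close> cancel. Each of the n components of \<open>u\<close> is at most 1 at the nodes,
  whence the factor n.\<close>

lemma fe_product_gradient:
  assumes u: "u \<in> fe_vec_space \<Omega> \<T>" and u1: "\<And>a. a \<in> mesh_nodes \<T> \<Longrightarrow> norm (u a) = 1"
    and r: "r \<in> fe_space \<Omega> \<T>" and rm: "\<And>a. a \<in> mesh_nodes \<T> \<Longrightarrow> \<bar>r a\<bar> \<le> m" and m: "m \<ge> 0"
    and w: "w \<in> fe_vec_space \<Omega> \<T>" and wa: "\<And>a. a \<in> mesh_nodes \<T> \<Longrightarrow> w a = r a *\<^sub>R u a"
  shows "L2_norm \<Omega> (weak_grad_vec \<Omega> w) \<le> (m * L2_norm \<Omega> (weak_grad_vec \<Omega> u) + real CARD('n) * L2_norm \<Omega>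
      (weak_grad \<Omega> r)) / c"
proof -
  let ?U = "L2_norm \<Omega> (weak_grad_vec \<Omega> u)" and ?R = "L2_norm \<Omega> (weak_grad \<Omega> r)"
  have wi: "(\<lambda>x. w x $ i) \<in> fe_space \<Omega> \<T>" for i using w by (simp add: fe_vec_space_def)
  have ui: "(\<lambda>x. u x $ i) \<in> fe_space \<Omega> \<T>" for i using u by (simp add: fe_vec_space_def)
  have "(L2_norm \<Omega> (weak_grad_vec \<Omega> w))\<^sup>2 \<le> (\<Sum>i\<in>UNIV. \<Sum>K\<in>\<T>. 1 / (2 * c\<^sup>2) *
      (m\<^sup>2 * (measure lebesgue K * (norm (fe_grad (\<lambda>x. u x $ i) K))\<^sup>2) + measure lebesgue K *
      (norm (fe_grad r K))\<^sup>2))"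
    unfolding fe_weak_grad_vec_L2_norm[OF w]
  proof (intro sum_mono)
    fix i K assume K: "K \<in> \<T>"
    let ?x = "norm (fe_grad (\<lambda>x. u x $ i) K)" and ?y = "norm (fe_grad r K)"
    have "norm (fe_grad (\<lambda>x. w x $ i) K) \<le> (m * (h * ?x) + h * ?y) / (2 * c * h)"
    proof (rule fe_grad_bound[OF wi K])
      fix a b assume ab: "a \<in> vertices K" "b \<in> vertices K"
      then have abK: "a \<in> K" "b \<in> K" using element_facts(7)[OF K] by auto
      note na = vertex_node[OF K ab(1)] note nb = vertex_node[OF K ab(2)]
      \<comment> \<open>A mixed term is inserted, so that one factor of each product is a nodal
        value with a known bound.\<close>
      have "w a $ i - w b $ i = r a * (u a $ i - u b $ i) + (r a - r b) * u b $ i"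
        by (simp add: wa na nb algebra_simps)
      also have "\<dots> \<le> \<bar>r a\<bar> * \<bar>u a $ i - u b $ i\<bar> + \<bar>r a - r b\<bar> * \<bar>u b $ i\<bar>"
        by (intro add_mono) (simp_all add: abs_mult[symmetric])
      also have "\<dots> \<le> m * (h * ?x) + (h * ?y) * 1"
        using rm[OF na] fe_vertex_diff[OF ui K abK, of i] fe_vertex_diff[OF r K abK] component_le_norm_cart[of
            "u b" i] u1[OF nb] h_pos m
        by (intro add_mono mult_mono) auto
      finally show "w a $ i - w b $ i \<le> m * (h * ?x) + h * ?y" by simp
    qed
    also have "m * (h * ?x) + h * ?y = (m * ?x + ?y) * h" by (simp add: algebra_simps)
    also have "(m * ?x + ?y) * h / (2 * c * h) = (m * ?x + ?y) / (2 * c)" using h_pos by simp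
    finally have "(norm (fe_grad (\<lambda>x. w x $ i) K))\<^sup>2 \<le> ((m * ?x + ?y) / (2 * c))\<^sup>2" by (rule power_mono) simp
    also have "\<dots> \<le> 1 / (2 * c\<^sup>2) * (m\<^sup>2 * ?x\<^sup>2 + ?y\<^sup>2)"
    proof -
      have "0 \<le> (m * ?x - ?y)\<^sup>2" by simp
      then have "(m * ?x + ?y)\<^sup>2 \<le> 2 * (m\<^sup>2 * ?x\<^sup>2 + ?y\<^sup>2)" by (simp add: power2_eq_square algebra_simps)
      then have "(m * ?x + ?y)\<^sup>2 / (4 * c\<^sup>2) \<le> 2 * (m\<^sup>2 * ?x\<^sup>2 + ?y\<^sup>2) / (4 * c\<^sup>2)" by (rule divide_right_mono) simp
      moreover have "2 * S / (4 * c\<^sup>2) = 1 / (2 * c\<^sup>2) * S" "(S / (2 * c))\<^sup>2 = S\<^sup>2 / (4 * c\<^sup>2)" for S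
        by (simp_all add: power_divide power_mult_distrib)
      ultimately show ?thesis by (simp only:)
    qed
    finally have "measure lebesgue K * (norm (fe_grad (\<lambda>x. w x $ i) K))\<^sup>2
        \<le> measure lebesgue K * (1 / (2 * c\<^sup>2) * (m\<^sup>2 * ?x\<^sup>2 + ?y\<^sup>2))"
      by (rule mult_left_mono) simp
    then show "measure lebesgue K * (norm (fe_grad (\<lambda>x. w x $ i) K))\<^sup>2
        \<le> 1 / (2 * c\<^sup>2) * (m\<^sup>2 * (measure lebesgue K * ?x\<^sup>2) + measure lebesgue K * ?y\<^sup>2)"
      by (simp add: algebra_simps)
  qed
  also have "\<dots> = 1 / (2 * c\<^sup>2) * (m\<^sup>2 * ?U\<^sup>2 + real CARD('n) * ?R\<^sup>2)"
    unfolding fe_weak_grad_vec_L2_norm[OF u] fe_weak_grad_L2_norm[OF r]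
    by (simp add: sum_distrib_left[symmetric] sum.distrib sum_divide_distrib[symmetric])
  also have "\<dots> \<le> 1 / c\<^sup>2 * (m * ?U + real CARD('n) * ?R)\<^sup>2"
  proof -
    have U0: "?U \<ge> 0" "?R \<ge> 0" by (rule L2_norm_nonneg)+
    \<comment> \<open>Enlarging n to n^2 completes the square.\<close>
    have n1: "real CARD('n) \<le> real CARD('n) * real CARD('n)" by simp
    have "m\<^sup>2 * ?U\<^sup>2 + real CARD('n) * ?R\<^sup>2 \<le> m\<^sup>2 * ?U\<^sup>2 + (real CARD('n) * real CARD('n)) * ?R\<^sup>2"
      by (intro add_left_mono mult_right_mono n1) simp
    also have "\<dots> \<le> (m * ?U + real CARD('n) * ?R)\<^sup>2"
    proof -
      have "0 \<le> 2 * (m * ?U) * (real CARD('n) * ?R)" using U0 m by simp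
      then show ?thesis by (simp add: power2_eq_square algebra_simps)
    qed
    finally have "1 / (2 * c\<^sup>2) * (m\<^sup>2 * ?U\<^sup>2 + real CARD('n) * ?R\<^sup>2) \<le> 1 / c\<^sup>2 * (m * ?U + real CARD('n) * ?R)\<^sup>2"
      using c_pos by (intro mult_mono) (auto simp: field_simps)
    then show ?thesis .
  qed
  also have "\<dots> = ((m * ?U + real CARD('n) * ?R) / c)\<^sup>2" by (simp add: power_divide)
  finally show ?thesis
    by (rule power2_le_imp_le) (use m c_pos L2_norm_nonneg[of \<Omega> "weak_grad_vec \<Omega> u"] L2_norm_nonneg[of \<Omega> "weak_grad \<Omega>
        r"] in \<open>auto intro!: divide_nonneg_nonneg add_nonneg_nonneg mult_nonneg_nonneg\<close>)
qed

lemma competitor_transfer: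
  fixes d k :: real
  assumes u: "u \<in> fe_vec_space \<Omega> \<T>" and u1: "\<And>a. a \<in> mesh_nodes \<T> \<Longrightarrow> norm (u a) = 1"
    and P: "P \<in> H1_space \<Omega> \<inter> Linf_space \<Omega>"
    and cone: "uniform_cone \<Omega> d k"
    and k: "0 < k" "k \<le> 1" and d: "d > 0"
  obtains w where "w \<in> fe_vec_space \<Omega> \<T>"
    "\<And>q. q \<in> fe_space \<Omega> \<T> \<Longrightarrow> L2_inner \<Omega> q (nodal_interp \<Omega> \<T> (\<lambda>x. u x \<bullet> w x)) = L2_inner \<Omega> q P"
    "L2_norm \<Omega> (weak_grad_vec \<Omega> w) + Linf_norm \<Omega> w
       \<le> inf_sup_const CARD('n) c d k (measure lebesgue \<Omega>) * (1 + L2_norm \<Omega> (weak_grad_vec \<Omega> u)) *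
         (L2_norm \<Omega> (weak_grad \<Omega> P) + Linf_norm \<Omega> P)"
proof -
  let ?\<beta> = "Linf_norm \<Omega> P" and ?\<gamma> = "L2_norm \<Omega> (weak_grad \<Omega> P)" and ?U = "L2_norm \<Omega> (weak_grad_vec \<Omega> u)"
  let ?Cs = "stability_const CARD('n) c d k (measure lebesgue \<Omega>)"
  let ?Cp = "\<bar>projection_const CARD('n) c\<bar>"
  obtain p g where pg: "bounded_weak_pair \<Omega> ?\<beta> p g"
    and gn: "(LINT x|lebesgue. (norm (g x))\<^sup>2) = ?\<gamma>\<^sup>2"
    and pe: "AE x in lebesgue. x \<in> \<Omega> \<longrightarrow> P x = p x"
    by (rule H1_Linf_representative[OF P]) (rule that)
  note pb = bounded_weak_pairD(2)[OF pg] and p0 = bounded_weak_pairD(3)[OF pg]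
  have pB: "p \<in> bounded_functions" by (rule bounded_weak_pair_bounded[OF pg])
  obtain r where r: "r \<in> fe_space \<Omega> \<T>" and orth: "\<And>q. q \<in> fe_space \<Omega> \<T> \<Longrightarrow> (LINT x|lebesgue. q x * r x)
      = (LINT x|lebesgue. q x * p x)"
    and rn: "\<And>a. a \<in> mesh_nodes \<T> \<Longrightarrow> \<bar>r a\<bar> \<le> ?\<beta> * projection_const CARD('n) c"
    by (rule L2_projection[OF pB pb]) (rule that)
  have \<beta>0: "?\<beta> \<ge> 0" using pb[of 0] by linarith
  define m where "m = ?\<beta> * ?Cp"
  have m: "m \<ge> 0" using \<beta>0 by (simp add: m_def)
  have rm: "\<bar>r a\<bar> \<le> m" if "a \<in> mesh_nodes \<T>" for a
    using rn[OF that] mult_left_mono[OF abs_ge_self[of "projection_const CARD('n) c"] \<beta>0] by (simp add: m_def)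
  \<comment> \<open>The product r u itself is piecewise quadratic, so it is interpolated in each
    component.\<close>
  define w :: "real^'n \<Rightarrow> real^'n" where "w x = (\<chi> i. nodal_interp \<Omega> \<T> (\<lambda>a. r a * u a $ i) x)" for x
  have w: "w \<in> fe_vec_space \<Omega> \<T>" by (simp add: fe_vec_space_def w_def nodal_interp)
  have wa: "w a = r a *\<^sub>R u a" if "a \<in> mesh_nodes \<T>" for a
    using that by (simp add: w_def vec_eq_iff nodal_interp)
  have ir: "nodal_interp \<Omega> \<T> (\<lambda>x. u x \<bullet> w x) = r"
  proof (rule nodal_interp_eq[OF r])
    fix a assume a: "a \<in> mesh_nodes \<T>"
    show "r a = u a \<bullet> w a" unfolding wa[OF a] using u1[OF a] by (simp add: power2_norm_eq_inner[symmetric])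
  qed
  have R: "L2_norm \<Omega> (weak_grad \<Omega> r) \<le> ?Cs * (?\<gamma> + ?\<beta>)"
    by (rule projection_H1_stable[OF pg r orth cone k d gn L2_norm_nonneg])
  have W: "L2_norm \<Omega> (weak_grad_vec \<Omega> w) \<le> (m * ?U + real CARD('n) * L2_norm \<Omega> (weak_grad \<Omega> r)) / c"
    by (rule fe_product_gradient[OF u u1 r rm m w wa])
  have Wi: "Linf_norm \<Omega> w \<le> m"
  proof (rule Linf_norm_le(1)[OF fe_vec_measurable[OF w]])
    show "norm (w x) \<le> m" for x
      by (rule fe_vec_norm_le[OF w _ m]) (simp add: wa u1 rm)
  qed
  show ?thesis
  proof (rule that[OF w])
    fix q assume q: "q \<in> fe_space \<Omega> \<T>"
    have qB: "q \<in> bounded_functions" by (rule fe_bounded_functions[OF q])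
    have PL: "P \<in> L2_space \<Omega>" using P by (auto simp: H1_space_def)
    have qm: "q \<in> borel_measurable lebesgue" using fe_measurable[OF q] by (simp add: measurable_completion)
    have "L2_inner \<Omega> q P = (LINT x|lebesgue. q x * p x)"
      unfolding L2_inner_indicator[OF dom_sets]
    proof (rule integral_cong_AE)
      have "(\<lambda>x. q x * (indicator \<Omega> x * P x)) \<in> borel_measurable lebesgue"
        using PL by (intro borel_measurable_times[OF qm]) (simp add: L2_space_iff[OF dom_sets])
      then show "(\<lambda>x. indicator \<Omega> x * (q x \<bullet> P x)) \<in> borel_measurable lebesgue" by (simp add: mult_ac)
      show "(\<lambda>x. q x * p x) \<in> borel_measurable lebesgue"
        using bounded_functions_integrable[OF bounded_functions_mult[OF qB pB]] by auto
      show "AE x in lebesgue. indicator \<Omega> x * (q x \<bullet> P x) = q x * p x"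
        using pe by eventually_elim (auto simp: p0 indicator_def)
    qed
    also have "\<dots> = L2_inner \<Omega> q r"
      using orth[OF q] L2_inner_eq[OF qB fe_bounded_functions[OF r]] by simp
    finally show "L2_inner \<Omega> q (nodal_interp \<Omega> \<T> (\<lambda>x. u x \<bullet> w x)) = L2_inner \<Omega> q P" unfolding ir by simp
  next
    have U0: "?U \<ge> 0" and \<gamma>0: "?\<gamma> \<ge> 0" by (rule L2_norm_nonneg)+
    have Cs: "?Cs \<ge> 0" using c_pos k by (intro stability_const_nonneg) auto
    let ?S = "?\<gamma> + ?\<beta>"
    have mS: "m \<le> ?Cp * ?S" unfolding m_def using \<gamma>0 \<beta>0 by (simp add: algebra_simps)
    have "(m * ?U + real CARD('n) * L2_norm \<Omega> (weak_grad \<Omega> r)) / c + m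
        \<le> ((?Cp * ?S) * ?U + real CARD('n) * (?Cs * ?S)) / c + ?Cp * ?S"
      using mS R U0 c_pos by (intro add_mono divide_right_mono mult_right_mono mult_left_mono) auto
    also have "\<dots> = (?Cp / c * ?U + real CARD('n) * ?Cs / c + ?Cp) * ?S"
    proof -
      have "((a * S) * U + n * (b * S)) / c + a * S = (a / c * U + n * b / c + a) * S" for a b n S U :: real
        by (simp add: add_divide_distrib algebra_simps)
      then show ?thesis by this
    qed
    also have "\<dots> \<le> (inf_sup_const CARD('n) c d k (measure lebesgue \<Omega>) * (1 + ?U)) * ?S"
    proof (rule mult_right_mono)
      \<comment> \<open>Terms without \<parallel>\<nabla>u\<parallel> are enlarged by the factor 1 +
        \<parallel>\<nabla>u\<parallel>, so that one constant can be taken out.\<close>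
      have "?Cp / c * ?U + real CARD('n) * ?Cs / c + ?Cp \<le> ?Cp / c * (1 + ?U) + real CARD('n) * ?Cs / c * (1 + ?U) +
          ?Cp * (1 + ?U) + 1 * (1 + ?U)"
      proof -
        have "0 \<le> ?Cp / c" "0 \<le> real CARD('n) * ?Cs / c * ?U" "0 \<le> ?Cp * ?U" using c_pos Cs U0 by auto
        then show ?thesis using U0 by (simp add: distrib_left)
      qed
      also have "\<dots> = inf_sup_const CARD('n) c d k (measure lebesgue \<Omega>) * (1 + ?U)"
        by (simp only: inf_sup_const_def distrib_right)
      finally show "?Cp / c * ?U + real CARD('n) * ?Cs / c + ?Cp \<le> inf_sup_const CARD('n) c d k (measure lebesgue \<Omega>) *
          (1 + ?U)" .
      show "0 \<le> ?S" using \<gamma>0 \<beta>0 by simp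
    qed
    finally show "L2_norm \<Omega> (weak_grad_vec \<Omega> w) + Linf_norm \<Omega> w \<le> inf_sup_const CARD('n) c d k (measure lebesgue \<Omega>) *
        (1 + ?U) * ?S"
      using W Wi by linarith
  qed
qed

text \<open>In \<open>ereal\<close> a dual norm of 0 or \<infinity> would turn the quotient into a
  default value. It is finite, because the product with \<open>p\<close> is at most sup
  \<bar>q\<bar> times the volume times the sup norm of \<open>p\<close>, and positive, because
  \<open>q\<close> is its own competitor.\<close>

lemma dual_norm_fe:
  assumes q: "q \<in> fe_space \<Omega> \<T>" "q \<noteq> (\<lambda>_. 0)"
  obtains D where "dual_norm \<Omega> q = ereal D" "D > 0"
proof -
  let ?Q = "{p \<in> H1_space \<Omega> \<inter> Linf_space \<Omega>. \<not> (AE x in lebesgue_on \<Omega>. p x = 0)}"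
  let ?F = "\<lambda>p. L2_inner \<Omega> q p / (L2_norm \<Omega> (weak_grad \<Omega> p) + Linf_norm \<Omega> p)"
  have qB: "q \<in> bounded_functions" by (rule fe_bounded_functions[OF q(1)])
  obtain M where M: "M \<ge> 0" "\<And>x. \<bar>q x\<bar> \<le> M" using fe_bounded[OF q(1)] by blast
  have qm: "q \<in> borel_measurable (lebesgue_on \<Omega>)"
    using fe_measurable[OF q(1)] by (intro measurable_restrict_space1 measurable_completion) simp
  let ?\<mu> = "measure lebesgue \<Omega>"
  have up: "?F p \<le> M * ?\<mu>" if p: "p \<in> ?Q" for p
  proof -
    let ?\<beta> = "Linf_norm \<Omega> p" and ?\<gamma> = "L2_norm \<Omega> (weak_grad \<Omega> p)"
    have pL: "p \<in> Linf_space \<Omega>" using p by auto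
    have \<beta>0: "?\<beta> \<ge> 0" using pL by (intro Linf_norm_nonneg) (simp add: Linf_space_def)
    have \<gamma>0: "?\<gamma> \<ge> 0" by (rule L2_norm_nonneg)
    have "L2_inner \<Omega> q p \<le> (LINT x|lebesgue. indicator \<Omega> x * (M * ?\<beta>))"
    proof (cases "integrable lebesgue (\<lambda>x. indicator \<Omega> x * (q x \<bullet> p x))")
      case True
      show ?thesis unfolding L2_inner_indicator[OF dom_sets]
      proof (rule integral_mono_AE[OF True])
        show "integrable lebesgue (\<lambda>x. indicator \<Omega> x * (M * ?\<beta>))"
          using dom_lmeasurable by (intro integrable_mult_left) (simp add: lmeasurable_iff_integrable)
        show "AE x in lebesgue. indicator \<Omega> x * (q x \<bullet> p x) \<le> indicator \<Omega> x * (M * ?\<beta>)"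
          using Linf_norm_AE[OF pL]
        proof eventually_elim
          case (elim x)
          show ?case
          proof (cases "x \<in> \<Omega>")
            case True
            have "q x * p x \<le> \<bar>q x\<bar> * \<bar>p x\<bar>" by (simp add: abs_mult[symmetric])
            also have "\<dots> \<le> M * ?\<beta>" using elim True M by (intro mult_mono) auto
            finally show ?thesis using True by simp
          qed simp
        qed
      qed
    next
      \<comment> \<open>The integral is then 0 by convention, below the nonnegative bound.\<close>
      case False
      then show ?thesis unfolding L2_inner_indicator[OF dom_sets] using M \<beta>0
        by (simp add: not_integrable_integral_eq)
    qed
    also have "\<dots> = M * ?\<mu> * ?\<beta>" using dom_lmeasurable by simp
    also have "\<dots> \<le> M * ?\<mu> * (?\<gamma> + ?\<beta>)" using M \<gamma>0 by (intro mult_left_mono) auto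
    finally have "L2_inner \<Omega> q p \<le> M * ?\<mu> * (?\<gamma> + ?\<beta>)" .
    then show ?thesis using M \<beta>0 \<gamma>0 by (cases "?\<gamma> + ?\<beta> = 0") (auto simp: pos_divide_le_eq)
  qed
  have qq: "L2_inner \<Omega> q q > 0"
  proof -
    have "\<exists>a\<in>mesh_nodes \<T>. q a \<noteq> 0" using q fe_space_eqI[OF q(1) fe_space_zero] by auto
    then obtain a where a: "a \<in> mesh_nodes \<T>" "q a \<noteq> 0" by blast
    have "0 < (q a)\<^sup>2" using a by simp
    also have "\<dots> \<le> (\<Sum>a\<in>mesh_nodes \<T>. (q a)\<^sup>2)" by (rule member_le_sum[OF a(1)]) (auto simp: finite_nodes)
    finally have s: "0 < (\<Sum>a\<in>mesh_nodes \<T>. (q a)\<^sup>2)" .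
    have "0 < unit_ball_vol (real CARD('n)) * (c * h)^CARD('n) / (real (CARD('n) + 1) * 4^(CARD('n)+1)) *
        (\<Sum>a\<in>mesh_nodes \<T>. (q a)\<^sup>2)"
      using c_pos h_pos by (intro mult_pos_pos divide_pos_pos s) auto
    then show ?thesis using mass_lower[OF q(1)] by (simp add: L2_inner_eq[OF qB qB])
  qed
  have qLi: "q \<in> Linf_space \<Omega>" by (rule Linf_norm_le(2)[OF qm]) (use M in auto)
  have nz: "\<not> (AE x in lebesgue_on \<Omega>. q x = 0)"
  proof
    assume "AE x in lebesgue_on \<Omega>. q x = 0"
    then have "AE x in lebesgue_on \<Omega>. q x \<bullet> q x = 0" by eventually_elim simp
    then have "L2_inner \<Omega> q q = 0" unfolding L2_inner_def by (rule integral_eq_zero_AE)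
    then show False using qq by simp
  qed
  have qQ: "q \<in> ?Q" using fe_H1[OF q(1)] qLi nz by simp
  have "?F q > 0"
  proof -
    have b0: "Linf_norm \<Omega> q \<ge> 0" by (rule Linf_norm_nonneg[OF qm])
    have "Linf_norm \<Omega> q \<noteq> 0"
    proof
      assume z: "Linf_norm \<Omega> q = 0"
      have "AE x in lebesgue. x \<in> \<Omega> \<longrightarrow> q x = 0" using Linf_norm_AE[OF qLi] by eventually_elim (simp add: z)
      then show False using nz dom_sets by (simp add: AE_restrict_space_iff)
    qed
    then show ?thesis using b0 qq L2_norm_nonneg[of \<Omega> "weak_grad \<Omega> q"] by (intro divide_pos_pos) auto
  qed
  moreover have "ereal (?F q) \<le> dual_norm \<Omega> q" unfolding dual_norm_def by (rule SUP_upper[OF qQ])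
  moreover have "dual_norm \<Omega> q \<le> ereal (M * ?\<mu>)" unfolding dual_norm_def by (rule SUP_least) (use up in simp)
  ultimately show ?thesis using that by (cases "dual_norm \<Omega> q") auto
qed

text \<open>A competitor \<open>P\<close> that reaches the fraction \<theta> of the dual norm is
  transferred to a field \<open>w\<close> with the same numerator and a norm larger by at most the
  constant times 1 + \<parallel>\<nabla>u\<parallel>. This gives the bound times \<theta>, for every
  \<theta> < 1.\<close>

theorem inf_sup_condition:
  fixes d k :: real
  assumes u: "u \<in> fe_vec_space \<Omega> \<T>" and u1: "\<And>a. a \<in> mesh_nodes \<T> \<Longrightarrow> norm (u a) = 1"
    and cone: "uniform_cone \<Omega> d k"
    and k: "0 < k" "k \<le> 1" and d: "d > 0"
    and q: "q \<in> fe_space \<Omega> \<T>" "q \<noteq> (\<lambda>_. 0)"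
  shows "ereal (1 / inf_sup_const CARD('n) c d k (measure lebesgue \<Omega>) / (1 + L2_norm \<Omega> (weak_grad_vec \<Omega> u)))
    \<le> (SUP w \<in> fe_vec_space \<Omega> \<T> - {\<lambda>_. 0}.
         ereal (L2_inner \<Omega> q (nodal_interp \<Omega> \<T> (\<lambda>x. u x \<bullet> w x)))
           / (dual_norm \<Omega> q * ereal (L2_norm \<Omega> (weak_grad_vec \<Omega> w) + Linf_norm \<Omega> w)))"
    (is "ereal ?A \<le> ?S")
proof -
  let ?C = "inf_sup_const CARD('n) c d k (measure lebesgue \<Omega>)" and ?U = "L2_norm \<Omega> (weak_grad_vec \<Omega> u)"
  have C: "?C > 0" unfolding inf_sup_const_def using c_pos k stability_const_nonneg[of c k "measure lebesgue \<Omega>"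
      "CARD('n)" d]
    by (intro add_pos_nonneg) auto
  have U0: "?U \<ge> 0" by (rule L2_norm_nonneg)
  obtain D where D: "dual_norm \<Omega> q = ereal D" "D > 0" using dual_norm_fe[OF q] by blast
  have A: "?A > 0" using C U0 by (intro divide_pos_pos) auto
  have key: "ereal (\<theta> * ?A) \<le> ?S" if \<theta>: "0 < \<theta>" "\<theta> < 1" for \<theta>
  proof -
    have "ereal (\<theta> * D) < dual_norm \<Omega> q" using D \<theta> by simp
    then obtain P where P: "P \<in> H1_space \<Omega> \<inter> Linf_space \<Omega>" 
      "\<theta> * D < L2_inner \<Omega> q P / (L2_norm \<Omega> (weak_grad \<Omega> P) + Linf_norm \<Omega> P)"
      unfolding dual_norm_def less_SUP_iff by auto
    let ?SP = "L2_norm \<Omega> (weak_grad \<Omega> P) + Linf_norm \<Omega> P"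
    have "Linf_norm \<Omega> P \<ge> 0" using P by (intro Linf_norm_nonneg) (simp add: Linf_space_def)
    then have SP0: "?SP \<ge> 0" using L2_norm_nonneg[of \<Omega> "weak_grad \<Omega> P"] by simp
    have pos: "0 < L2_inner \<Omega> q P / ?SP" using P(2) D(2) \<theta>(1) by (meson less_trans mult_pos_pos)
    then have SP: "?SP > 0" using SP0 by (cases "?SP = 0") auto
    have qP: "L2_inner \<Omega> q P > \<theta> * D * ?SP" using P(2) SP by (simp add: pos_less_divide_eq)
    obtain w where w: "w \<in> fe_vec_space \<Omega> \<T>"
      and wq: "\<And>q. q \<in> fe_space \<Omega> \<T> \<Longrightarrow> L2_inner \<Omega> q (nodal_interp \<Omega> \<T> (\<lambda>x. u x \<bullet> w x)) = L2_inner \<Omega> q P"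
      and wn: "L2_norm \<Omega> (weak_grad_vec \<Omega> w) + Linf_norm \<Omega> w \<le> ?C * (1 + ?U) * ?SP"
      by (rule competitor_transfer[OF u u1 P(1) cone k d]) (assumption, rule that)
    let ?N = "L2_norm \<Omega> (weak_grad_vec \<Omega> w) + Linf_norm \<Omega> w"
    have "w \<noteq> (\<lambda>_. 0)"
    proof
      assume w0: "w = (\<lambda>_. 0)"
      have "nodal_interp \<Omega> \<T> (\<lambda>x. u x \<bullet> w x) = (\<lambda>_. 0)"
        by (rule nodal_interp_eq[OF fe_space_zero]) (simp add: w0)
      then have "L2_inner \<Omega> q P = 0" using wq[OF q(1)] by (simp add: L2_inner_def)
      then show False using pos by simp
    qed
    then have "ereal (L2_inner \<Omega> q (nodal_interp \<Omega> \<T> (\<lambda>x. u x \<bullet> w x))) / (dual_norm \<Omega> q * ereal ?N) \<le> ?S"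
      using w by (intro SUP_upper) auto
    then have le: "ereal (L2_inner \<Omega> q P) / ereal (D * ?N) \<le> ?S" unfolding wq[OF q(1)] D(1) by simp
    have "Linf_norm \<Omega> w \<ge> 0" by (rule Linf_norm_nonneg[OF fe_vec_measurable[OF w]])
    then have N0: "?N \<ge> 0" using L2_norm_nonneg[of \<Omega> "weak_grad_vec \<Omega> w"] by simp
    show ?thesis
    proof (cases "?N = 0")
      \<comment> \<open>A positive number divided by 0 is \<infinity> in \<open>ereal\<close>, so a
        vanishing norm does no harm.\<close>
      case True
      have "L2_inner \<Omega> q P > 0" using pos SP by (simp add: zero_less_divide_iff)
      then have "?S = \<infinity>" using le unfolding True by (simp add: divide_ereal_def)
      then show ?thesis by simp
    next
      case False
      then have N: "?N > 0" using N0 by simp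
      have "\<theta> * ?A \<le> L2_inner \<Omega> q P / (D * ?N)"
      proof -
        have "\<theta> * ?A * (D * ?N) \<le> \<theta> * ?A * (D * (?C * (1 + ?U) * ?SP))"
          using \<theta> A D(2) wn by (intro mult_left_mono) auto
        also have "\<dots> = \<theta> * D * ?SP"
        proof -
          have "\<theta> * (1 / C / V) * (D * (C * V * S)) = \<theta> * D * S" if "C \<noteq> 0" "V \<noteq> 0" for C V S :: real
            using that by simp
          from this[of ?C "1 + ?U"] show ?thesis using C U0 by simp
        qed
        also have "\<dots> \<le> L2_inner \<Omega> q P" using qP by simp
        finally show ?thesis using D(2) N by (subst pos_le_divide_eq) auto
      qed
      then have "ereal (\<theta> * ?A) \<le> ereal (L2_inner \<Omega> q P / (D * ?N))" by simp
      also have "\<dots> = ereal (L2_inner \<Omega> q P) / ereal (D * ?N)" using D(2) N by simp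
      finally show ?thesis using le by (rule order_trans)
    qed
  qed
  show ?thesis
  proof (rule dense_le)
    fix x :: ereal assume x: "x < ereal ?A"
    show "x \<le> ?S"
    proof (cases x)
      case (real y)
      \<comment> \<open>The value 1/2 keeps \<theta> positive when \<open>y\<close> is not.\<close>
      define \<theta> where "\<theta> = max (1/2) (y / ?A)"
      have "y < ?A" using x unfolding real by (simp only: less_ereal.simps)
      then have "y / ?A < 1" using A by (simp only: divide_less_eq_1_pos)
      then have \<theta>: "0 < \<theta>" "\<theta> < 1" by (auto simp: \<theta>_def)
      have "y = y / a * a" if "a > 0" for a :: real using that by simp
      from this[OF A] have "y = y / ?A * ?A" .
      also have "\<dots> \<le> \<theta> * ?A" using A by (intro mult_right_mono) (auto simp: \<theta>_def)
      finally have "x \<le> ereal (\<theta> * ?A)" using real by simp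
      then show ?thesis using key[OF \<theta>] by (rule order_trans)
    qed (use x in auto)
  qed
qed

end

section \<open>From the assumptions on the family to \<open>fe_mesh\<close>, and the
  conclusion\<close>

lemma polyhedral_frontier_negligible:
  fixes \<Omega> :: "(real^'n) set"
  assumes "polyhedral_boundary \<Omega>"
  shows "negligible (frontier \<Omega>)"
proof -
  obtain \<F> where F: "finite \<F>" "\<And>F. F \<in> \<F> \<Longrightarrow> polytope F \<and> aff_dim F = int CARD('n) - 1" "frontier \<Omega> = \<Union>\<F>"
    using assms unfolding polyhedral_boundary_def by metis
  have "negligible F" if "F \<in> \<F>" for F
  proof -
    \<comment> \<open>A face of dimension n - 1 has no interior, so it lies in its own frontier,
      which is null by convexity.\<close>
    have "interior F = {}" using aff_dim_nonempty_interior[of F] F(2)[OF that] by force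
    then have "F \<subseteq> frontier F" using closure_subset by (auto simp: frontier_def)
    then show ?thesis using negligible_convex_frontier[OF polytope_imp_convex] F(2)[OF that] negligible_subset
        by blast
  qed
  then show ?thesis unfolding F(3) using F(1) by (intro negligible_Union) auto
qed

lemma full_simplex_interior:
  fixes K :: "(real^'n) set"
  assumes "int CARD('n) simplex K"
  shows "interior K \<noteq> {}"
proof -
  have "aff_dim K = int DIM(real^'n)" using aff_dim_simplex[OF assms] by simp
  then have "affine hull K = UNIV" using aff_dim_eq_full[of K] by blast
  moreover have "K \<noteq> {}" using assms by (metis of_nat_0_le_iff simplex_empty zero_neq_neg_one neg_0_le_iff_le
      not_one_le_zero)
  then have "rel_interior K \<noteq> {}" using convex_simplex[OF assms] by (simp add: rel_interior_eq_empty)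
  ultimately show ?thesis by (simp add: rel_interior_interior)
qed

lemma quasi_uniform_fe_mesh:
  fixes \<Omega> :: "(real^'n) set"
  assumes dom: "polyhedral_lipschitz_domain \<Omega>" and H: "H \<subseteq> {0<..}"
    and tri: "\<And>h. h \<in> H \<Longrightarrow> conforming_triangulation \<Omega> (\<T> h)"
    and mesh: "\<And>h. h \<in> H \<Longrightarrow> h = mesh_size (\<T> h)"
    and sr: "shape_regular H \<T>" and qu: "quasi_uniform H \<T>"
  obtains c where "\<And>h. h \<in> H \<Longrightarrow> fe_mesh \<Omega> (\<T> h) h c" "c > 0"
proof -
  obtain \<sigma> where \<sigma>: "\<sigma> > 0" "\<And>h K. h \<in> H \<Longrightarrow> K \<in> \<T> h \<Longrightarrow> diameter K \<le> \<sigma> * inball_diameter K"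
    using sr unfolding shape_regular_def by blast
  obtain \<tau> where \<tau>: "\<tau> > 0" "\<And>h K. h \<in> H \<Longrightarrow> K \<in> \<T> h \<Longrightarrow> \<tau> * mesh_size (\<T> h) \<le> diameter K"
    using qu unfolding quasi_uniform_def by blast
  \<comment> \<open>The two regularity constants give \<tau> h \<le> \<sigma> times the inball
    diameter, which is therefore at least 4 c h. One factor 2 passes to radii; the other leaves room
    below a supremum that is only approached.\<close>
  define c where "c = \<tau> / (4 * \<sigma>)"
  have c: "c > 0" using \<sigma> \<tau> by (simp add: c_def)
  have "fe_mesh \<Omega> (\<T> h) h c" if h: "h \<in> H" for h
  proof
    show "conforming_triangulation \<Omega> (\<T> h)" by (rule tri[OF h])
    show "open \<Omega>" "bounded \<Omega>" "\<Omega> \<noteq> {}" using dom by (auto simp: polyhedral_lipschitz_domain_def)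
    show "negligible (frontier \<Omega>)" using dom by (intro polyhedral_frontier_negligible)
        (simp add: polyhedral_lipschitz_domain_def)
    show hp: "h > 0" using H h by auto
    show "c > 0" by (rule c)
    have fin: "finite (\<T> h)" using tri[OF h] by (simp add: conforming_triangulation_def triangulation_def)
    fix K assume K: "K \<in> \<T> h"
    have "diameter K \<le> mesh_size (\<T> h)" unfolding mesh_size_def by (rule Max_ge) (use fin K in auto)
    then show "diameter K \<le> h" by (rule ord_le_eq_trans[OF _ mesh[OF h, symmetric]])
    have "interior K \<noteq> {}" using tri[OF h] K by (intro full_simplex_interior) (simp add: conforming_triangulation_def)
    then obtain x where "x \<in> interior K" by blast
    then obtain \<rho> where "\<rho> > 0" "cball x \<rho> \<subseteq> K" using mem_interior_cball by blast
    \<comment> \<open>An element of full dimension contains some ball, so the supremum is not over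
      the empty set.\<close>
    then have ne: "{2 * r | r c. 0 < r \<and> cball c r \<subseteq> K} \<noteq> {}" by blast
    have "\<tau> * h \<le> \<sigma> * inball_diameter K" using \<tau>(2)[OF h K] \<sigma>(2)[OF h K] mesh[OF h, symmetric] by simp
    then have "\<tau> * h / \<sigma> \<le> inball_diameter K" using \<sigma>(1) by (simp add: pos_divide_le_eq mult.commute)
    moreover have "2 * (c * h) < \<tau> * h / \<sigma>" using \<sigma>(1) \<tau>(1) hp by (simp add: c_def field_simps)
    ultimately have "2 * (c * h) < Sup {2 * r | r c. 0 < r \<and> cball c r \<subseteq> K}" unfolding inball_diameter_def by linarith
    then obtain x where "x \<in> {2 * r | r c. 0 < r \<and> cball c r \<subseteq> K}" "2 * (c * h) < x"
      by (rule less_cSupE[OF _ ne]) (rule that)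
    then obtain r y where "cball y r \<subseteq> K" "c * h < r" by auto
    then have "cball y (c * h) \<subseteq> K" by (meson less_imp_le order_trans subset_cball)
    then show "\<exists>x. cball x (c * h) \<subseteq> K" by blast
  qed
  then show ?thesis using that c by blast
qed

theorem lemma4p7:
  fixes \<Omega> :: "(real^'n) set"
    and H :: "real set"
    and \<T> :: "real \<Rightarrow> (real^'n) set set"
    and u0 :: "real^'n \<Rightarrow> real^'n"
    and u0h :: "real \<Rightarrow> real^'n \<Rightarrow> real^'n"
  assumes "CARD('n) \<in> {2, 3}"
    and "polyhedral_lipschitz_domain \<Omega>"
    and "H \<subseteq> {0<..}"
    and "\<And>h. h \<in> H \<Longrightarrow> conforming_triangulation \<Omega> (\<T> h)"
    and "\<And>h. h \<in> H \<Longrightarrow> h = mesh_size (\<T> h)"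
    and "shape_regular H \<T>"
    and "quasi_uniform H \<T>"
    and "u0 \<in> H1_vec_space \<Omega>"
    and "AE x in lebesgue_on \<Omega>. norm (u0 x) = 1"
    and "\<And>h. h \<in> H \<Longrightarrow> u0h h \<in> fe_vec_space \<Omega> (\<T> h)"
    and "\<And>h a. h \<in> H \<Longrightarrow> a \<in> mesh_nodes (\<T> h) \<Longrightarrow> norm (u0h h a) = 1"
    and "\<And>h. h \<in> H \<Longrightarrow> L2_norm \<Omega> (weak_grad_vec \<Omega> (u0h h)) \<le> L2_norm \<Omega> (weak_grad_vec \<Omega> u0)"
  shows "\<exists>C>0. \<forall>h\<in>H. \<forall>u\<in>fe_vec_space \<Omega> (\<T> h).
           (\<forall>a\<in>mesh_nodes (\<T> h). norm (u a) = 1) \<longrightarrow>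
           ereal (C / (1 + L2_norm \<Omega> (weak_grad_vec \<Omega> u)))
             \<le> (INF q \<in> fe_space \<Omega> (\<T> h) - {\<lambda>_. 0}.
                  SUP w \<in> fe_vec_space \<Omega> (\<T> h) - {\<lambda>_. 0}.
                    ereal (L2_inner \<Omega> q (nodal_interp \<Omega> (\<T> h) (\<lambda>x. u x \<bullet> w x)))
                      / (dual_norm \<Omega> q * ereal (L2_norm \<Omega> (weak_grad_vec \<Omega> w) + Linf_norm \<Omega> w)))"
proof -
  obtain c where mesh: "\<And>h. h \<in> H \<Longrightarrow> fe_mesh \<Omega> (\<T> h) h c" and c: "c > 0"
    using quasi_uniform_fe_mesh[OF assms(2-7)] by metis
  have dom: "open \<Omega>" "bounded \<Omega>" "lipschitz_boundary \<Omega>"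
    using assms(2) by (auto simp: polyhedral_lipschitz_domain_def)
  obtain d k where dk: "d > 0" "0 < k" "k \<le> 1"
    and cone: "uniform_cone \<Omega> d k"
    by (rule uniform_interior_cone[OF dom]) (rule that)
  \<comment> \<open>All of \<open>c\<close>, \<open>d\<close> and \<open>k\<close> are fixed before
    \<open>h\<close> and \<open>u\<close>, so this constant depends only on the domain and the
    family.\<close>
  let ?C = "1 / inf_sup_const CARD('n) c d k (measure lebesgue \<Omega>)"
  have "?C > 0" unfolding inf_sup_const_def
    using c dk(2) stability_const_nonneg[of c k "measure lebesgue \<Omega>" "CARD('n)" d]
    by (intro divide_pos_pos add_pos_nonneg) auto
  moreover have "ereal (?C / (1 + L2_norm \<Omega> (weak_grad_vec \<Omega> u)))
             \<le> (INF q \<in> fe_space \<Omega> (\<T> h) - {\<lambda>_. 0}.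
                  SUP w \<in> fe_vec_space \<Omega> (\<T> h) - {\<lambda>_. 0}.
                    ereal (L2_inner \<Omega> q (nodal_interp \<Omega> (\<T> h) (\<lambda>x. u x \<bullet> w x)))
                      / (dual_norm \<Omega> q * ereal (L2_norm \<Omega> (weak_grad_vec \<Omega> w) + Linf_norm \<Omega> w)))"
    if "h \<in> H" "u \<in> fe_vec_space \<Omega> (\<T> h)" "\<forall>a\<in>mesh_nodes (\<T> h). norm (u a) = 1" for h u
    by (intro INF_greatest fe_mesh.inf_sup_condition[OF mesh[OF that(1)] that(2) _ cone dk(2,3,1)])
      (use that(3) in auto)
  ultimately show ?thesis by blast
qed


end
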